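(* Let $\mathbf{C}$ be a complete and cocomplete category and let $I$ be a set of maps of $\mathbf{C}$ such that the domains and the codomains of maps in $I$ are small relative to $I\text{-}\mathrm{cell}$. For every $i : U \to V$ in $I$, let $C_U(V)$ (with $\iota_0,\iota_1 : V \to C_U(V)$) be a chosen reflexive relative cylinder object for $i$ such that $[\iota_0,\iota_1] : V \amalg_U V \to C_U(V)$ belongs to $I\text{-}\mathrm{cof}$. Let $J_I = \{\iota_0 : V \to C_U(V) \mid (i : U \to V) \in I\}$, and let $\mathcal{W}_I$ be the class of maps that have the RLP up to $\sim_i$ with respect to every $i \in I$. Consider the condition ( * ) for every composable pair of maps $f \in J_I\text{-}\mathrm{cell}$ and $g$, if $g \circ f \in \mathcal{W}_I$, then $g \in \mathcal{W}_I$. Then ( * ) holds if and only if for every object $X$ of $\mathbf{C}$ there exists a path object $P(X)$, with maps $p_0,p_1 : P(X) \to X$, such that the following conditions hold: (1) For every $f : X \to Y$, there exists a morphism of path objects $(f, P(f)) : P(X) \to P(Y)$. (2) Either $p_1$ has the RLP with respect to $I$, or there exists a map $s : P(X) \to P(X)$ such that $p_0 \circ s = p_1$ and $p_1 \circ s = p_0$. (3) $p_0$ has the RLP with respect to $I$. (4) Either the path objects are reflexive and the maps $\langle p_0,p_1\rangle : P(X) \to X \times X$ have the RLP with respect to $J_I$, or maps in $J_I\text{-}\mathrm{cell}$ have the RLP up to $\sim^r$ with respect to the domains of maps in $I$.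
   Context: A relative cylinder object for $i : U \to V$ is an object $C_U(V)$ with maps $\iota_0,\iota_1 : V \to C_U(V)$ such that $\iota_0 \circ i = \iota_1 \circ i$; it is reflexive if there is a map $s : C_U(V) \to V$ with $s \circ \iota_0 = s \circ \iota_1 = \mathrm{id}_V$. For $a,b : V \to Y$, write $a \sim_i b$ if there is $h : C_U(V) \to Y$ with $h \circ \iota_0 = a$ and $h \circ \iota_1 = b$. A path object for $X$ is any object $P(X)$ together with maps $p_0,p_1 : P(X) \to X$; it is reflexive if there is $t : X \to P(X)$ with $p_0 \circ t = p_1 \circ t = \mathrm{id}_X$. A morphism of path objects $P(X) \to P(Y)$ is a pair of maps $f : X \to Y$ and $P(f) : P(X) \to P(Y)$ commuting with $p_0$ and with $p_1$. (In condition (1), only existence of $P(f)$ is required, not functoriality.) For $a,b : V \to X$, write $a \sim^r b$ if there is $h : V \to P(X)$ with $p_0 \circ h = a$ and $p_1 \circ h = b$. For a relation $R$ on $\mathbf{C}(V,Y)$, a map $f : X \to Y$ has the RLP up to $R$ with respect to $i : U \to V$ if for all $u : U \to X$, $v : V \to Y$ with $f \circ u = v \circ i$ there is $k : V \to X$ with $k \circ i = u$ and $(f \circ k)\,R\,v$. A map has the RLP up to $R$ with respect to an object $U$ if it has it with respect to the map $0 \to U$ from the initial object; i.e. for every $u : U \to Y$ there is $u' : U \to X$ with $(f \circ u')\,R\,u$. For a class $K$ of maps: $K\text{-}\mathrm{inj}$ is the class of maps with the RLP with respect to all maps in $K$; $K\text{-}\mathrm{cof}$ is the class of maps with the LLP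 with respect to all maps in $K\text{-}\mathrm{inj}$; $K\text{-}\mathrm{cell}$ is the class of transfinite compositions of pushouts of elements of $K$. *)

theory Defs
  imports Main
begin

unbundle cardinal_syntax

(* Size. A type 'u of strongly inaccessible cardinality plays the role of the universe: a
   collection, of any type, is small (a "set" rather than a class) if it has fewer elements than
   'u. Up to isomorphism the small ordinals are then the well-orders on small subsets of 'u and
   the small categories are those whose objects and arrows form small subsets of 'u. *)

definition universe :: "'u itself \<Rightarrow> bool" where
  "universe _ \<longleftrightarrow> |UNIV :: nat set| <o |UNIV :: 'u set| \<and> regularCard |UNIV :: 'u set| \<and>
     (\<forall>A :: 'u set. |A| <o |UNIV :: 'u set| \<longrightarrow> |Pow A| <o |UNIV :: 'u set| )"

definition small :: "'u itself \<Rightarrow> 'a set \<Rightarrow> bool" where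
  "small _ A \<longleftrightarrow> |A| <o |UNIV :: 'u set|"


section \<open>Categories, diagrams, limits and colimits\<close>

record ('o, 'm) cat =
  Obj :: "'o set"
  Arr :: "'m set"
  Dom :: "'m \<Rightarrow> 'o"
  Cod :: "'m \<Rightarrow> 'o"
  Id :: "'o \<Rightarrow> 'm"
  Comp :: "'m \<Rightarrow> 'm \<Rightarrow> 'm"  (infixl "\<cdot>\<index>" 70)

definition hom :: "('o, 'm) cat \<Rightarrow> 'o \<Rightarrow> 'o \<Rightarrow> 'm set" where
  "hom C X Y = {f \<in> Arr C. Dom C f = X \<and> Cod C f = Y}"

locale category =
  fixes C :: "('o, 'm) cat" (structure)
  assumes Dom_Obj: "f \<in> Arr C \<Longrightarrow> Dom C f \<in> Obj C"
    and Cod_Obj: "f \<in> Arr C \<Longrightarrow> Cod C f \<in> Obj C"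
    and Id_hom: "X \<in> Obj C \<Longrightarrow> Id C X \<in> hom C X X"
    and Comp_hom: "f \<in> hom C X Y \<Longrightarrow> g \<in> hom C Y Z \<Longrightarrow> g \<cdot> f \<in> hom C X Z"
    and Comp_Id: "f \<in> hom C X Y \<Longrightarrow> f \<cdot> Id C X = f"
    and Id_Comp: "f \<in> hom C X Y \<Longrightarrow> Id C Y \<cdot> f = f"
    and Comp_assoc: "f \<in> hom C X Y \<Longrightarrow> g \<in> hom C Y Z \<Longrightarrow> h \<in> hom C Z W \<Longrightarrow>
      h \<cdot> (g \<cdot> f) = (h \<cdot> g) \<cdot> f"

definition locally_small :: "'u itself \<Rightarrow> ('o, 'm) cat \<Rightarrow> bool" where
  "locally_small u C \<longleftrightarrow> (\<forall>X \<in> Obj C. \<forall>Y \<in> Obj C. small u (hom C X Y))"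

definition small_category :: "'u itself \<Rightarrow> ('j, 'k) cat \<Rightarrow> bool" where
  "small_category u J \<longleftrightarrow> category J \<and> small u (Obj J) \<and> small u (Arr J)"

definition is_functor ::
  "('j, 'k) cat \<Rightarrow> ('o, 'm) cat \<Rightarrow> ('j \<Rightarrow> 'o) \<Rightarrow> ('k \<Rightarrow> 'm) \<Rightarrow> bool" where
  "is_functor J C F \<phi> \<longleftrightarrow>
     (\<forall>j \<in> Obj J. F j \<in> Obj C) \<and>
     (\<forall>a \<in> Arr J. \<phi> a \<in> hom C (F (Dom J a)) (F (Cod J a))) \<and>
     (\<forall>j \<in> Obj J. \<phi> (Id J j) = Id C (F j)) \<and>
     (\<forall>a \<in> Arr J. \<forall>b \<in> Arr J. Dom J b = Cod J a \<longrightarrow> \<phi> (b \<cdot>\<^bsub>J\<^esub> a) = \<phi> b \<cdot>\<^bsub>C\<^esub> \<phi> a)"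

definition is_cone ::
  "('j, 'k) cat \<Rightarrow> ('o, 'm) cat \<Rightarrow> ('j \<Rightarrow> 'o) \<Rightarrow> ('k \<Rightarrow> 'm) \<Rightarrow> 'o \<Rightarrow> ('j \<Rightarrow> 'm) \<Rightarrow> bool" where
  "is_cone J C F \<phi> L \<pi> \<longleftrightarrow>
     L \<in> Obj C \<and> (\<forall>j \<in> Obj J. \<pi> j \<in> hom C L (F j)) \<and>
     (\<forall>a \<in> Arr J. \<phi> a \<cdot>\<^bsub>C\<^esub> \<pi> (Dom J a) = \<pi> (Cod J a))"

definition is_limit ::
  "('j, 'k) cat \<Rightarrow> ('o, 'm) cat \<Rightarrow> ('j \<Rightarrow> 'o) \<Rightarrow> ('k \<Rightarrow> 'm) \<Rightarrow> 'o \<Rightarrow> ('j \<Rightarrow> 'm) \<Rightarrow> bool" where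
  "is_limit J C F \<phi> L \<pi> \<longleftrightarrow> is_cone J C F \<phi> L \<pi> \<and>
     (\<forall>M \<rho>. is_cone J C F \<phi> M \<rho> \<longrightarrow>
        (\<exists>!h. h \<in> hom C M L \<and> (\<forall>j \<in> Obj J. \<pi> j \<cdot>\<^bsub>C\<^esub> h = \<rho> j)))"

definition is_cocone ::
  "('j, 'k) cat \<Rightarrow> ('o, 'm) cat \<Rightarrow> ('j \<Rightarrow> 'o) \<Rightarrow> ('k \<Rightarrow> 'm) \<Rightarrow> 'o \<Rightarrow> ('j \<Rightarrow> 'm) \<Rightarrow> bool" where
  "is_cocone J C F \<phi> L \<kappa> \<longleftrightarrow>
     L \<in> Obj C \<and> (\<forall>j \<in> Obj J. \<kappa> j \<in> hom C (F j) L) \<and>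
     (\<forall>a \<in> Arr J. \<kappa> (Cod J a) \<cdot>\<^bsub>C\<^esub> \<phi> a = \<kappa> (Dom J a))"

definition is_colimit ::
  "('j, 'k) cat \<Rightarrow> ('o, 'm) cat \<Rightarrow> ('j \<Rightarrow> 'o) \<Rightarrow> ('k \<Rightarrow> 'm) \<Rightarrow> 'o \<Rightarrow> ('j \<Rightarrow> 'm) \<Rightarrow> bool" where
  "is_colimit J C F \<phi> L \<kappa> \<longleftrightarrow> is_cocone J C F \<phi> L \<kappa> \<and>
     (\<forall>M \<rho>. is_cocone J C F \<phi> M \<rho> \<longrightarrow>
        (\<exists>!h. h \<in> hom C L M \<and> (\<forall>j \<in> Obj J. h \<cdot>\<^bsub>C\<^esub> \<kappa> j = \<rho> j)))"

definition complete :: "'u itself \<Rightarrow> ('o, 'm) cat \<Rightarrow> bool" where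
  "complete u C \<longleftrightarrow> (\<forall>(J :: ('u, 'u) cat) F \<phi>.
     small_category u J \<and> is_functor J C F \<phi> \<longrightarrow> (\<exists>L \<pi>. is_limit J C F \<phi> L \<pi>))"

definition cocomplete :: "'u itself \<Rightarrow> ('o, 'm) cat \<Rightarrow> bool" where
  "cocomplete u C \<longleftrightarrow> (\<forall>(J :: ('u, 'u) cat) F \<phi>.
     small_category u J \<and> is_functor J C F \<phi> \<longrightarrow> (\<exists>L \<kappa>. is_colimit J C F \<phi> L \<kappa>))"

definition is_initial :: "('o, 'm) cat \<Rightarrow> 'o \<Rightarrow> bool" where
  "is_initial C Z \<longleftrightarrow> Z \<in> Obj C \<and> (\<forall>X \<in> Obj C. \<exists>!h. h \<in> hom C Z X)"

definition is_product :: "('o, 'm) cat \<Rightarrow> 'o \<Rightarrow> 'o \<Rightarrow> 'o \<Rightarrow> 'm \<Rightarrow> 'm \<Rightarrow> bool" where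
  "is_product C X Y Q q\<^sub>0 q\<^sub>1 \<longleftrightarrow>
     Q \<in> Obj C \<and> q\<^sub>0 \<in> hom C Q X \<and> q\<^sub>1 \<in> hom C Q Y \<and>
     (\<forall>T \<in> Obj C. \<forall>a \<in> hom C T X. \<forall>b \<in> hom C T Y.
        \<exists>!h. h \<in> hom C T Q \<and> q\<^sub>0 \<cdot>\<^bsub>C\<^esub> h = a \<and> q\<^sub>1 \<cdot>\<^bsub>C\<^esub> h = b)"

(* j0 : B -> P and j1 : B' -> P exhibit P as the pushout of f : A -> B and g : A -> B'. *)
definition is_pushout :: "('o, 'm) cat \<Rightarrow> 'm \<Rightarrow> 'm \<Rightarrow> 'o \<Rightarrow> 'm \<Rightarrow> 'm \<Rightarrow> bool" where
  "is_pushout C f g P j\<^sub>0 j\<^sub>1 \<longleftrightarrow>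
     f \<in> Arr C \<and> g \<in> Arr C \<and> Dom C f = Dom C g \<and> P \<in> Obj C \<and>
     j\<^sub>0 \<in> hom C (Cod C f) P \<and> j\<^sub>1 \<in> hom C (Cod C g) P \<and> j\<^sub>0 \<cdot>\<^bsub>C\<^esub> f = j\<^sub>1 \<cdot>\<^bsub>C\<^esub> g \<and>
     (\<forall>T \<in> Obj C. \<forall>a \<in> hom C (Cod C f) T. \<forall>b \<in> hom C (Cod C g) T. a \<cdot>\<^bsub>C\<^esub> f = b \<cdot>\<^bsub>C\<^esub> g \<longrightarrow>
        (\<exists>!h. h \<in> hom C P T \<and> h \<cdot>\<^bsub>C\<^esub> j\<^sub>0 = a \<and> h \<cdot>\<^bsub>C\<^esub> j\<^sub>1 = b))"


section \<open>Lifting properties\<close>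

text \<open>A relation up to which a lifting property is taken is given on all parallel arrows at once.\<close>

definition rlp_upto :: "('o, 'm) cat \<Rightarrow> ('m \<Rightarrow> 'm \<Rightarrow> bool) \<Rightarrow> 'm \<Rightarrow> 'm \<Rightarrow> bool" where
  "rlp_upto C R i f \<longleftrightarrow>
     (\<forall>u \<in> hom C (Dom C i) (Dom C f). \<forall>v \<in> hom C (Cod C i) (Cod C f).
        f \<cdot>\<^bsub>C\<^esub> u = v \<cdot>\<^bsub>C\<^esub> i \<longrightarrow>
        (\<exists>k \<in> hom C (Cod C i) (Dom C f). k \<cdot>\<^bsub>C\<^esub> i = u \<and> R (f \<cdot>\<^bsub>C\<^esub> k) v))"

definition rlp_upto_obj :: "('o, 'm) cat \<Rightarrow> ('m \<Rightarrow> 'm \<Rightarrow> bool) \<Rightarrow> 'o \<Rightarrow> 'm \<Rightarrow> bool" where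
  "rlp_upto_obj C R U f \<longleftrightarrow> (\<forall>Z z. is_initial C Z \<and> z \<in> hom C Z U \<longrightarrow> rlp_upto C R z f)"

definition rlp :: "('o, 'm) cat \<Rightarrow> 'm \<Rightarrow> 'm \<Rightarrow> bool" where
  "rlp C i f \<longleftrightarrow>
     (\<forall>u \<in> hom C (Dom C i) (Dom C f). \<forall>v \<in> hom C (Cod C i) (Cod C f).
        f \<cdot>\<^bsub>C\<^esub> u = v \<cdot>\<^bsub>C\<^esub> i \<longrightarrow>
        (\<exists>k \<in> hom C (Cod C i) (Dom C f). k \<cdot>\<^bsub>C\<^esub> i = u \<and> f \<cdot>\<^bsub>C\<^esub> k = v))"

definition inj_class :: "('o, 'm) cat \<Rightarrow> 'm set \<Rightarrow> 'm set" where
  "inj_class C K = {f \<in> Arr C. \<forall>i \<in> K. rlp C i f}"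

definition cof_class :: "('o, 'm) cat \<Rightarrow> 'm set \<Rightarrow> 'm set" where
  "cof_class C K = {i \<in> Arr C. \<forall>f \<in> inj_class C K. rlp C i f}"


section \<open>Transfinite compositions, cell complexes, smallness\<close>

text \<open>A well-order r, given by its weak order relation, as a poset category; the arrow from
  a to b is the pair (a, b).\<close>

definition order_cat :: "'j rel \<Rightarrow> ('j, 'j \<times> 'j) cat" where
  "order_cat r = \<lparr>Obj = Field r, Arr = r, Dom = fst, Cod = snd,
     Id = (\<lambda>a. (a, a)), Comp = (\<lambda>g f. (fst f, snd g))\<rparr>"

definition small_ordinal :: "'u rel \<Rightarrow> bool" where
  "small_ordinal r \<longleftrightarrow> Well_order r \<and> small TYPE('u) (Field r)"

definition is_zero :: "'j rel \<Rightarrow> 'j \<Rightarrow> bool" where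
  "is_zero r a \<longleftrightarrow> a \<in> Field r \<and> (\<forall>b \<in> Field r. (a, b) \<in> r)"

definition is_succ :: "'j rel \<Rightarrow> 'j \<Rightarrow> 'j \<Rightarrow> bool" where
  "is_succ r a b \<longleftrightarrow> (a, b) \<in> r \<and> a \<noteq> b \<and> (\<forall>c. (a, c) \<in> r \<and> (c, b) \<in> r \<longrightarrow> c = a \<or> c = b)"

definition is_limit_elem :: "'j rel \<Rightarrow> 'j \<Rightarrow> bool" where
  "is_limit_elem r b \<longleftrightarrow> b \<in> Field r \<and> \<not> is_zero r b \<and> \<not> (\<exists>a. is_succ r a b)"

definition transfinite_seq ::
  "('o, 'm) cat \<Rightarrow> 'u rel \<Rightarrow> ('u \<Rightarrow> 'o) \<Rightarrow> ('u \<times> 'u \<Rightarrow> 'm) \<Rightarrow> bool" where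
  "transfinite_seq C r X \<phi> \<longleftrightarrow> small_ordinal r \<and> is_functor (order_cat r) C X \<phi> \<and>
     (\<forall>b. is_limit_elem r b \<longrightarrow>
        is_colimit (order_cat (Restr r (underS r b))) C X \<phi> (X b) (\<lambda>a. \<phi> (a, b)))"

definition steps_in :: "'u rel \<Rightarrow> ('u \<times> 'u \<Rightarrow> 'm) \<Rightarrow> 'm set \<Rightarrow> bool" where
  "steps_in r \<phi> D \<longleftrightarrow> (\<forall>a b. is_succ r a b \<longrightarrow> \<phi> (a, b) \<in> D)"

text \<open>All colimits are allowed, not only chosen ones, so that isomorphisms occur as compositions
  of length one.\<close>

definition transfinite_compositions ::
  "'u itself \<Rightarrow> ('o, 'm) cat \<Rightarrow> 'm set \<Rightarrow> 'm set" where
  "transfinite_compositions _ C D =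
     {f. \<exists>(r :: 'u rel) X \<phi> L \<kappa> z. transfinite_seq C r X \<phi> \<and> steps_in r \<phi> D \<and>
        is_colimit (order_cat r) C X \<phi> L \<kappa> \<and> is_zero r z \<and> f = \<kappa> z}"

definition pushouts :: "('o, 'm) cat \<Rightarrow> 'm set \<Rightarrow> 'm set" where
  "pushouts C K = {f. \<exists>i \<in> K. \<exists>a P b. is_pushout C i a P b f}"

definition cell_class :: "'u itself \<Rightarrow> ('o, 'm) cat \<Rightarrow> 'm set \<Rightarrow> 'm set" where
  "cell_class u C K = transfinite_compositions u C (pushouts C K)"

text \<open>A limit ordinal r in which every subset of cardinality at most that of S has its supremum
  below r.\<close>

definition filtered_ordinal :: "'u set \<Rightarrow> 'u rel \<Rightarrow> bool" where
  "filtered_ordinal S r \<longleftrightarrow> small_ordinal r \<and> Field r \<noteq> {} \<and>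
     (\<forall>a \<in> Field r. \<exists>b. (a, b) \<in> r \<and> a \<noteq> b) \<and>
     (\<forall>A. A \<subseteq> Field r \<and> |A| \<le>o |S| \<longrightarrow> (\<exists>b \<in> Field r. \<forall>a \<in> A. (a, b) \<in> r))"

text \<open>The colimit of the sets \<open>hom C A (X a)\<close>, as a quotient of their disjoint union.\<close>

definition hom_seq :: "('o, 'm) cat \<Rightarrow> 'o \<Rightarrow> 'u rel \<Rightarrow> ('u \<Rightarrow> 'o) \<Rightarrow> ('u \<times> 'm) set" where
  "hom_seq C A r X = (SIGMA a : Field r. hom C A (X a))"

definition hom_colim ::
  "('o, 'm) cat \<Rightarrow> 'o \<Rightarrow> 'u rel \<Rightarrow> ('u \<Rightarrow> 'o) \<Rightarrow> ('u \<times> 'u \<Rightarrow> 'm) \<Rightarrow> ('u \<times> 'm) set set" where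
  "hom_colim C A r X \<phi> = hom_seq C A r X //
     {((a, g), (b, h)). (a, g) \<in> hom_seq C A r X \<and> (b, h) \<in> hom_seq C A r X \<and>
        (\<exists>c. (a, c) \<in> r \<and> (b, c) \<in> r \<and> \<phi> (a, c) \<cdot>\<^bsub>C\<^esub> g = \<phi> (b, c) \<cdot>\<^bsub>C\<^esub> h)}"

text \<open>The canonical map from \<open>hom_colim\<close> to \<open>hom C A L\<close> sends the class of \<open>(a, g)\<close> to the
  composite of g with the a-th colimit injection; it is constant on classes.\<close>

definition small_relative :: "'u itself \<Rightarrow> ('o, 'm) cat \<Rightarrow> 'm set \<Rightarrow> 'o \<Rightarrow> bool" where
  "small_relative u C D A \<longleftrightarrow> (\<exists>S :: 'u set. small u S \<and>
     (\<forall>r X \<phi> L \<kappa>. filtered_ordinal S r \<and> transfinite_seq C r X \<phi> \<and> steps_in r \<phi> D \<and>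
        is_colimit (order_cat r) C X \<phi> L \<kappa> \<longrightarrow>
        bij_betw (\<lambda>c. the_elem ((\<lambda>(a, g). \<kappa> a \<cdot>\<^bsub>C\<^esub> g) ` c)) (hom_colim C A r X \<phi>) (hom C A L)))"


section \<open>Relative cylinder objects and path objects\<close>

definition rel_cylinder :: "('o, 'm) cat \<Rightarrow> 'm \<Rightarrow> 'o \<Rightarrow> 'm \<Rightarrow> 'm \<Rightarrow> bool" where
  "rel_cylinder C i K \<iota>\<^sub>0 \<iota>\<^sub>1 \<longleftrightarrow> i \<in> Arr C \<and> K \<in> Obj C \<and>
     \<iota>\<^sub>0 \<in> hom C (Cod C i) K \<and> \<iota>\<^sub>1 \<in> hom C (Cod C i) K \<and> \<iota>\<^sub>0 \<cdot>\<^bsub>C\<^esub> i = \<iota>\<^sub>1 \<cdot>\<^bsub>C\<^esub> i"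

definition reflexive_cylinder :: "('o, 'm) cat \<Rightarrow> 'm \<Rightarrow> 'o \<Rightarrow> 'm \<Rightarrow> 'm \<Rightarrow> bool" where
  "reflexive_cylinder C i K \<iota>\<^sub>0 \<iota>\<^sub>1 \<longleftrightarrow> rel_cylinder C i K \<iota>\<^sub>0 \<iota>\<^sub>1 \<and>
     (\<exists>s \<in> hom C K (Cod C i). s \<cdot>\<^bsub>C\<^esub> \<iota>\<^sub>0 = Id C (Cod C i) \<and> s \<cdot>\<^bsub>C\<^esub> \<iota>\<^sub>1 = Id C (Cod C i))"

text \<open>The map from the pushout of i along itself to the cylinder belongs to the class D (which
  will be closed under isomorphism, so that the choice of pushout is immaterial).\<close>

definition copairing_in :: "('o, 'm) cat \<Rightarrow> 'm set \<Rightarrow> 'm \<Rightarrow> 'o \<Rightarrow> 'm \<Rightarrow> 'm \<Rightarrow> bool" where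
  "copairing_in C D i K \<iota>\<^sub>0 \<iota>\<^sub>1 \<longleftrightarrow> (\<forall>Q j\<^sub>0 j\<^sub>1. is_pushout C i i Q j\<^sub>0 j\<^sub>1 \<longrightarrow>
     (\<forall>h \<in> hom C Q K. h \<cdot>\<^bsub>C\<^esub> j\<^sub>0 = \<iota>\<^sub>0 \<and> h \<cdot>\<^bsub>C\<^esub> j\<^sub>1 = \<iota>\<^sub>1 \<longrightarrow> h \<in> D))"

definition cyl_sim :: "('o, 'm) cat \<Rightarrow> 'o \<Rightarrow> 'm \<Rightarrow> 'm \<Rightarrow> 'm \<Rightarrow> 'm \<Rightarrow> bool" where
  "cyl_sim C K \<iota>\<^sub>0 \<iota>\<^sub>1 a b \<longleftrightarrow> (\<exists>h \<in> hom C K (Cod C a). h \<cdot>\<^bsub>C\<^esub> \<iota>\<^sub>0 = a \<and> h \<cdot>\<^bsub>C\<^esub> \<iota>\<^sub>1 = b)"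

definition W_class ::
  "('o, 'm) cat \<Rightarrow> 'm set \<Rightarrow> ('m \<Rightarrow> 'o) \<Rightarrow> ('m \<Rightarrow> 'm) \<Rightarrow> ('m \<Rightarrow> 'm) \<Rightarrow> 'm set" where
  "W_class C I Cyl \<iota>\<^sub>0 \<iota>\<^sub>1 =
     {f \<in> Arr C. \<forall>i \<in> I. rlp_upto C (cyl_sim C (Cyl i) (\<iota>\<^sub>0 i) (\<iota>\<^sub>1 i)) i f}"

definition path_object :: "('o, 'm) cat \<Rightarrow> 'o \<Rightarrow> 'o \<Rightarrow> 'm \<Rightarrow> 'm \<Rightarrow> bool" where
  "path_object C X P p\<^sub>0 p\<^sub>1 \<longleftrightarrow> X \<in> Obj C \<and> P \<in> Obj C \<and> p\<^sub>0 \<in> hom C P X \<and> p\<^sub>1 \<in> hom C P X"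

definition reflexive_path_object :: "('o, 'm) cat \<Rightarrow> 'o \<Rightarrow> 'o \<Rightarrow> 'm \<Rightarrow> 'm \<Rightarrow> bool" where
  "reflexive_path_object C X P p\<^sub>0 p\<^sub>1 \<longleftrightarrow> path_object C X P p\<^sub>0 p\<^sub>1 \<and>
     (\<exists>t \<in> hom C X P. p\<^sub>0 \<cdot>\<^bsub>C\<^esub> t = Id C X \<and> p\<^sub>1 \<cdot>\<^bsub>C\<^esub> t = Id C X)"

text \<open>The pair \<open>(f, Pf)\<close> is a morphism from the path object P (with \<open>p\<^sub>0, p\<^sub>1\<close>) of the domain of f
  to the path object Q (with \<open>q\<^sub>0, q\<^sub>1\<close>) of its codomain.\<close>

definition path_morphism ::
  "('o, 'm) cat \<Rightarrow> 'o \<Rightarrow> 'm \<Rightarrow> 'm \<Rightarrow> 'o \<Rightarrow> 'm \<Rightarrow> 'm \<Rightarrow> 'm \<Rightarrow> 'm \<Rightarrow> bool" where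
  "path_morphism C P p\<^sub>0 p\<^sub>1 Q q\<^sub>0 q\<^sub>1 f Pf \<longleftrightarrow> f \<in> Arr C \<and> Pf \<in> hom C P Q \<and>
     q\<^sub>0 \<cdot>\<^bsub>C\<^esub> Pf = f \<cdot>\<^bsub>C\<^esub> p\<^sub>0 \<and> q\<^sub>1 \<cdot>\<^bsub>C\<^esub> Pf = f \<cdot>\<^bsub>C\<^esub> p\<^sub>1"

definition path_sim :: "('o, 'm) cat \<Rightarrow> 'o \<Rightarrow> 'm \<Rightarrow> 'm \<Rightarrow> 'm \<Rightarrow> 'm \<Rightarrow> bool" where
  "path_sim C P p\<^sub>0 p\<^sub>1 a b \<longleftrightarrow> (\<exists>h \<in> hom C (Dom C a) P. p\<^sub>0 \<cdot>\<^bsub>C\<^esub> h = a \<and> p\<^sub>1 \<cdot>\<^bsub>C\<^esub> h = b)"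

definition pairing_rlp :: "('o, 'm) cat \<Rightarrow> 'm set \<Rightarrow> 'o \<Rightarrow> 'o \<Rightarrow> 'm \<Rightarrow> 'm \<Rightarrow> bool" where
  "pairing_rlp C K X P p\<^sub>0 p\<^sub>1 \<longleftrightarrow> (\<forall>Q q\<^sub>0 q\<^sub>1. is_product C X X Q q\<^sub>0 q\<^sub>1 \<longrightarrow>
     (\<forall>h \<in> hom C P Q. q\<^sub>0 \<cdot>\<^bsub>C\<^esub> h = p\<^sub>0 \<and> q\<^sub>1 \<cdot>\<^bsub>C\<^esub> h = p\<^sub>1 \<longrightarrow> (\<forall>j \<in> K. rlp C j h)))"

end

theory Submission
  imports Defs
begin


text \<open>Write J for the set of the maps \<open>\<iota>\<^sub>0 i\<close>. Reflexivity of the cylinders makes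
  every object fibrant: a map defined on V extends along \<open>\<iota>\<^sub>0 : V \<rightarrow> C\<^sub>U(V)\<close> because \<open>\<iota>\<^sub>0\<close> has a
  retraction. A map in W that has the right lifting property with respect to J even has it with
  respect to I, since a lift up to homotopy can be corrected by lifting the homotopy
  (\<open>W_fibration_in_inj\<close>).

  Suppose that right factors of W along J-cell maps stay in W. Factor every diagonal as a J-cell
  map t followed by a map \<open>P X \<rightarrow> X \<times> X\<close> in J-inj. Both projections \<open>p\<^sub>0, p\<^sub>1\<close> are retractions of t,
  so they lie in W by hypothesis, and they have the lifting property with respect to J because X
  is fibrant; hence they have it with respect to I. The map of path objects over f is a lift
  against t (\<open>path_objects_exist\<close>).

  Conversely, given such path objects and \<open>g f \<in> W\<close> with f in J-cell, a square from i to g is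
  solved as follows. Its upper map \<open>u : U \<rightarrow> B\<close> is the end of a path that starts at some \<open>f u'\<close>; in
  the reflexive case this is because f is the inclusion of a deformation retract. The image under g of this path
  extends from U to V so as to end at the lower map v; at its start, \<open>g f \<in> W\<close> produces
  \<open>m : V \<rightarrow> A\<close> and a homotopy. Extending the path in B from \<open>f m\<close> gives the lift of the square, and
  lifting the homotopy along \<open>p\<^sub>0\<close>, relative to the two extended paths, gives the homotopy that is
  required of it (\<open>left_cancellation_from_path_objects\<close>).

  The factorizations come from the small object argument for J. It is run with one cell per
  step, along an ordinal that closes off all lifting problems arising on the way, so that its
  result is by construction a transfinite composition of pushouts
  (\<open>small_object_argument\<close>). The codomains V are only known to be small relative to I-cell, while
  the pushouts of J are merely in I-cof; a sequence of maps in I-cof is therefore exhibited as a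
  retract of a sequence of I-cell maps (\<open>factors_through_cofibrant_stages\<close>). All transfinite
  constructions are instances of two recursions: lifting along a natural transformation
  (\<open>transfinite_lift\<close>) and building a sequence over a given one (\<open>transfinite_tower\<close>).\<close>

section \<open>Smallness\<close>

lemma small_subset: "small u B \<Longrightarrow> A \<subseteq> B \<Longrightarrow> small u A"
  unfolding small_def using card_of_mono1 ordLeq_ordLess_trans by blast

lemma small_image: "small u A \<Longrightarrow> small u (f ` A)"
  unfolding small_def using card_of_image ordLeq_ordLess_trans by blast

lemma small_ordLeq: "small u B \<Longrightarrow> |A| \<le>o |B| \<Longrightarrow> small u A"
  unfolding small_def using ordLeq_ordLess_trans by blast

lemma universe_infinite: "universe TYPE('u) \<Longrightarrow> infinite (UNIV :: 'u set)"
  unfolding universe_def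
  using card_of_ordLeq_infinite infinite_UNIV_nat ordLess_imp_ordLeq by blast

lemma universe_stable: "universe TYPE('u) \<Longrightarrow> stable |UNIV :: 'u set|"
  using universe_infinite universe_def regularCard_stable
  by (metis Field_card_of card_of_Card_order)

lemma small_finite:
  assumes "universe TYPE('u)" "finite A" shows "small TYPE('u) A"
  unfolding small_def using assms universe_infinite finite_ordLess_infinite[OF card_of_Well_order card_of_Well_order]
  by (metis Field_card_of)

lemma small_Sigma:
  assumes "universe TYPE('u)" "small TYPE('u) A" "\<And>a. a \<in> A \<Longrightarrow> small TYPE('u) (F a)"
  shows "small TYPE('u) (SIGMA a : A. F a)"
  using assms stable_elim[OF universe_stable] unfolding small_def by blast

lemma small_UN:
  assumes "universe TYPE('u)" "small TYPE('u) A" "\<And>a. a \<in> A \<Longrightarrow> small TYPE('u) (F a)"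
  shows "small TYPE('u) (\<Union>a \<in> A. F a)"
  using assms stable_UNION[OF universe_stable] unfolding small_def by blast

lemma small_Un:
  assumes "universe TYPE('u)" "small TYPE('u) A" "small TYPE('u) B"
  shows "small TYPE('u) (A \<union> B)"
proof -
  have "small TYPE('u) (\<Union>b \<in> (UNIV :: bool set). if b then A else B)"
    using assms by (intro small_UN) (auto intro: small_finite)
  then show ?thesis by (simp add: UNIV_bool Un_commute)
qed

abbreviation univ_order :: "'u rel" where
  "univ_order \<equiv> |UNIV :: 'u set|"

lemma univ_order_Well_order: "Well_order |UNIV :: 'u set|"
  by (rule card_of_Well_order)

lemma Field_univ_order [simp]: "Field (univ_order :: 'u rel) = UNIV"
  by (rule Field_card_of)

lemma small_underS_univ_order: "small TYPE('u) (underS (univ_order :: 'u rel) a)"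
  unfolding small_def by (rule card_of_underS[OF card_of_Card_order]) simp

lemma not_in_underS:
  assumes "Well_order r" "a \<in> Field r" "b \<in> Field r" "b \<notin> underS r a"
  shows "(a, b) \<in> r"
proof -
  interpret wo_rel r using assms(1) by (simp add: wo_rel_def)
  show ?thesis using assms TOTALS REFL by (auto simp: underS_def refl_on_def)
qed

text \<open>By regularity of the universe: an unbounded subset of the order would have full
  cardinality.\<close>

lemma small_bounded:
  assumes u: "universe TYPE('u)" and A: "small TYPE('u) (A :: 'u set)"
  shows "\<exists>b. A \<subseteq> underS univ_order b"
proof (rule ccontr)
  assume no: "\<not> ?thesis"
  let ?r = "univ_order :: 'u rel"
  have "\<exists>b\<in>A. (a, b) \<in> ?r" for a
    using no not_in_underS[OF univ_order_Well_order, of a] by auto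
  moreover have "\<exists>a'. a \<noteq> a' \<and> (a, a') \<in> ?r" for a
    using infinite_Card_order_limit[OF card_of_Card_order, of "UNIV :: 'u set" a] universe_infinite[OF u] by auto
  moreover have "trans ?r" "antisym ?r"
    using univ_order_Well_order[where 'u='u]
    by (auto simp: order_on_defs)
  ultimately have "cofinal A ?r"
    unfolding cofinal_def by (metis antisymD transD)
  then have "|A| =o ?r" using u unfolding universe_def regularCard_def by auto
  then show False using A unfolding small_def by (metis not_ordLess_ordIso)
qed

text \<open>The order is the successor cardinal of an infinite set containing S. It is regular, and it is
  small because it is no larger than a power set. Finite sets A are bounded even if S is empty.\<close>

lemma small_cofinality_exceeded:
  assumes u: "universe TYPE('u)" and S: "small TYPE('u) (S :: 'u set)"
  shows "\<exists>k :: 'u set rel. Well_order k \<and> small TYPE('u) (Field k) \<and> Field k \<noteq> {} \<and>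
    (\<forall>A. A \<subseteq> Field k \<and> ( |A| \<le>o |S| \<or> finite A) \<longrightarrow> (\<exists>x \<in> Field k. A \<subseteq> underS k x))"
proof -
  obtain N :: "'u set" where N: "|N| =o |UNIV :: nat set|"
    using u unfolding universe_def
    by (metis card_of_image card_of_ordLeq internalize_card_of_ordLeq2 ordIso_symmetric ordLess_imp_ordLeq)
  define T where "T = S \<union> N"
  have smT: "small TYPE('u) T"
    using N u S unfolding T_def universe_def
    by (intro small_Un[OF u]) (auto simp: small_def intro: ordIso_ordLess_trans)
  have infT: "infinite T"
    using N unfolding T_def by (metis card_of_ordIso_finite finite_Un infinite_UNIV_nat)
  let ?k = "cardSuc |T|"
  have co: "Card_order ?k" by (rule cardSuc_Card_order) (rule card_of_Card_order)
  have wo: "Well_order ?k" using co unfolding card_order_on_def by blast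
  have inf: "infinite (Field ?k)" unfolding cardSuc_finite[OF card_of_Card_order] Field_card_of by (rule infT)
  have reg: "regularCard ?k" by (rule infinite_cardSuc_regularCard[OF _ card_of_Card_order]) (simp add: infT Field_card_of)
  have "?k \<le>o |Pow T|"
    by (rule cardSuc_least[OF card_of_Card_order card_of_Card_order card_of_Pow])
  then have "|Field ?k| \<le>o |Pow T|"
    using card_of_Field_ordIso[OF co] ordIso_ordLeq_trans by blast
  moreover have "small TYPE('u) (Pow T)"
    using smT u unfolding small_def universe_def by blast
  ultimately have sm: "small TYPE('u) (Field ?k)" by (rule small_ordLeq[rotated])
  have "\<exists>x \<in> Field ?k. A \<subseteq> underS ?k x"
    if A: "A \<subseteq> Field ?k" "|A| \<le>o |S| \<or> finite A" for A
  proof -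
    have "|A| \<le>o |T|" using A(2)
    proof
      assume "|A| \<le>o |S|"
      moreover have "|S| \<le>o |T|" unfolding T_def by (rule card_of_mono1) blast
      ultimately show ?thesis by (rule ordLeq_transitive)
    next
      assume "finite A"
      then have "|A| <o |T|"
        using infT by (intro finite_ordLess_infinite card_of_Well_order) (simp_all add: Field_card_of)
      then show ?thesis by (rule ordLess_imp_ordLeq)
    qed
    then have "|A| <o ?k" using cardSuc_greater[OF card_of_Card_order] by (rule ordLeq_ordLess_trans)
    then have "\<not> cofinal A ?k"
      using reg A(1) unfolding regularCard_def by (metis not_ordLess_ordIso)
    then obtain y where y: "y \<in> Field ?k" "\<And>b. b \<in> A \<Longrightarrow> \<not> (y \<noteq> b \<and> (y, b) \<in> ?k)"
      unfolding cofinal_def by blast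
    obtain x where x: "x \<in> Field ?k" "y \<noteq> x" "(y, x) \<in> ?k"
      using infinite_Card_order_limit[OF co inf y(1)] by (auto simp: Field_def)
    interpret wo_rel ?k using wo by (simp add: wo_rel_def)
    have "(a, x) \<in> ?k \<and> a \<noteq> x" if "a \<in> A" for a
    proof -
      have "(a, y) \<in> ?k" using y that A(1) TOTALS REFL by (metis refl_onD subsetD)
      then show ?thesis using x TRANS ANTISYM by (metis antisymD transD)
    qed
    then show ?thesis using x by (auto simp: underS_def)
  qed
  then show ?thesis using wo sm inf by (metis finite.emptyI)
qed

lemma underS_trans: "Well_order r \<Longrightarrow> a \<in> underS r b \<Longrightarrow> (b, c) \<in> r \<Longrightarrow> a \<in> underS r c"
  unfolding underS_def order_on_defs by (auto dest: antisymD transD)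

lemma Field_Restr_underS: "Well_order r \<Longrightarrow> Field (Restr r (underS r a)) = underS r a"
  by (simp add: Field_Restr_ofilter wo_rel.intro wo_rel.underS_ofilter)

lemma small_ordinal_Restr_underS:
  "Well_order r \<Longrightarrow> small TYPE('u) (underS r a) \<Longrightarrow> small_ordinal (Restr (r :: 'u rel) (underS r a))"
  unfolding small_ordinal_def using Well_order_Restr by (metis Field_Restr_underS)

text \<open>The length of the small object argument: l is the supremum of a sequence whose length has
  cofinality greater than S, which makes the segment below l filtered, and whose terms jump beyond
  all values of F on what came before, which makes the segment closed under F.\<close>

lemma closed_filtered_segment:
  fixes F :: "'u \<Rightarrow> 'u"
  assumes u: "universe TYPE('u)" and S: "small TYPE('u) (S :: 'u set)"
  defines "R \<equiv> univ_order :: 'u rel"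
  shows "\<exists>l. filtered_ordinal S (Restr R (underS R l)) \<and> is_limit_elem R l \<and>
    (\<forall>a \<in> underS R l. F a \<in> underS R l)"
proof -
  obtain k :: "'u set rel" where k: "Well_order k" "small TYPE('u) (Field k)" "Field k \<noteq> {}"
    and unb: "\<And>A. A \<subseteq> Field k \<Longrightarrow> |A| \<le>o |S| \<or> finite A \<Longrightarrow> \<exists>x \<in> Field k. A \<subseteq> underS k x"
    using small_cofinality_exceeded[OF u S] by metis
  interpret k: wo_rel k using k(1) by (simp add: wo_rel_def)
  have woR: "Well_order R" unfolding R_def by (rule univ_order_Well_order)
  interpret R: wo_rel R using woR by (simp add: wo_rel_def)
  have [simp]: "Field R = UNIV" unfolding R_def by simp
  have smR: "small TYPE('u) (underS R a)" for a
    unfolding R_def by (rule small_underS_univ_order)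
  \<comment> \<open>F need not be monotone, so each term has to exceed the values of F at everything below an
    earlier term\<close>
  define P where "P g x y \<longleftrightarrow> (\<forall>z \<in> underS k x. g z \<in> underS R y \<and> F ` (underS R (g z)) \<subseteq> underS R y)"
    for g :: "'u set \<Rightarrow> 'u" and x and y :: 'u
  have "\<exists>g. \<forall>x. P g x (g x)"
  proof (rule dependent_wf_choice[OF k.WF])
    show "P f x r = P g x r" if "\<And>z. (z, x) \<in> k - Relation.Id \<Longrightarrow> f z = g z" for f g x r
      using that unfolding P_def underS_def by auto
    show "\<exists>r. P f x r" for x f
    proof -
      have sm: "small TYPE('u) (underS k x)"
        by (rule small_subset[OF k(2)]) (auto simp: underS_def Field_def)
      have "small TYPE('u) (\<Union>z\<in>underS k x. insert (f z) (F ` (underS R (f z))))"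
        using small_Un[OF u small_finite[OF u] small_image[OF smR], of "{_}"]
        by (intro small_UN[OF u sm]) auto
      from small_bounded[OF u this] show ?thesis
        unfolding P_def R_def by blast
    qed
  qed
  then obtain g where g: "\<And>x. P g x (g x)" by blast
  have "small TYPE('u) (g ` Field k)" using k(2) by (rule small_image)
  then obtain b0 where b0: "g ` Field k \<subseteq> underS R b0"
    using small_bounded[OF u] unfolding R_def by blast
  define B where "B = {b. g ` Field k \<subseteq> underS R b}"
  define l where "l = R.minim B"
  have lB: "g ` Field k \<subseteq> underS R l"
    using R.minim_in[of B] b0 unfolding l_def B_def by auto
  have lmin: "(l, b) \<in> R" if "g ` Field k \<subseteq> underS R b" for b
    using R.minim_least[of B b] that unfolding l_def B_def by auto
  have below: "\<exists>x\<in>Field k. a \<in> underS R (g x)" if a: "a \<in> underS R l" for a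
  proof -
    have "\<not> g ` Field k \<subseteq> underS R a"
      using lmin a R.ANTISYM by (auto simp: underS_def dest: antisymD)
    then obtain x where x: "x \<in> Field k" "(a, g x) \<in> R"
      using not_in_underS[OF woR, of a] by auto
    obtain y where y: "y \<in> Field k" "x \<in> underS k y"
      using unb[of "{x}"] x(1) by auto
    then have "g x \<in> underS R (g y)" using g unfolding P_def by blast
    then show ?thesis using y x R.TRANS R.ANTISYM
      unfolding underS_def by (auto dest: transD antisymD)
  qed
  have ne: "underS R l \<noteq> {}" using lB k(3) by auto
  have nomax: "\<exists>b\<in>underS R l. (a, b) \<in> R \<and> a \<noteq> b" if a: "a \<in> underS R l" for a
    using below[OF a] lB by (auto simp: underS_def)
  have bnd: "\<exists>b\<in>underS R l. \<forall>a\<in>A. (a, b) \<in> R" if A: "A \<subseteq> underS R l" "|A| \<le>o |S|" for A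
  proof -
    obtain x where x: "\<And>a. a \<in> A \<Longrightarrow> x a \<in> Field k \<and> a \<in> underS R (g (x a))"
      using below A(1) by (metis subsetD)
    have "|x ` A| \<le>o |S|" using A(2) card_of_image ordLeq_transitive by blast
    then obtain y where y: "y \<in> Field k" "x ` A \<subseteq> underS k y"
      using unb[of "x ` A"] x by (metis image_subsetI)
    have "(a, g y) \<in> R" if "a \<in> A" for a
    proof -
      have "g (x a) \<in> underS R (g y)" using g y that unfolding P_def by blast
      then show ?thesis using x[OF that] R.TRANS by (auto simp: underS_def dest: transD)
    qed
    then show ?thesis using y lB by blast
  qed
  have cl: "F a \<in> underS R l" if a: "a \<in> underS R l" for a
  proof -
    obtain x where x: "x \<in> Field k" "a \<in> underS R (g x)" using below[OF a] by blast
    obtain y where y: "y \<in> Field k" "x \<in> underS k y"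
      using unb[of "{x}"] x(1) by auto
    then have "F a \<in> underS R (g y)" using g x unfolding P_def by blast
    moreover have "(g y, l) \<in> R" using lB y by (auto simp: underS_def)
    ultimately show ?thesis by (rule underS_trans[OF woR])
  qed
  have lim: "is_limit_elem R l"
  proof -
    have "\<not> is_zero R l" using ne R.ANTISYM
      by (auto simp: is_zero_def underS_def dest: antisymD)
    moreover have "\<not> is_succ R a l" for a
      using nomax[of a] by (fastforce simp: is_succ_def underS_def)
    ultimately show ?thesis by (simp add: is_limit_elem_def)
  qed
  have "filtered_ordinal S (Restr R (underS R l))"
    unfolding filtered_ordinal_def Field_Restr_underS[OF woR]
  proof (intro conjI ballI allI impI)
    show "small_ordinal (Restr R (underS R l))"
      by (rule small_ordinal_Restr_underS[OF woR smR])
    show "underS R l \<noteq> {}" by (rule ne)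
    fix a assume "a \<in> underS R l"
    with nomax show "\<exists>b. (a, b) \<in> Restr R (underS R l) \<and> a \<noteq> b" by blast
  next
    fix A assume A: "A \<subseteq> underS R l \<and> |A| \<le>o |S|"
    then obtain b where b: "b \<in> underS R l" "\<forall>a\<in>A. (a, b) \<in> R" using bnd by meson
    then have "\<forall>a\<in>A. (a, b) \<in> Restr R (underS R l)" using A by auto
    with b(1) show "\<exists>b\<in>underS R l. \<forall>a\<in>A. (a, b) \<in> Restr R (underS R l)" by (rule bexI[rotated])
  qed
  with lim cl show ?thesis by blast
qed


section \<open>Arrows, and colimits over arbitrary small categories\<close>

lemma homD: "f \<in> hom C X Y \<Longrightarrow> f \<in> Arr C" "f \<in> hom C X Y \<Longrightarrow> Dom C f = X"
    "f \<in> hom C X Y \<Longrightarrow> Cod C f = Y"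
  by (simp_all add: hom_def)

lemma Arr_hom: "f \<in> Arr C \<Longrightarrow> f \<in> hom C (Dom C f) (Cod C f)"
  by (simp add: hom_def)

context category
begin

lemma hom_Obj: "f \<in> hom C X Y \<Longrightarrow> X \<in> Obj C" "f \<in> hom C X Y \<Longrightarrow> Y \<in> Obj C"
  using Dom_Obj Cod_Obj by (auto simp: hom_def)

lemma assoc:
  "f \<in> hom C X Y \<Longrightarrow> g \<in> hom C Y Z \<Longrightarrow> h \<in> hom C Z W \<Longrightarrow> (h \<cdot> g) \<cdot> f = h \<cdot> (g \<cdot> f)"
  using Comp_assoc by metis

end

lemma ex_universe_encoding:
  assumes "small TYPE('u) A"
  shows "\<exists>e :: 'a \<Rightarrow> 'u. inj_on e A"
  using assms unfolding small_def by (meson card_of_ordLeq ordLess_imp_ordLeq)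

lemma is_cocone_reindex:
  assumes J: "category J" and e: "inj_on e (Obj J)" and d: "inj_on d (Arr J)"
    and J': "J' = \<lparr>Obj = e ` Obj J, Arr = d ` Arr J,
      Dom = (\<lambda>a. e (Dom J (inv_into (Arr J) d a))), Cod = (\<lambda>a. e (Cod J (inv_into (Arr J) d a))),
      Id = (\<lambda>x. d (Id J (inv_into (Obj J) e x))),
      Comp = (\<lambda>g f. d (inv_into (Arr J) d g \<cdot>\<^bsub>J\<^esub> inv_into (Arr J) d f))\<rparr>"
  shows "category J'"
    and "is_functor J C F \<phi> \<Longrightarrow>
      is_functor J' C (F \<circ> inv_into (Obj J) e) (\<phi> \<circ> inv_into (Arr J) d)"
    and "is_cocone J' C (F \<circ> inv_into (Obj J) e) (\<phi> \<circ> inv_into (Arr J) d) M \<sigma> \<longleftrightarrow>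
      is_cocone J C F \<phi> M (\<sigma> \<circ> e)"
proof -
  interpret J: category J by (rule J)
  have [simp]: "x \<in> Obj J \<Longrightarrow> inv_into (Obj J) e (e x) = x" for x using e by simp
  have [simp]: "x \<in> Arr J \<Longrightarrow> inv_into (Arr J) d (d x) = x" for x using d by simp
  have [simp]: "x \<in> Obj J \<Longrightarrow> Id J x \<in> Arr J" "x \<in> Obj J \<Longrightarrow> Dom J (Id J x) = x"
    "x \<in> Obj J \<Longrightarrow> Cod J (Id J x) = x" for x
    using J.Id_hom by (auto simp: hom_def)
  have [simp]: "f \<in> Arr J \<Longrightarrow> Dom J f \<in> Obj J" "f \<in> Arr J \<Longrightarrow> Cod J f \<in> Obj J" for f
    using J.Dom_Obj J.Cod_Obj by auto
  have comp [simp]: "g \<cdot>\<^bsub>J\<^esub> f \<in> Arr J" "Dom J (g \<cdot>\<^bsub>J\<^esub> f) = Dom J f" "Cod J (g \<cdot>\<^bsub>J\<^esub> f) = Cod J g"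
    if "f \<in> Arr J" "g \<in> Arr J" "Dom J g = Cod J f" for f g
    using J.Comp_hom[OF Arr_hom, of f g "Cod J g"] that by (auto simp: hom_def)
  have eD: "e (Dom J g) = e (Cod J f) \<Longrightarrow> f \<in> Arr J \<Longrightarrow> g \<in> Arr J \<Longrightarrow> Dom J g = Cod J f" for f g
    using e by (auto dest: inj_onD)
  show "category J'"
  proof
    show "f \<in> Arr J' \<Longrightarrow> Dom J' f \<in> Obj J'" "f \<in> Arr J' \<Longrightarrow> Cod J' f \<in> Obj J'" for f
      by (auto simp: J')
    show "X \<in> Obj J' \<Longrightarrow> Id J' X \<in> hom J' X X" for X by (auto simp: J' hom_def)
    show "g \<cdot>\<^bsub>J'\<^esub> f \<in> hom J' X Z" if "f \<in> hom J' X Y" "g \<in> hom J' Y Z" for f g X Y Z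
      using that eD by (auto simp: J' hom_def)
    show "f \<cdot>\<^bsub>J'\<^esub> Id J' X = f" if "f \<in> hom J' X Y" for f X Y
      using that J.Comp_Id[OF Arr_hom] by (auto simp: J' hom_def)
    show "Id J' Y \<cdot>\<^bsub>J'\<^esub> f = f" if "f \<in> hom J' X Y" for f X Y
      using that J.Id_Comp[OF Arr_hom] by (auto simp: J' hom_def)
    show "h \<cdot>\<^bsub>J'\<^esub> (g \<cdot>\<^bsub>J'\<^esub> f) = h \<cdot>\<^bsub>J'\<^esub> g \<cdot>\<^bsub>J'\<^esub> f"
      if asm: "f \<in> hom J' X Y" "g \<in> hom J' Y Z" "h \<in> hom J' Z W" for f g h X Y Z W
    proof -
      obtain f' g' h' where [simp]: "f = d f'" "g = d g'" "h = d h'"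
        and a: "f' \<in> Arr J" "g' \<in> Arr J" "h' \<in> Arr J" using asm by (auto simp: J' hom_def)
      have c: "Dom J g' = Cod J f'" "Dom J h' = Cod J g'"
        using asm a eD by (auto simp: J' hom_def)
      have "h' \<cdot>\<^bsub>J\<^esub> (g' \<cdot>\<^bsub>J\<^esub> f') = h' \<cdot>\<^bsub>J\<^esub> g' \<cdot>\<^bsub>J\<^esub> f'"
        using J.Comp_assoc[OF Arr_hom, of f' g' "Cod J g'" h' "Cod J h'"] a c by (auto simp: hom_def)
      then show ?thesis using a c by (simp add: J')
    qed
  qed
  show "is_functor J' C (F \<circ> inv_into (Obj J) e) (\<phi> \<circ> inv_into (Arr J) d)"
    if "is_functor J C F \<phi>"
    using that eD by (auto simp: is_functor_def J')
  show "is_cocone J' C (F \<circ> inv_into (Obj J) e) (\<phi> \<circ> inv_into (Arr J) d) M \<sigma> \<longleftrightarrow>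
      is_cocone J C F \<phi> M (\<sigma> \<circ> e)"
    by (auto simp: is_cocone_def J')
qed

lemma is_cocone_cong:
  assumes "\<And>j. j \<in> Obj J \<Longrightarrow> \<kappa> j = \<kappa>' j" "category J"
  shows "is_cocone J C F \<phi> L \<kappa> \<longleftrightarrow> is_cocone J C F \<phi> L \<kappa>'"
  using assms category.Dom_Obj[OF assms(2)] category.Cod_Obj[OF assms(2)]
  by (simp add: is_cocone_def)

text \<open>Cocompleteness only speaks of diagrams whose objects and arrows are elements of the
  universe, so the shape of a diagram is first encoded there.\<close>

lemma small_colimit_exists:
  fixes J :: "('j, 'k) cat"
  assumes co: "cocomplete TYPE('u) C" and J: "small_category TYPE('u) J"
    and F: "is_functor J C F \<phi>"
  shows "\<exists>L \<kappa>. is_colimit J C F \<phi> L \<kappa>"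
proof -
  obtain e :: "'j \<Rightarrow> 'u" where e: "inj_on e (Obj J)"
    using J ex_universe_encoding unfolding small_category_def by blast
  obtain d :: "'k \<Rightarrow> 'u" where d: "inj_on d (Arr J)"
    using J ex_universe_encoding unfolding small_category_def by blast
  have catJ: "category J" using J by (simp add: small_category_def)
  define J' :: "('u, 'u) cat" where J': "J' = \<lparr>Obj = e ` Obj J, Arr = d ` Arr J,
      Dom = (\<lambda>a. e (Dom J (inv_into (Arr J) d a))), Cod = (\<lambda>a. e (Cod J (inv_into (Arr J) d a))),
      Id = (\<lambda>x. d (Id J (inv_into (Obj J) e x))),
      Comp = (\<lambda>g f. d (inv_into (Arr J) d g \<cdot>\<^bsub>J\<^esub> inv_into (Arr J) d f))\<rparr>"
  note re = is_cocone_reindex[OF catJ e d J']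
  have "small_category TYPE('u) J'"
    using re(1) J by (auto simp: small_category_def J' small_image)
  then obtain L \<kappa> where L: "is_colimit J' C (F \<circ> inv_into (Obj J) e) (\<phi> \<circ> inv_into (Arr J) d) L \<kappa>"
    using co re(2)[OF F] unfolding cocomplete_def by blast
  have "\<exists>!h. h \<in> hom C L M \<and> (\<forall>j\<in>Obj J. h \<cdot>\<^bsub>C\<^esub> (\<kappa> \<circ> e) j = \<rho> j)"
    if \<rho>: "is_cocone J C F \<phi> M \<rho>" for M \<rho>
  proof -
    have "is_cocone J' C (F \<circ> inv_into (Obj J) e) (\<phi> \<circ> inv_into (Arr J) d) M (\<rho> \<circ> inv_into (Obj J) e)"
      unfolding re(3) using iffD1[OF is_cocone_cong[OF _ catJ] \<rho>] e by simp
    then have "\<exists>!h. h \<in> hom C L M \<and> (\<forall>j\<in>Obj J'. h \<cdot>\<^bsub>C\<^esub> \<kappa> j = (\<rho> \<circ> inv_into (Obj J) e) j)"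
      using L unfolding is_colimit_def by blast
    then show ?thesis using e by (simp add: J')
  qed
  moreover have "is_cocone J C F \<phi> L (\<kappa> \<circ> e)"
    by (rule iffD1[OF re(3)]) (use L in \<open>simp add: is_colimit_def\<close>)
  ultimately show ?thesis unfolding is_colimit_def by blast
qed

text \<open>The arrows 3 and 4 are the legs from 0 to 1 and from 0 to 2, and each other arrow is the
  identity of the object of the same name. Two legs are never composable, so the clauses for
  \<open>Comp\<close> cover every composite.\<close>

definition span_shape :: "(nat, nat) cat" where
  "span_shape = \<lparr>Obj = {0, 1, 2}, Arr = {0, 1, 2, 3, 4}, Dom = (\<lambda>a. if a < 3 then a else 0),
     Cod = (\<lambda>a. if a < 3 then a else a - 2), Id = (\<lambda>x. x),
     Comp = (\<lambda>g f. if f < 3 then g else f)\<rparr>"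

definition discrete_shape :: "'a set \<Rightarrow> ('a, 'a) cat" where
  "discrete_shape A = \<lparr>Obj = A, Arr = A, Dom = (\<lambda>a. a), Cod = (\<lambda>a. a), Id = (\<lambda>x. x),
     Comp = (\<lambda>g f. f)\<rparr>"

lemma span_shape_small: "universe TYPE('u) \<Longrightarrow> small_category TYPE('u) span_shape"
  unfolding small_category_def
proof (intro conjI)
  show "category span_shape" by unfold_locales (auto simp: span_shape_def hom_def)
qed (auto intro: small_finite simp: span_shape_def)

lemma discrete_shape_small:
  "small TYPE('u) A \<Longrightarrow> small_category TYPE('u) (discrete_shape A)"
  unfolding small_category_def
proof (intro conjI)
  show "category (discrete_shape A)" by unfold_locales (auto simp: discrete_shape_def hom_def)
qed (auto simp: discrete_shape_def)

context category
begin

lemma pushout_exists: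
  assumes u: "universe TYPE('u)" and co: "cocomplete TYPE('u) C"
    and f: "f \<in> hom C A B" and g: "g \<in> hom C A B'"
  shows "\<exists>P j\<^sub>0 j\<^sub>1. is_pushout C f g P j\<^sub>0 j\<^sub>1"
proof -
  define F where "F n = (if n = 0 then A else if n = 1 then B else B')" for n :: nat
  define \<phi> where "\<phi> n = (if n = 3 then f else if n = 4 then g else Id C (F n))" for n :: nat
  have obj: "A \<in> Obj C" "B \<in> Obj C" "B' \<in> Obj C" using f g hom_Obj by auto
  have F: "is_functor span_shape C F \<phi>"
    using obj f g Id_hom Comp_Id[OF f] Id_Comp[OF f] Comp_Id[OF g] Id_Comp[OF g]
      Comp_Id[OF Id_hom]
    by (auto simp: is_functor_def span_shape_def F_def \<phi>_def)
  have "small_category TYPE('u) span_shape"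
    using u by (rule span_shape_small)
  from small_colimit_exists[OF co this F] obtain P \<kappa> where
    P: "is_colimit span_shape C F \<phi> P \<kappa>" by blast
  have cc: "is_cocone span_shape C F \<phi> M \<rho> \<longleftrightarrow> M \<in> Obj C \<and> \<rho> 0 \<in> hom C A M \<and> \<rho> 1 \<in> hom C B M \<and>
     \<rho> 2 \<in> hom C B' M \<and> \<rho> 1 \<cdot> f = \<rho> 0 \<and> \<rho> 2 \<cdot> g = \<rho> 0" for M \<rho>
    using Comp_Id by (auto simp: is_cocone_def span_shape_def F_def \<phi>_def)
  have "is_pushout C f g P (\<kappa> 1) (\<kappa> 2)"
    unfolding is_pushout_def
  proof (intro conjI ballI impI)
    show "f \<in> Arr C" "g \<in> Arr C" "Dom C f = Dom C g" "P \<in> Obj C" "\<kappa> 1 \<in> hom C (Cod C f) P"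
      "\<kappa> 2 \<in> hom C (Cod C g) P" "\<kappa> 1 \<cdot> f = \<kappa> 2 \<cdot> g"
      using P cc f g by (auto simp: is_colimit_def homD)
    fix T a b
    assume "T \<in> Obj C" and a: "a \<in> hom C (Cod C f) T" and b: "b \<in> hom C (Cod C g) T"
      and eq: "a \<cdot> f = b \<cdot> g"
    define \<rho> where "\<rho> n = (if n = 0 then a \<cdot> f else if n = 1 then a else b)" for n :: nat
    have "is_cocone span_shape C F \<phi> T \<rho>"
      unfolding cc using \<open>T \<in> Obj C\<close> a b eq f g Comp_hom[OF f, of a T]
      by (auto simp: \<rho>_def homD)
    then have ex: "\<exists>!h. h \<in> hom C P T \<and> (\<forall>j\<in>Obj span_shape. h \<cdot> \<kappa> j = \<rho> j)"
      using P unfolding is_colimit_def by blast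
    have "(\<forall>j\<in>Obj span_shape. h \<cdot> \<kappa> j = \<rho> j) \<longleftrightarrow> h \<cdot> \<kappa> 1 = a \<and> h \<cdot> \<kappa> 2 = b" if h: "h \<in> hom C P T" for h
    proof -
      have "\<kappa> 1 \<in> hom C B P" "\<kappa> 1 \<cdot> f = \<kappa> 0" using P cc by (auto simp: is_colimit_def)
      then have "h \<cdot> \<kappa> 0 = (h \<cdot> \<kappa> 1) \<cdot> f" using assoc[OF f _ h] by metis
      then show ?thesis by (auto simp: span_shape_def \<rho>_def)
    qed
    then show "\<exists>!h. h \<in> hom C P T \<and> h \<cdot> \<kappa> 1 = a \<and> h \<cdot> \<kappa> 2 = b"
      using ex by (metis (no_types, lifting))
  qed
  then show ?thesis by blast
qed

lemma initial_exists:
  assumes u: "universe TYPE('u)" and co: "cocomplete TYPE('u) C"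
  shows "\<exists>Z. is_initial C Z"
proof -
  let ?J = "discrete_shape ({} :: 'u set)"
  have "small_category TYPE('u) ?J"
    using u by (intro discrete_shape_small small_finite) auto
  moreover have "is_functor ?J C (\<lambda>_. undefined) (\<lambda>_. undefined)"
    by (simp add: is_functor_def discrete_shape_def)
  ultimately obtain L \<kappa> where "is_colimit ?J C (\<lambda>_. undefined) (\<lambda>_. undefined) L \<kappa>"
    using small_colimit_exists[OF co] by blast
  then have "is_initial C L"
    by (simp add: is_colimit_def is_initial_def is_cocone_def discrete_shape_def)
  then show ?thesis by blast
qed

lemma terminal_exists:
  assumes u: "universe TYPE('u)" and co: "complete TYPE('u) C"
  shows "\<exists>Z \<in> Obj C. \<forall>X \<in> Obj C. \<exists>!h. h \<in> hom C X Z"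
proof -
  let ?J = "discrete_shape ({} :: 'u set)"
  have "small_category TYPE('u) ?J"
    using u by (intro discrete_shape_small small_finite) auto
  moreover have "is_functor ?J C (\<lambda>_. undefined) (\<lambda>_. undefined)"
    by (simp add: is_functor_def discrete_shape_def)
  ultimately obtain L \<kappa> where "is_limit ?J C (\<lambda>_. undefined) (\<lambda>_. undefined) L \<kappa>"
    using co unfolding complete_def by blast
  then show ?thesis
    by (intro bexI[of _ L]) (auto simp: is_limit_def is_cone_def discrete_shape_def)
qed

lemma product_exists:
  assumes u: "universe TYPE('u)" and co: "complete TYPE('u) C" and X: "X \<in> Obj C" and Y: "Y \<in> Obj C"
  shows "\<exists>Q q\<^sub>0 q\<^sub>1. is_product C X Y Q q\<^sub>0 q\<^sub>1"
proof -
  obtain x y :: 'u where xy: "x \<noteq> y"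
    using universe_infinite[OF u] by (metis (full_types) UNIV_eq_I finite.simps insert_iff)
  let ?J = "discrete_shape {x, y}"
  define F where "F z = (if z = x then X else Y)" for z
  have "small_category TYPE('u) ?J"
    using u by (intro discrete_shape_small small_finite) auto
  moreover have "is_functor ?J C F (\<lambda>z. Id C (F z))"
    using X Y Id_hom Comp_Id[OF Id_hom] by (auto simp: is_functor_def discrete_shape_def F_def)
  ultimately obtain Q \<pi> where Q: "is_limit ?J C F (\<lambda>z. Id C (F z)) Q \<pi>"
    using co unfolding complete_def by blast
  have cone: "is_cone ?J C F (\<lambda>z. Id C (F z)) M \<rho> \<longleftrightarrow>
      M \<in> Obj C \<and> \<rho> x \<in> hom C M X \<and> \<rho> y \<in> hom C M Y" for M \<rho>
    using Id_Comp xy by (auto simp: is_cone_def discrete_shape_def F_def)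
  have "is_product C X Y Q (\<pi> x) (\<pi> y)"
    unfolding is_product_def
  proof (intro conjI ballI)
    show "Q \<in> Obj C" "\<pi> x \<in> hom C Q X" "\<pi> y \<in> hom C Q Y" using Q cone by (auto simp: is_limit_def)
    fix T a b assume "T \<in> Obj C" "a \<in> hom C T X" "b \<in> hom C T Y"
    then have "is_cone ?J C F (\<lambda>z. Id C (F z)) T (\<lambda>z. if z = x then a else b)"
      using xy by (simp add: cone)
    then have "\<exists>!h. h \<in> hom C T Q \<and> (\<forall>z\<in>Obj ?J. \<pi> z \<cdot> h = (if z = x then a else b))"
      using Q unfolding is_limit_def by blast
    then show "\<exists>!h. h \<in> hom C T Q \<and> \<pi> x \<cdot> h = a \<and> \<pi> y \<cdot> h = b"
      using xy by (auto simp: discrete_shape_def)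
  qed
  then show ?thesis by blast
qed

end

section \<open>Well-orders as categories\<close>

lemma order_cat_category: "Well_order r \<Longrightarrow> category (order_cat r)"
  by unfold_locales
    (auto simp: order_cat_def hom_def order_on_defs refl_on_def Field_def dest: transD)

lemma order_cat_small:
  assumes "universe TYPE('u)" "Well_order r" "small TYPE('u) (Field r)"
  shows "small_category TYPE('u) (order_cat r)"
proof -
  have "small TYPE('u) (Field r \<times> Field r)" using assms by (intro small_Sigma) auto
  then have "small TYPE('u) r" by (rule small_subset) (auto simp: Field_def)
  then show ?thesis
    using assms order_cat_category by (auto simp: small_category_def order_cat_def)
qed

lemma order_functor_iff:
  "is_functor (order_cat r) C X \<phi> \<longleftrightarrow>
    (\<forall>a\<in>Field r. X a \<in> Obj C \<and> \<phi> (a, a) = Id C (X a)) \<and>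
    (\<forall>a b. (a, b) \<in> r \<longrightarrow> \<phi> (a, b) \<in> hom C (X a) (X b)) \<and>
    (\<forall>a b c. (a, b) \<in> r \<and> (b, c) \<in> r \<longrightarrow> \<phi> (b, c) \<cdot>\<^bsub>C\<^esub> \<phi> (a, b) = \<phi> (a, c))"
proof -
  have "(\<forall>a\<in>r. \<forall>b\<in>r. fst b = snd a \<longrightarrow> \<phi> (fst a, snd b) = \<phi> b \<cdot>\<^bsub>C\<^esub> \<phi> a) \<longleftrightarrow>
    (\<forall>a b c. (a, b) \<in> r \<and> (b, c) \<in> r \<longrightarrow> \<phi> (b, c) \<cdot>\<^bsub>C\<^esub> \<phi> (a, b) = \<phi> (a, c))"
    by (metis fst_conv prod.collapse snd_conv)
  moreover have "(\<forall>a\<in>r. \<phi> a \<in> hom C (X (fst a)) (X (snd a))) \<longleftrightarrow>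
    (\<forall>a b. (a, b) \<in> r \<longrightarrow> \<phi> (a, b) \<in> hom C (X a) (X b))"
    by auto
  ultimately show ?thesis by (auto simp: is_functor_def order_cat_def)
qed

lemma order_cocone_iff:
  "is_cocone (order_cat r) C X \<phi> L \<kappa> \<longleftrightarrow>
    L \<in> Obj C \<and> (\<forall>a\<in>Field r. \<kappa> a \<in> hom C (X a) L) \<and>
    (\<forall>a b. (a, b) \<in> r \<longrightarrow> \<kappa> b \<cdot>\<^bsub>C\<^esub> \<phi> (a, b) = \<kappa> a)"
  unfolding is_cocone_def order_cat_def by auto

lemma order_colimitD:
  assumes "is_colimit (order_cat r) C X \<phi> L \<kappa>"
  shows "L \<in> Obj C" "a \<in> Field r \<Longrightarrow> \<kappa> a \<in> hom C (X a) L"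
    "(a, b) \<in> r \<Longrightarrow> \<kappa> b \<cdot>\<^bsub>C\<^esub> \<phi> (a, b) = \<kappa> a"
  using assms unfolding is_colimit_def order_cocone_iff by auto

lemma order_colimit_induce:
  assumes "is_colimit (order_cat r) C X \<phi> L \<kappa>"
    and "M \<in> Obj C" "\<And>a. a \<in> Field r \<Longrightarrow> \<rho> a \<in> hom C (X a) M"
    and "\<And>a b. (a, b) \<in> r \<Longrightarrow> \<rho> b \<cdot>\<^bsub>C\<^esub> \<phi> (a, b) = \<rho> a"
  obtains h where "h \<in> hom C L M" "\<And>a. a \<in> Field r \<Longrightarrow> h \<cdot>\<^bsub>C\<^esub> \<kappa> a = \<rho> a"
proof -
  have "is_cocone (order_cat r) C X \<phi> M \<rho>" using assms(2-) unfolding order_cocone_iff by blast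
  then have "\<exists>h. h \<in> hom C L M \<and> (\<forall>j\<in>Obj (order_cat r). h \<cdot>\<^bsub>C\<^esub> \<kappa> j = \<rho> j)"
    using assms(1) unfolding is_colimit_def by blast
  then show thesis using that by (auto simp: order_cat_def)
qed

lemma (in category) order_colimit_unique:
  assumes L: "is_colimit (order_cat r) C X \<phi> L \<kappa>"
    and F: "\<And>a b. (a, b) \<in> r \<Longrightarrow> \<phi> (a, b) \<in> hom C (X a) (X b)"
    and h: "h \<in> hom C L M" and h': "h' \<in> hom C L M"
    and eq: "\<And>a. a \<in> Field r \<Longrightarrow> h \<cdot> \<kappa> a = h' \<cdot> \<kappa> a"
  shows "h = h'"
proof -
  have "is_cocone (order_cat r) C X \<phi> M (\<lambda>a. h \<cdot> \<kappa> a)"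
    unfolding order_cocone_iff
    using order_colimitD[OF L] hom_Obj(2)[OF h] Comp_hom[OF _ h] F assoc[OF F _ h]
    by (auto simp: FieldI1 FieldI2)
  then have "\<exists>!g. g \<in> hom C L M \<and> (\<forall>j\<in>Obj (order_cat r). g \<cdot> \<kappa> j = h \<cdot> \<kappa> j)"
    using L unfolding is_colimit_def by blast
  then show ?thesis using h h' eq by (metis (no_types, lifting) cat.select_convs(1) order_cat_def)
qed

lemma order_colimit_cong:
  assumes "\<And>a. a \<in> Field r \<Longrightarrow> X a = X' a" "\<And>a b. (a, b) \<in> r \<Longrightarrow> \<phi> (a, b) = \<phi>' (a, b)"
    "\<And>a. a \<in> Field r \<Longrightarrow> \<kappa> a = \<kappa>' a"
  shows "is_colimit (order_cat r) C X \<phi> L \<kappa> \<longleftrightarrow> is_colimit (order_cat r) C X' \<phi>' L \<kappa>'"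
proof -
  have "is_cocone (order_cat r) C X \<phi> M \<rho> \<longleftrightarrow> is_cocone (order_cat r) C X' \<phi>' M \<rho>" for M \<rho>
    using assms(1,2) by (auto simp: order_cocone_iff)
  moreover have "is_cocone (order_cat r) C X' \<phi>' L \<kappa> \<longleftrightarrow> is_cocone (order_cat r) C X' \<phi>' L \<kappa>'"
    using assms(3) by (auto simp: order_cocone_iff FieldI1 FieldI2)
  moreover have "(\<forall>j\<in>Obj (order_cat r). h \<cdot>\<^bsub>C\<^esub> \<kappa> j = \<rho> j) \<longleftrightarrow> (\<forall>j\<in>Obj (order_cat r). h \<cdot>\<^bsub>C\<^esub> \<kappa>' j = \<rho> j)" for h \<rho>
    using assms(3) by (auto simp: order_cat_def)
  ultimately show ?thesis unfolding is_colimit_def by simp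
qed


section \<open>Transfinite recursion along a well-order\<close>

lemma wo_refl: "Well_order r \<Longrightarrow> a \<in> Field r \<Longrightarrow> (a, a) \<in> r"
  unfolding order_on_defs by (auto dest: refl_onD)

lemma wo_trans: "Well_order r \<Longrightarrow> (a, b) \<in> r \<Longrightarrow> (b, c) \<in> r \<Longrightarrow> (a, c) \<in> r"
  unfolding order_on_defs by (auto dest: transD)

lemma wo_antisym: "Well_order r \<Longrightarrow> (a, b) \<in> r \<Longrightarrow> (b, a) \<in> r \<Longrightarrow> a = b"
  unfolding order_on_defs by (auto dest: antisymD)

lemma wo_total: "Well_order r \<Longrightarrow> a \<in> Field r \<Longrightarrow> b \<in> Field r \<Longrightarrow> (a, b) \<in> r \<or> (b, a) \<in> r"
  by (simp add: wo_rel.TOTALS wo_rel_def)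

lemma underS_iff: "a \<in> underS r b \<longleftrightarrow> (a, b) \<in> r \<and> a \<noteq> b"
  by (auto simp: underS_def)

lemma is_succ_below:
  assumes "Well_order r" "is_succ r a b" "c \<in> underS r b"
  shows "(c, a) \<in> r"
  using assms wo_total[OF assms(1), of c a] unfolding is_succ_def
  by (metis FieldI1 underS_iff)

lemma is_succ_unique: "Well_order r \<Longrightarrow> is_succ r a b \<Longrightarrow> is_succ r a' b \<Longrightarrow> a = a'"
  using is_succ_below[of r a b a'] is_succ_below[of r a' b a] wo_antisym[of r a a']
  by (auto simp: is_succ_def underS_iff)

lemma is_zero_underS: "Well_order r \<Longrightarrow> is_zero r z \<Longrightarrow> underS r z = {}"
  unfolding is_zero_def using wo_antisym[of r _ z] by (auto simp: underS_iff FieldI1)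

lemma is_zero_unique: "Well_order r \<Longrightarrow> is_zero r z \<Longrightarrow> is_zero r z' \<Longrightarrow> z = z'"
  unfolding is_zero_def using wo_antisym[of r z z'] by auto

lemma stage_cases:
  assumes "b \<in> Field r"
  obtains "is_zero r b" | a where "is_succ r a b" | "is_limit_elem r b"
  using assms unfolding is_limit_elem_def by blast

lemma order_functorD:
  assumes "is_functor (order_cat r) C X \<phi>"
  shows "a \<in> Field r \<Longrightarrow> X a \<in> Obj C" "a \<in> Field r \<Longrightarrow> \<phi> (a, a) = Id C (X a)"
    "(a, b) \<in> r \<Longrightarrow> \<phi> (a, b) \<in> hom C (X a) (X b)"
    "(a, b) \<in> r \<Longrightarrow> (b, c) \<in> r \<Longrightarrow> \<phi> (b, c) \<cdot>\<^bsub>C\<^esub> \<phi> (a, b) = \<phi> (a, c)"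
  using assms unfolding order_functor_iff by blast+

definition continuous_at_limits ::
  "('o, 'm) cat \<Rightarrow> 'j rel \<Rightarrow> ('j \<Rightarrow> 'o) \<Rightarrow> ('j \<times> 'j \<Rightarrow> 'm) \<Rightarrow> bool" where
  "continuous_at_limits C r X \<phi> \<longleftrightarrow> (\<forall>b. is_limit_elem r b \<longrightarrow>
     is_colimit (order_cat (Restr r (underS r b))) C X \<phi> (X b) (\<lambda>a. \<phi> (a, b)))"

text \<open>A lift of v through p is built stage by stage: lifting hypotheses act at successors, and at a
  limit stage the earlier lifts induce one, as X is a colimit there. With constant Y and B this is the
  lifting property of transfinite compositions; with v the identity it yields a section of p.\<close>

lemma (in category) transfinite_lift:
  assumes wo: "Well_order r"
    and X: "is_functor (order_cat r) C X \<phi>" and Xlim: "continuous_at_limits C r X \<phi>"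
    and Y: "is_functor (order_cat r) C Y \<psi>"
    and B: "is_functor (order_cat r) C B \<beta>"
    and p: "\<And>a. a \<in> Field r \<Longrightarrow> p a \<in> hom C (Y a) (B a)"
      "\<And>a b. (a, b) \<in> r \<Longrightarrow> p b \<cdot> \<psi> (a, b) = \<beta> (a, b) \<cdot> p a"
    and v: "\<And>a. a \<in> Field r \<Longrightarrow> v a \<in> hom C (X a) (B a)"
      "\<And>a b. (a, b) \<in> r \<Longrightarrow> v b \<cdot> \<phi> (a, b) = \<beta> (a, b) \<cdot> v a"
    and z: "is_zero r z" and u: "u \<in> hom C (X z) (Y z)" "p z \<cdot> u = v z"
    and step: "\<And>a b k. is_succ r a b \<Longrightarrow> k \<in> hom C (X a) (Y a) \<Longrightarrow> p a \<cdot> k = v a \<Longrightarrow>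
      \<exists>l \<in> hom C (X b) (Y b). l \<cdot> \<phi> (a, b) = \<psi> (a, b) \<cdot> k \<and> p b \<cdot> l = v b"
  obtains k where "\<And>a. a \<in> Field r \<Longrightarrow> k a \<in> hom C (X a) (Y a)"
    "\<And>a. a \<in> Field r \<Longrightarrow> p a \<cdot> k a = v a"
    "\<And>a b. (a, b) \<in> r \<Longrightarrow> k b \<cdot> \<phi> (a, b) = \<psi> (a, b) \<cdot> k a"
    "k z = u"
proof -
  note Xd = order_functorD[OF X] and Yd = order_functorD[OF Y] and Bd = order_functorD[OF B]
  define P where "P k b l \<longleftrightarrow> (b \<in> Field r \<longrightarrow> l \<in> hom C (X b) (Y b) \<and> p b \<cdot> l = v b \<and>
    (\<forall>a\<in>underS r b. l \<cdot> \<phi> (a, b) = \<psi> (a, b) \<cdot> k a) \<and> (is_zero r b \<longrightarrow> l = u))" for k b l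
  have "\<exists>k. \<forall>b. P k b (k b)"
  proof (rule dependent_wf_choice)
    show "wf (r - Relation.Id)" using wo by (simp add: wo_rel.WF wo_rel_def)
    show "P f x l = P g x l" if "\<And>y. (y, x) \<in> r - Relation.Id \<Longrightarrow> f y = g y" for f g x l
      using that by (auto simp: P_def underS_iff)
    fix b k assume "\<And>a. (a, b) \<in> r - Relation.Id \<Longrightarrow> P k a (k a)"
    then have IH: "P k a (k a)" if "a \<in> underS r b" for a using that by (auto simp: underS_iff)
    have kd: "k a \<in> hom C (X a) (Y a)" "p a \<cdot> k a = v a" if "a \<in> underS r b" for a
      using IH[OF that] that by (auto simp: P_def underS_iff FieldI1)
    have kn: "k a \<cdot> \<phi> (c, a) = \<psi> (c, a) \<cdot> k c" if "a \<in> underS r b" "(c, a) \<in> r" for a c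
    proof (cases "c = a")
      case True
      then show ?thesis using Xd(2) Yd(2) that kd Comp_Id Id_Comp by (metis FieldI1)
    next
      case False
      then show ?thesis using IH[OF that(1)] that by (auto simp: P_def underS_iff FieldI2)
    qed
    show "\<exists>l. P k b l"
    proof (cases "b \<in> Field r")
      case b: True
      then show ?thesis
      proof (cases rule: stage_cases)
        case 1
        then have "b = z" using is_zero_unique wo z by metis
        then have "P k b u" using u is_zero_underS[OF wo z] by (simp add: P_def)
        then show ?thesis by blast
      next
        case (2 a)
        then have ab: "(a, b) \<in> r" "a \<in> underS r b" by (auto simp: is_succ_def underS_iff)
        then have "\<not> is_zero r b" using is_zero_underS[OF wo] by auto
        obtain l where l: "l \<in> hom C (X b) (Y b)" "l \<cdot> \<phi> (a, b) = \<psi> (a, b) \<cdot> k a" "p b \<cdot> l = v b"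
          using step[OF 2 kd[OF ab(2)]] by blast
        have "l \<cdot> \<phi> (c, b) = \<psi> (c, b) \<cdot> k c" if c: "c \<in> underS r b" for c
        proof -
          have ca: "(c, a) \<in> r" by (rule is_succ_below[OF wo 2 c])
          have "l \<cdot> \<phi> (c, b) = l \<cdot> (\<phi> (a, b) \<cdot> \<phi> (c, a))" using Xd(4)[OF ca ab(1)] by simp
          also have "\<dots> = (\<psi> (a, b) \<cdot> k a) \<cdot> \<phi> (c, a)"
            using l assoc[OF Xd(3)[OF ca] Xd(3)[OF ab(1)] l(1)] by simp
          also have "\<dots> = \<psi> (a, b) \<cdot> (\<psi> (c, a) \<cdot> k c)"
            using kn[OF ab(2) ca] assoc[OF Xd(3)[OF ca] kd(1)[OF ab(2)] Yd(3)[OF ab(1)]] by simp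
          also have "\<dots> = \<psi> (c, b) \<cdot> k c"
            using assoc[OF kd(1)[OF c] Yd(3)[OF ca] Yd(3)[OF ab(1)]] Yd(4)[OF ca ab(1)] by simp
          finally show ?thesis .
        qed
        then have "P k b l" using l \<open>\<not> is_zero r b\<close> by (simp add: P_def)
        then show ?thesis by blast
      next
        case 3
        let ?r = "Restr r (underS r b)"
        have F: "Field ?r = underS r b" by (rule Field_Restr_underS[OF wo])
        have colim: "is_colimit (order_cat ?r) C X \<phi> (X b) (\<lambda>a. \<phi> (a, b))"
          using Xlim 3 by (simp add: continuous_at_limits_def)
        have nat: "(\<psi> (c, b) \<cdot> k c) \<cdot> \<phi> (a, c) = \<psi> (a, b) \<cdot> k a" if "(a, c) \<in> ?r" for a c
        proof -
          have *: "(a, c) \<in> r" "c \<in> underS r b" "(c, b) \<in> r" "a \<in> underS r b"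
            using that by (auto simp: underS_iff)
          have "(\<psi> (c, b) \<cdot> k c) \<cdot> \<phi> (a, c) = \<psi> (c, b) \<cdot> (\<psi> (a, c) \<cdot> k a)"
            using kn[OF *(2,1)] assoc[OF Xd(3)[OF *(1)] kd(1)[OF *(2)] Yd(3)[OF *(3)]] by simp
          also have "\<dots> = \<psi> (a, b) \<cdot> k a"
            using assoc[OF kd(1)[OF *(4)] Yd(3)[OF *(1)] Yd(3)[OF *(3)]] Yd(4)[OF *(1,3)] by simp
          finally show ?thesis .
        qed
        have "\<psi> (a, b) \<cdot> k a \<in> hom C (X a) (Y b)" if "a \<in> Field ?r" for a
          using that Comp_hom[OF kd(1) Yd(3)] unfolding F by (auto simp: underS_iff)
        then obtain l where l: "l \<in> hom C (X b) (Y b)"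
          "\<And>a. a \<in> underS r b \<Longrightarrow> l \<cdot> \<phi> (a, b) = \<psi> (a, b) \<cdot> k a"
          using order_colimit_induce[OF colim Yd(1)[OF b], of "\<lambda>a. \<psi> (a, b) \<cdot> k a"] nat F by metis
        have "p b \<cdot> l = v b"
        proof (rule order_colimit_unique[OF colim])
          show "\<phi> (a, c) \<in> hom C (X a) (X c)" if "(a, c) \<in> ?r" for a c using that Xd(3) by auto
          show "p b \<cdot> l \<in> hom C (X b) (B b)" "v b \<in> hom C (X b) (B b)"
            using p(1) v(1) l b Comp_hom by auto
          fix a assume "a \<in> Field ?r"
          then have a: "a \<in> underS r b" "(a, b) \<in> r" "a \<in> Field r"
            unfolding F by (auto simp: underS_iff FieldI1)
          have "(p b \<cdot> l) \<cdot> \<phi> (a, b) = p b \<cdot> (\<psi> (a, b) \<cdot> k a)"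
            using l(2)[OF a(1)] assoc[OF Xd(3)[OF a(2)] l(1) p(1)[OF b]] by simp
          also have "\<dots> = \<beta> (a, b) \<cdot> (p a \<cdot> k a)"
            using assoc[OF kd(1)[OF a(1)] Yd(3)[OF a(2)] p(1)[OF b]]
              assoc[OF kd(1)[OF a(1)] p(1)[OF a(3)] Bd(3)[OF a(2)]] p(2)[OF a(2)] by simp
          also have "\<dots> = v b \<cdot> \<phi> (a, b)" using kd a v(2) by simp
          finally show "(p b \<cdot> l) \<cdot> \<phi> (a, b) = v b \<cdot> \<phi> (a, b)" .
        qed
        then have "P k b l" using l 3 by (simp add: P_def is_limit_elem_def)
        then show ?thesis by blast
      qed
    qed (simp add: P_def)
  qed
  then obtain k where k: "\<And>b. P k b (k b)" by blast
  have kd: "k a \<in> hom C (X a) (Y a)" "p a \<cdot> k a = v a" if "a \<in> Field r" for a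
    using k[of a] that by (auto simp: P_def)
  have "k b \<cdot> \<phi> (a, b) = \<psi> (a, b) \<cdot> k a" if "(a, b) \<in> r" for a b
  proof (cases "a = b")
    case True
    then show ?thesis using Xd(2) Yd(2) that kd Comp_Id Id_Comp by (metis FieldI1)
  next
    case False
    then show ?thesis using k[of b] that by (auto simp: P_def underS_iff FieldI2)
  qed
  moreover have "k z = u" using k[of z] z by (auto simp: P_def is_zero_def)
  ultimately show thesis using that kd by blast
qed


definition tower_over :: "('o, 'm) cat \<Rightarrow> 'j rel \<Rightarrow> ('j \<Rightarrow> 'o) \<Rightarrow> ('j \<times> 'j \<Rightarrow> 'm) \<Rightarrow>
    ('j \<Rightarrow> 'o) \<Rightarrow> ('j \<times> 'j \<Rightarrow> 'm) \<Rightarrow> ('j \<Rightarrow> 'm) \<Rightarrow> bool" where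
  "tower_over C r B \<beta> Y \<psi> p \<longleftrightarrow> is_functor (order_cat r) C Y \<psi> \<and>
     (\<forall>a\<in>Field r. p a \<in> hom C (Y a) (B a)) \<and>
     (\<forall>a b. (a, b) \<in> r \<longrightarrow> p b \<cdot>\<^bsub>C\<^esub> \<psi> (a, b) = \<beta> (a, b) \<cdot>\<^bsub>C\<^esub> p a)"

text \<open>The chosen step may depend on the whole history of the construction (Q sees Y, \<open>\<psi>\<close> and p, not
  only their values at a), which is what the bookkeeping in the small object argument needs;
  \<open>Qcong\<close> says that Q only looks at the stages constructed so far. At limit stages Y is a colimit,
  whereas B may be arbitrary there.\<close>

lemma (in category) transfinite_tower:
  fixes r :: "'u rel"
  assumes univ: "universe TYPE('u)" and co: "cocomplete TYPE('u) C"
    and wo: "Well_order r" and sm: "\<And>b. b \<in> Field r \<Longrightarrow> small TYPE('u) (underS r b)"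
    and B: "is_functor (order_cat r) C B \<beta>"
    and z: "is_zero r z" and p0: "p0 \<in> hom C Y0 (B z)"
    and Qcong: "\<And>a b Y \<psi> p Y' \<psi>' p' y e q. is_succ r a b \<Longrightarrow>
      (\<And>c. c \<in> underS r b \<Longrightarrow> Y c = Y' c \<and> p c = p' c) \<Longrightarrow>
      (\<And>c d. (c, d) \<in> r \<Longrightarrow> d \<in> underS r b \<Longrightarrow> \<psi> (c, d) = \<psi>' (c, d)) \<Longrightarrow>
      Q a b Y \<psi> p y e q \<Longrightarrow> Q a b Y' \<psi>' p' y e q"
    and step: "\<And>a b Y \<psi> p. is_succ r a b \<Longrightarrow> tower_over C (Restr r (underS r b)) B \<beta> Y \<psi> p \<Longrightarrow>
      Y z = Y0 \<Longrightarrow> p z = p0 \<Longrightarrow>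
      \<exists>y e q. e \<in> hom C (Y a) y \<and> q \<in> hom C y (B b) \<and> q \<cdot> e = \<beta> (a, b) \<cdot> p a \<and> Q a b Y \<psi> p y e q"
  obtains Y \<psi> p where "tower_over C r B \<beta> Y \<psi> p" "continuous_at_limits C r Y \<psi>"
    "Y z = Y0" "p z = p0" "\<And>a b. is_succ r a b \<Longrightarrow> Q a b Y \<psi> p (Y b) (\<psi> (a, b)) (p b)"
proof -
  note Bd = order_functorD[OF B]
  \<comment> \<open>the recursion produces, for each b, the object, all maps into it from earlier stages, and the
    projection to the base\<close>
  let ?Y = "\<lambda>F a. fst (F a)" and ?\<psi> = "\<lambda>F (a, b). fst (snd (F b)) a" and ?p = "\<lambda>F a. snd (snd (F a))"
  define P :: "('u \<Rightarrow> 'o \<times> ('u \<Rightarrow> 'm) \<times> 'm) \<Rightarrow> 'u \<Rightarrow> 'o \<times> ('u \<Rightarrow> 'm) \<times> 'm \<Rightarrow> bool"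
    where "P F b x \<longleftrightarrow> (b \<in> Field r \<longrightarrow> (case x of (y, s, q) \<Rightarrow>
      q \<in> hom C y (B b) \<and> s b = Id C y \<and>
      (\<forall>a\<in>underS r b. s a \<in> hom C (?Y F a) y \<and> q \<cdot> s a = \<beta> (a, b) \<cdot> ?p F a) \<and>
      (\<forall>a c. (a, c) \<in> r \<and> c \<in> underS r b \<longrightarrow> s c \<cdot> ?\<psi> F (a, c) = s a) \<and>
      (is_zero r b \<longrightarrow> y = Y0 \<and> q = p0) \<and>
      (\<forall>a. is_succ r a b \<longrightarrow> Q a b (?Y F) (?\<psi> F) (?p F) y (s a) q) \<and>
      (is_limit_elem r b \<longrightarrow>
        is_colimit (order_cat (Restr r (underS r b))) C (?Y F) (?\<psi> F) y s)))" for F b x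
  have Pcong: "P F b x" if "P G b x" and eq: "\<And>a. a \<in> underS r b \<Longrightarrow> F a = G a" for F G b x
  proof -
    obtain y s q where x: "x = (y, s, q)" by (cases x)
    have un: "a \<in> underS r b" if "(a, c) \<in> r" "c \<in> underS r b" for a c
      using that wo_trans[OF wo, of a c b] wo_antisym[OF wo, of c b] by (auto simp: underS_iff)
    have "Q a b (?Y F) (?\<psi> F) (?p F) y (s a) q"
      if "is_succ r a b" "Q a b (?Y G) (?\<psi> G) (?p G) y (s a) q" for a
      using that(2) by (rule Qcong[OF that(1), rotated 2]) (auto simp: eq)
    moreover have "is_colimit (order_cat (Restr r (underS r b))) C (?Y F) (?\<psi> F) y s \<longleftrightarrow>
        is_colimit (order_cat (Restr r (underS r b))) C (?Y G) (?\<psi> G) y s"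
      by (rule order_colimit_cong) (auto simp: eq Field_Restr_underS[OF wo])
    ultimately show ?thesis using \<open>P G b x\<close> eq un unfolding P_def x by auto
  qed
  \<comment> \<open>applied to the stages below b during the recursion, and to all stages at the end\<close>
  have tower: "tower_over C (Restr r A) B \<beta> (?Y F) (?\<psi> F) (?p F)"
    if IH: "\<And>a. a \<in> A \<Longrightarrow> P F a (F a)" and A: "Field (Restr r A) = A" "A \<subseteq> Field r" for F A
  proof -
    have d: "?p F a \<in> hom C (?Y F a) (B a)" "?\<psi> F (a, a) = Id C (?Y F a)"
      "c \<in> underS r a \<Longrightarrow> ?\<psi> F (c, a) \<in> hom C (?Y F c) (?Y F a)"
      "c \<in> underS r a \<Longrightarrow> ?p F a \<cdot> ?\<psi> F (c, a) = \<beta> (c, a) \<cdot> ?p F c"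
      "(d, c) \<in> r \<Longrightarrow> c \<in> underS r a \<Longrightarrow> ?\<psi> F (c, a) \<cdot> ?\<psi> F (d, c) = ?\<psi> F (d, a)"
      if "a \<in> A" for a c d
      using IH[OF that] A(2) that unfolding P_def by (auto split: prod.splits)
    have obj: "?Y F a \<in> Obj C" if "a \<in> A" for a using d(1)[OF that] hom_Obj by blast
    have hom: "?\<psi> F (c, a) \<in> hom C (?Y F c) (?Y F a)" if "(c, a) \<in> r" "a \<in> A" for a c
    proof (cases "c = a")
      case True
      then show ?thesis using d(2)[OF that(2)] Id_hom[OF obj[OF that(2)]] by simp
    next
      case False
      then show ?thesis using d(3)[OF that(2)] that(1) by (simp add: underS_iff)
    qed
    have comp: "?\<psi> F (c, a) \<cdot> ?\<psi> F (d, c) = ?\<psi> F (d, a)" if "(d, c) \<in> r" "(c, a) \<in> r" "a \<in> A" for a c d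
    proof (cases "c = a")
      case True
      then show ?thesis using d(2)[OF that(3)] Id_Comp[OF hom[OF that(1)]] that by simp
    next
      case False
      then show ?thesis using d(5)[OF that(3,1)] that(2) by (simp add: underS_iff)
    qed
    have nat: "?p F a \<cdot> ?\<psi> F (c, a) = \<beta> (c, a) \<cdot> ?p F c" if "(c, a) \<in> r" "a \<in> A" for a c
    proof (cases "c = a")
      case True
      then show ?thesis
        using d(1,2)[OF that(2)] Comp_Id Id_Comp Bd(2)[of a] A(2) that(2) by auto
    next
      case False
      then show ?thesis using d(4)[OF that(2)] that(1) by (simp add: underS_iff)
    qed
    show ?thesis
      unfolding tower_over_def order_functor_iff A
      using d(1,2) obj hom comp nat by auto
  qed
  have "\<exists>F. \<forall>b. P F b (F b)"
  proof (rule dependent_wf_choice)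
    show "wf (r - Relation.Id)" using wo by (simp add: wo_rel.WF wo_rel_def)
    show "P F b x = P G b x" if "\<And>a. (a, b) \<in> r - Relation.Id \<Longrightarrow> F a = G a" for F G b x
      using Pcong[of G b x F] Pcong[of F b x G] that by (auto simp: underS_iff)
    fix b F assume "\<And>a. (a, b) \<in> r - Relation.Id \<Longrightarrow> P F a (F a)"
    then have IH: "P F a (F a)" if "a \<in> underS r b" for a using that by (auto simp: underS_iff)
    let ?r = "Restr r (underS r b)"
    have F: "Field ?r = underS r b" by (rule Field_Restr_underS[OF wo])
    have tow: "tower_over C ?r B \<beta> (?Y F) (?\<psi> F) (?p F)"
      by (rule tower[OF IH F]) (auto simp: underS_iff FieldI1)
    have func: "is_functor (order_cat ?r) C (?Y F) (?\<psi> F)"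
      and pd: "\<And>a. a \<in> underS r b \<Longrightarrow> ?p F a \<in> hom C (?Y F a) (B a)"
      and pn: "\<And>a c. (a, c) \<in> ?r \<Longrightarrow> ?p F c \<cdot> ?\<psi> F (a, c) = \<beta> (a, c) \<cdot> ?p F a"
      using tow unfolding tower_over_def F by blast+
    note fd = order_functorD[OF func, unfolded F]
    have un: "(a, c) \<in> ?r" if "(a, c) \<in> r" "c \<in> underS r b" for a c
      using that wo_trans[OF wo, of a c b] wo_antisym[OF wo, of c b] by (auto simp: underS_iff)
    show "\<exists>x. P F b x"
    proof (cases "b \<in> Field r")
      case b: True
      then show ?thesis
      proof (cases rule: stage_cases)
        case 1
        then have [simp]: "b = z" using is_zero_unique wo z by metis
        have "underS r b = {}" using is_zero_underS[OF wo z] by simp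
        moreover have "\<not> is_succ r a b" for a
          using calculation by (auto simp: is_succ_def underS_iff)
        ultimately have "P F b (Y0, \<lambda>_. Id C Y0, p0)"
          using p0 1 by (auto simp: P_def is_limit_elem_def)
        then show ?thesis by blast
      next
        case (2 a)
        then have ab: "(a, b) \<in> r" "a \<in> underS r b" "a \<noteq> b" by (auto simp: is_succ_def underS_iff)
        then have nz: "\<not> is_zero r b" using is_zero_underS[OF wo] by auto
        have "z \<in> underS r b" using z b nz by (auto simp: is_zero_def underS_iff)
        then have "?Y F z = Y0" "?p F z = p0"
          using IH[of z] z by (auto simp: P_def is_zero_def split: prod.splits)
        then obtain y e q where e: "e \<in> hom C (?Y F a) y" and q: "q \<in> hom C y (B b)"
          and eq: "q \<cdot> e = \<beta> (a, b) \<cdot> ?p F a" and Q: "Q a b (?Y F) (?\<psi> F) (?p F) y e q"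
          using step[OF 2 tow] by blast
        define s where "s c = (if c = b then Id C y else if c = a then e else e \<cdot> ?\<psi> F (c, a))" for c
        have s: "s c = e \<cdot> ?\<psi> F (c, a)" "(c, a) \<in> ?r" if "c \<in> underS r b" for c
        proof -
          show ca: "(c, a) \<in> ?r" using un[OF is_succ_below[OF wo 2 that] ab(2)] .
          show "s c = e \<cdot> ?\<psi> F (c, a)"
            using that fd(2)[OF ab(2)] Comp_Id[OF e] ab(3) by (auto simp: s_def underS_iff)
        qed
        have 1: "s c \<in> hom C (?Y F c) y \<and> q \<cdot> s c = \<beta> (c, b) \<cdot> ?p F c" if c: "c \<in> underS r b" for c
        proof
          note sc = s[OF c] and h = fd(3)[OF s(2)[OF c]]
          show "s c \<in> hom C (?Y F c) y" unfolding sc(1) by (rule Comp_hom[OF h e])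
          have "q \<cdot> s c = (q \<cdot> e) \<cdot> ?\<psi> F (c, a)" unfolding sc(1) using assoc[OF h e q] by simp
          also have "\<dots> = \<beta> (a, b) \<cdot> (\<beta> (c, a) \<cdot> ?p F c)"
            unfolding eq using assoc[OF h pd[OF ab(2)] Bd(3)[OF ab(1)]] pn[OF sc(2)] by simp
          also have "\<dots> = \<beta> (c, b) \<cdot> ?p F c"
            using assoc[OF pd[OF c] Bd(3) Bd(3)[OF ab(1)]] sc(2) Bd(4)[OF _ ab(1)] by auto
          finally show "q \<cdot> s c = \<beta> (c, b) \<cdot> ?p F c" .
        qed
        have 2: "s d \<cdot> ?\<psi> F (c, d) = s c" if "(c, d) \<in> r" "d \<in> underS r b" for c d
        proof -
          have cd: "(c, d) \<in> ?r" using un[OF that] .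
          then have c: "c \<in> underS r b" by blast
          have "s d \<cdot> ?\<psi> F (c, d) = e \<cdot> (?\<psi> F (d, a) \<cdot> ?\<psi> F (c, d))"
            using s[OF that(2)] assoc[OF fd(3)[OF cd] fd(3)[OF s(2)[OF that(2)]] e] by simp
          then show ?thesis using s(1)[OF c] fd(4)[OF cd s(2)[OF that(2)]] by simp
        qed
        have "s a = e" using ab(3) by (simp add: s_def)
        have "Q a' b (?Y F) (?\<psi> F) (?p F) y (s a') q" if "is_succ r a' b" for a'
          using is_succ_unique[OF wo that \<open>is_succ r a b\<close>] Q \<open>s a = e\<close> by simp
        moreover have "\<not> is_limit_elem r b" using \<open>is_succ r a b\<close> by (auto simp: is_limit_elem_def)
        moreover have "s b = Id C y" by (simp add: s_def)
        ultimately have "P F b (y, s, q)" using q nz 1 2 by (simp add: P_def)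
        then show ?thesis by blast
      next
        case 3
        have "small_category TYPE('u) (order_cat ?r)"
          by (rule order_cat_small[OF univ Well_order_Restr[OF wo]]) (simp add: F sm[OF b])
        then obtain L \<kappa> where L: "is_colimit (order_cat ?r) C (?Y F) (?\<psi> F) L \<kappa>"
          using small_colimit_exists[OF co _ func] by blast
        note Ld = order_colimitD[OF L, unfolded F]
        define s where "s c = (if c = b then Id C L else \<kappa> c)" for c
        have s: "s c = \<kappa> c" if "c \<in> underS r b" for c using that by (auto simp: s_def underS_iff)
        have sL: "is_colimit (order_cat ?r) C (?Y F) (?\<psi> F) L s"
          using order_colimit_cong[of ?r "?Y F" "?Y F" "?\<psi> F" "?\<psi> F" s \<kappa> C L] s L F by auto
        have "\<beta> (a, b) \<cdot> ?p F a \<in> hom C (?Y F a) (B b)" if "a \<in> underS r b" for a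
          using Comp_hom[OF pd[OF that] Bd(3)] that by (auto simp: underS_iff)
        moreover have "(\<beta> (c, b) \<cdot> ?p F c) \<cdot> ?\<psi> F (a, c) = \<beta> (a, b) \<cdot> ?p F a" if ac: "(a, c) \<in> ?r" for a c
        proof -
          have *: "a \<in> underS r b" "c \<in> underS r b" "(a, c) \<in> r" "(c, b) \<in> r"
            using ac by (auto simp: underS_iff)
          show ?thesis
            using assoc[OF fd(3)[OF ac] pd[OF *(2)] Bd(3)[OF *(4)]] pn[OF ac]
              assoc[OF pd[OF *(1)] Bd(3)[OF *(3)] Bd(3)[OF *(4)]] Bd(4)[OF *(3,4)] by simp
        qed
        ultimately obtain q where q: "q \<in> hom C L (B b)"
          "\<And>a. a \<in> underS r b \<Longrightarrow> q \<cdot> \<kappa> a = \<beta> (a, b) \<cdot> ?p F a"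
          using order_colimit_induce[OF L Bd(1)[OF b], of "\<lambda>a. \<beta> (a, b) \<cdot> ?p F a"] unfolding F by metis
        have "\<forall>a\<in>underS r b. s a \<in> hom C (?Y F a) L \<and> q \<cdot> s a = \<beta> (a, b) \<cdot> ?p F a"
          using s Ld(2) q(2) by simp
        moreover have "s c \<cdot> ?\<psi> F (a, c) = s a" if "(a, c) \<in> r" "c \<in> underS r b" for a c
          using un[OF that] Ld(3)[OF un[OF that]] s by (metis IntD2 SigmaD1 SigmaD2)
        moreover have "s b = Id C L" "\<not> is_zero r b" "\<not> is_succ r a b" for a
          using 3 by (auto simp: s_def is_limit_elem_def)
        ultimately have "P F b (L, s, q)" using q(1) sL by (simp add: P_def)
        then show ?thesis by blast
      qed
    qed (simp add: P_def)
  qed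
  then obtain F where F: "\<And>b. P F b (F b)" by blast
  have R: "Restr r (Field r) = r" by (rule Restr_Field)
  have d: "tower_over C r B \<beta> (?Y F) (?\<psi> F) (?p F)"
    using tower[OF F, of "Field r"] unfolding R by simp
  have cont: "continuous_at_limits C r (?Y F) (?\<psi> F)"
    unfolding continuous_at_limits_def
  proof (intro allI impI)
    fix b assume "is_limit_elem r b"
    then have "is_colimit (order_cat (Restr r (underS r b))) C (?Y F) (?\<psi> F) (?Y F b) (fst (snd (F b)))"
      using F[of b] unfolding P_def by (auto simp: is_limit_elem_def split: prod.splits)
    then show "is_colimit (order_cat (Restr r (underS r b))) C (?Y F) (?\<psi> F) (?Y F b) (\<lambda>a. ?\<psi> F (a, b))"
      by simp
  qed
  have "?Y F z = Y0" "?p F z = p0"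
    using F[of z] z unfolding P_def by (auto simp: is_zero_def split: prod.splits)
  moreover have "Q a b (?Y F) (?\<psi> F) (?p F) (?Y F b) (?\<psi> F (a, b)) (?p F b)" if "is_succ r a b" for a b
    using F[of b] that unfolding P_def by (auto simp: is_succ_def FieldI2 split: prod.splits)
  ultimately show thesis using that[of "?Y F" "?\<psi> F" "?p F"] d cont by blast
qed


section \<open>Lifting against transfinite compositions\<close>

lemma rlpE:
  assumes "rlp C i p" "i \<in> hom C A B" "p \<in> hom C E F" "u \<in> hom C A E" "v \<in> hom C B F"
    "p \<cdot>\<^bsub>C\<^esub> u = v \<cdot>\<^bsub>C\<^esub> i"
  obtains k where "k \<in> hom C B E" "k \<cdot>\<^bsub>C\<^esub> i = u" "p \<cdot>\<^bsub>C\<^esub> k = v"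
  using assms unfolding rlp_def by (auto simp: homD)

lemma rlpI:
  assumes "i \<in> hom C A B" "p \<in> hom C E F"
    "\<And>u v. u \<in> hom C A E \<Longrightarrow> v \<in> hom C B F \<Longrightarrow> p \<cdot>\<^bsub>C\<^esub> u = v \<cdot>\<^bsub>C\<^esub> i \<Longrightarrow>
      \<exists>k \<in> hom C B E. k \<cdot>\<^bsub>C\<^esub> i = u \<and> p \<cdot>\<^bsub>C\<^esub> k = v"
  shows "rlp C i p"
  unfolding rlp_def using assms by (auto simp: homD)

lemma pushoutD:
  assumes "is_pushout C f g P j\<^sub>0 j\<^sub>1" "f \<in> hom C A B" "g \<in> hom C A B'"
  shows "P \<in> Obj C" "j\<^sub>0 \<in> hom C B P" "j\<^sub>1 \<in> hom C B' P" "j\<^sub>0 \<cdot>\<^bsub>C\<^esub> f = j\<^sub>1 \<cdot>\<^bsub>C\<^esub> g"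
    and "\<And>T a b. a \<in> hom C B T \<Longrightarrow> b \<in> hom C B' T \<Longrightarrow> T \<in> Obj C \<Longrightarrow> a \<cdot>\<^bsub>C\<^esub> f = b \<cdot>\<^bsub>C\<^esub> g \<Longrightarrow>
      \<exists>!h. h \<in> hom C P T \<and> h \<cdot>\<^bsub>C\<^esub> j\<^sub>0 = a \<and> h \<cdot>\<^bsub>C\<^esub> j\<^sub>1 = b"
  using assms unfolding is_pushout_def by (auto simp: homD)

context category
begin

lemma pushout_unique:
  assumes P: "is_pushout C f g P j\<^sub>0 j\<^sub>1" "f \<in> hom C A B" "g \<in> hom C A B'"
    and h: "h \<in> hom C P T" "h' \<in> hom C P T" "h \<cdot> j\<^sub>0 = h' \<cdot> j\<^sub>0" "h \<cdot> j\<^sub>1 = h' \<cdot> j\<^sub>1"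
  shows "h = h'"
proof -
  note Pd = pushoutD[OF P]
  have "(h \<cdot> j\<^sub>0) \<cdot> f = (h \<cdot> j\<^sub>1) \<cdot> g"
    using assoc[OF P(2) Pd(2) h(1)] assoc[OF P(3) Pd(3) h(1)] Pd(4) by simp
  from Pd(5)[OF Comp_hom[OF Pd(2) h(1)] Comp_hom[OF Pd(3) h(1)] hom_Obj(2)[OF h(1)] this]
  show ?thesis using h by metis
qed

lemma rlp_pushout:
  assumes i: "rlp C i p" and P: "is_pushout C i a P b f" and p: "p \<in> Arr C"
  shows "rlp C f p"
proof -
  have ih: "i \<in> hom C (Dom C i) (Cod C i)" and ah: "a \<in> hom C (Dom C i) (Cod C a)"
    using P by (auto simp: is_pushout_def hom_def)
  note Pd = pushoutD[OF P ih ah] and ph = Arr_hom[OF p]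
  show ?thesis
  proof (rule rlpI[OF Pd(3) ph])
    fix u v assume u: "u \<in> hom C (Cod C a) (Dom C p)" and v: "v \<in> hom C P (Cod C p)"
      and eq: "p \<cdot> u = v \<cdot> f"
    have "p \<cdot> (u \<cdot> a) = (v \<cdot> b) \<cdot> i"
      using assoc[OF ah u ph] assoc[OF ah Pd(3) v] assoc[OF ih Pd(2) v] eq Pd(4) by simp
    then obtain k where k: "k \<in> hom C (Cod C i) (Dom C p)" "k \<cdot> i = u \<cdot> a" "p \<cdot> k = v \<cdot> b"
      using rlpE[OF i ih ph Comp_hom[OF ah u] Comp_hom[OF Pd(2) v]] by blast
    obtain h where h: "h \<in> hom C P (Dom C p)" "h \<cdot> b = k" "h \<cdot> f = u"
      using Pd(5)[OF k(1) u hom_Obj(2)[OF u] k(2)] by blast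
    have "p \<cdot> h = v"
      by (rule pushout_unique[OF P ih ah Comp_hom[OF h(1) ph] v])
        (use h k eq assoc[OF Pd(2) h(1) ph] assoc[OF Pd(3) h(1) ph] in simp_all)
    then show "\<exists>k\<in>hom C P (Dom C p). k \<cdot> f = u \<and> p \<cdot> k = v" using h by blast
  qed
qed

lemma constant_functor:
  "X \<in> Obj C \<Longrightarrow> is_functor (order_cat r) C (\<lambda>_. X) (\<lambda>_. Id C X)"
  unfolding order_functor_iff using Id_hom Comp_Id by blast

lemma transfinite_seqD:
  assumes "transfinite_seq C r X \<phi>"
  shows "Well_order r" "small TYPE('u) (Field (r :: 'u rel))" "is_functor (order_cat r) C X \<phi>"
    "continuous_at_limits C r X \<phi>"
  using assms unfolding transfinite_seq_def small_ordinal_def continuous_at_limits_def by auto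

text \<open>Compatible lifts on all stages, with values in the constant sequence at the domain of p,
  induce a lift on the colimit.\<close>

lemma rlp_transfinite_composition:
  fixes r :: "'u rel"
  assumes X: "transfinite_seq C r X \<phi>" and L: "is_colimit (order_cat r) C X \<phi> L \<kappa>"
    and z: "is_zero r z" and p: "p \<in> Arr C"
    and steps: "\<And>a b. is_succ r a b \<Longrightarrow> rlp C (\<phi> (a, b)) p"
  shows "rlp C (\<kappa> z) p"
proof -
  note Xs = transfinite_seqD[OF X] and ph = Arr_hom[OF p] and Ld = order_colimitD[OF L]
  note Xd = order_functorD[OF Xs(3)]
  have zF: "z \<in> Field r" using z by (simp add: is_zero_def)
  show ?thesis
  proof (rule rlpI[OF Ld(2)[OF zF] ph])
    fix u v assume u: "u \<in> hom C (X z) (Dom C p)" and v: "v \<in> hom C L (Cod C p)"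
      and eq: "p \<cdot> u = v \<cdot> \<kappa> z"
    have E: "Dom C p \<in> Obj C" "Cod C p \<in> Obj C" using ph hom_Obj by auto
    obtain k where k: "\<And>a. a \<in> Field r \<Longrightarrow> k a \<in> hom C (X a) (Dom C p)"
      "\<And>a. a \<in> Field r \<Longrightarrow> p \<cdot> k a = v \<cdot> \<kappa> a"
      "\<And>a b. (a, b) \<in> r \<Longrightarrow> k b \<cdot> \<phi> (a, b) = Id C (Dom C p) \<cdot> k a" "k z = u"
    proof (rule transfinite_lift[OF Xs(1,3,4) constant_functor[OF E(1)] constant_functor[OF E(2)],
          of "\<lambda>_. p" "\<lambda>a. v \<cdot> \<kappa> a" z u])
      show "p \<cdot> Id C (Dom C p) = Id C (Cod C p) \<cdot> p" using Comp_Id[OF ph] Id_Comp[OF ph] by simp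
      show va: "v \<cdot> \<kappa> a \<in> hom C (X a) (Cod C p)" if "a \<in> Field r" for a
        using Comp_hom[OF Ld(2)[OF that] v] .
      show "(v \<cdot> \<kappa> b) \<cdot> \<phi> (a, b) = Id C (Cod C p) \<cdot> (v \<cdot> \<kappa> a)" if "(a, b) \<in> r" for a b
        using assoc[OF Xd(3)[OF that] Ld(2) v] Ld(3)[OF that] Id_Comp[OF va] that
        by (simp add: FieldI1 FieldI2)
      fix a b k assume ab: "is_succ r a b" and k: "k \<in> hom C (X a) (Dom C p)" "p \<cdot> k = v \<cdot> \<kappa> a"
      have abr: "(a, b) \<in> r" using ab by (simp add: is_succ_def)
      have bF: "b \<in> Field r" using abr by (rule FieldI2)
      have "p \<cdot> k = (v \<cdot> \<kappa> b) \<cdot> \<phi> (a, b)"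
        using k(2) assoc[OF Xd(3)[OF abr] Ld(2)[OF bF] v] Ld(3)[OF abr] by simp
      then obtain l where "l \<in> hom C (X b) (Dom C p)" "l \<cdot> \<phi> (a, b) = k" "p \<cdot> l = v \<cdot> \<kappa> b"
        using rlpE[OF steps[OF ab] Xd(3)[OF abr] ph k(1) va[OF bF]] by blast
      then show "\<exists>l\<in>hom C (X b) (Dom C p). l \<cdot> \<phi> (a, b) = Id C (Dom C p) \<cdot> k \<and> p \<cdot> l = v \<cdot> \<kappa> b"
        using Id_Comp[OF k(1)] by auto
    qed (use ph z u eq in auto)
    have "k b \<cdot> \<phi> (a, b) = k a" if "(a, b) \<in> r" for a b
      using k(3)[OF that] Id_Comp[OF k(1)] that by (simp add: FieldI1)
    then obtain h where h: "h \<in> hom C L (Dom C p)" "\<And>a. a \<in> Field r \<Longrightarrow> h \<cdot> \<kappa> a = k a"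
      using order_colimit_induce[OF L E(1), of k] k(1) by metis
    have "p \<cdot> h = v"
      by (rule order_colimit_unique[OF L _ Comp_hom[OF h(1) ph] v])
        (use Xd(3) h k(2) assoc[OF Ld(2) h(1) ph] in auto)
    then show "\<exists>k\<in>hom C L (Dom C p). k \<cdot> \<kappa> z = u \<and> p \<cdot> k = v"
      using h zF k(4) by blast
  qed
qed

lemma rlp_cell:
  assumes f: "f \<in> cell_class TYPE('u) C K" and p: "p \<in> inj_class C K"
  shows "rlp C f p"
proof -
  obtain r :: "'u rel" and X \<phi> L \<kappa> z where X: "transfinite_seq C r X \<phi>"
    and st: "steps_in r \<phi> (pushouts C K)" and L: "is_colimit (order_cat r) C X \<phi> L \<kappa>"
    and z: "is_zero r z" and f: "f = \<kappa> z"
    using f unfolding cell_class_def transfinite_compositions_def by blast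
  have "rlp C (\<phi> (a, b)) p" if "is_succ r a b" for a b
    using st that p rlp_pushout unfolding steps_in_def pushouts_def inj_class_def by blast
  moreover have "p \<in> Arr C" using p by (simp add: inj_class_def)
  ultimately show ?thesis unfolding f by (intro rlp_transfinite_composition[OF X L z])
qed

lemma cell_Arr: "f \<in> cell_class TYPE('u) C K \<Longrightarrow> f \<in> Arr C"
  unfolding cell_class_def transfinite_compositions_def
  using order_colimitD(2) by (fastforce simp: is_zero_def dest: homD)

lemma colimit_at_top:
  assumes wo: "Well_order r" and X: "is_functor (order_cat r) C X \<phi>"
    and m: "m \<in> Field r" "\<And>a. a \<in> Field r \<Longrightarrow> (a, m) \<in> r"
  shows "is_colimit (order_cat r) C X \<phi> (X m) (\<lambda>a. \<phi> (a, m))"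
proof -
  note Xd = order_functorD[OF X]
  have "is_cocone (order_cat r) C X \<phi> (X m) (\<lambda>a. \<phi> (a, m))"
    unfolding order_cocone_iff using Xd m by (auto simp: FieldI1 FieldI2)
  moreover have "\<exists>!h. h \<in> hom C (X m) M \<and> (\<forall>j\<in>Obj (order_cat r). h \<cdot> \<phi> (j, m) = \<rho> j)"
    if cc: "is_cocone (order_cat r) C X \<phi> M \<rho>" for M \<rho>
  proof (rule ex1I[of _ "\<rho> m"])
    have \<rho>: "\<rho> a \<in> hom C (X a) M" "(a, b) \<in> r \<Longrightarrow> \<rho> b \<cdot> \<phi> (a, b) = \<rho> a" if "a \<in> Field r" for a b
      using cc that unfolding order_cocone_iff by auto
    show "\<rho> m \<in> hom C (X m) M \<and> (\<forall>j\<in>Obj (order_cat r). \<rho> m \<cdot> \<phi> (j, m) = \<rho> j)"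
      using \<rho> m by (auto simp: order_cat_def)
    fix h assume "h \<in> hom C (X m) M \<and> (\<forall>j\<in>Obj (order_cat r). h \<cdot> \<phi> (j, m) = \<rho> j)"
    then show "h = \<rho> m" using Xd(2)[OF m(1)] Comp_Id[of h "X m" M] m(1) by (auto simp: order_cat_def)
  qed
  ultimately show ?thesis unfolding is_colimit_def by blast
qed

end

lemma two_stage_order:
  assumes "r = {(a, a), (b, b), (a, b)}"
  shows "Well_order r" "Field r = {a, b}"
proof -
  show F: "Field r = {a, b}" unfolding assms by (auto simp: Field_def)
  have "wf (r - Relation.Id)"
    by (rule finite_acyclic_wf)
      (auto simp: assms acyclic_def elim: trancl.cases)
  moreover have "refl_on {a, b} r" unfolding assms refl_on_def by blast
  moreover have "r \<subseteq> {a, b} \<times> {a, b}" unfolding assms by blast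
  moreover have "trans r" unfolding assms trans_def by blast
  moreover have "antisym r" unfolding assms antisym_def by blast
  moreover have "total_on {a, b} r" unfolding assms total_on_def by blast
  ultimately show "Well_order r" unfolding order_on_defs F by blast
qed

text \<open>Both cases use an order with bottom a and top b: two stages for an element of D, and a single
  stage \<open>a = b\<close> for an identity, where there are no steps.\<close>

lemma (in category) mem_transfinite_compositions:
  assumes u: "universe TYPE('u)" and f: "f \<in> hom C X Y" and D: "f \<in> D \<or> f = Id C X"
  shows "f \<in> transfinite_compositions TYPE('u) C D"
proof -
  obtain a b :: 'u where ab: "if f \<in> D then a \<noteq> b else a = b"
    using universe_infinite[OF u] by (metis (full_types) UNIV_eq_I finite.simps insert_iff)
  define r where "r = {(a, a), (b, b), (a, b)}"
  note r = two_stage_order[OF r_def]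
  define Z where "Z x = (if x = a then X else Y)" for x
  define \<phi> where "\<phi> = (\<lambda>(x, y). if x = y then Id C (Z x) else f)"
  have "X = Y" if "f = Id C X" using f that Id_hom[of X] hom_Obj(1)[OF f] by (auto simp: hom_def)
  then have func: "is_functor (order_cat r) C Z \<phi>"
    unfolding order_functor_iff r(2) using f Id_hom hom_Obj[OF f] Comp_Id Id_Comp Comp_Id[OF Id_hom]
    by (auto simp: r_def Z_def \<phi>_def)
  have nolim: "\<not> is_limit_elem r c" for c
    using ab by (auto simp: is_limit_elem_def is_zero_def is_succ_def r(2) r_def)
  have "transfinite_seq C r Z \<phi>"
    unfolding transfinite_seq_def small_ordinal_def using r func nolim small_finite[OF u, of "{a, b}"] by auto
  moreover have "steps_in r \<phi> D"
    using ab by (auto simp: steps_in_def is_succ_def r_def \<phi>_def split: if_splits)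
  moreover have "is_colimit (order_cat r) C Z \<phi> (Z b) (\<lambda>c. \<phi> (c, b))"
    by (rule colimit_at_top[OF r(1) func]) (auto simp: r(2) r_def)
  moreover have "is_zero r a" by (auto simp: is_zero_def r(2) r_def)
  moreover have "f = \<phi> (a, b)" using ab D by (auto simp: \<phi>_def Z_def split: if_splits)
  ultimately show ?thesis unfolding transfinite_compositions_def by blast
qed


section \<open>The small object argument\<close>

text \<open>The surjectivity half of smallness, with the bound S made explicit. This half is what
  lifting arguments use, and it passes to retracts of sequences.\<close>

definition factors_through_stages :: "'u itself \<Rightarrow> ('o, 'm) cat \<Rightarrow> 'm set \<Rightarrow> 'u set \<Rightarrow> 'o \<Rightarrow> bool" where
  "factors_through_stages _ C D S A \<longleftrightarrow>
     (\<forall>(r :: 'u rel) X \<phi> L \<kappa>. filtered_ordinal S r \<and> transfinite_seq C r X \<phi> \<and> steps_in r \<phi> D \<and>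
        is_colimit (order_cat r) C X \<phi> L \<kappa> \<longrightarrow>
        (\<forall>v \<in> hom C A L. \<exists>a \<in> Field r. \<exists>g \<in> hom C A (X a). \<kappa> a \<cdot>\<^bsub>C\<^esub> g = v))"

lemma factors_through_stages_mono:
  assumes A: "factors_through_stages TYPE('u) C D S A" and D: "D' \<subseteq> D" and S: "S \<subseteq> S'"
  shows "factors_through_stages TYPE('u) C D' S' A"
proof -
  have "filtered_ordinal S r" if "filtered_ordinal S' r" for r :: "'u rel"
  proof -
    have "|B| \<le>o |S'|" if "|B| \<le>o |S|" for B :: "'u set"
      using that card_of_mono1[OF S] by (rule ordLeq_transitive)
    then show ?thesis using that unfolding filtered_ordinal_def by blast
  qed
  moreover have "steps_in r \<phi> D" if "steps_in r \<phi> D'" for r :: "'u rel" and \<phi>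
    using that D unfolding steps_in_def by blast
  ultimately show ?thesis using A unfolding factors_through_stages_def by blast
qed

text \<open>All members of an equivalence class have the same composite into the colimit, so the element
  chosen from the image of the class is that of any representative.\<close>

lemma (in category) small_relative_factors:
  assumes "small_relative TYPE('u) C D A"
  shows "\<exists>S. small TYPE('u) S \<and> factors_through_stages TYPE('u) C D S A"
proof -
  obtain S :: "'u set" where S: "small TYPE('u) S" and
    bij: "\<And>r X \<phi> L \<kappa>. filtered_ordinal S r \<Longrightarrow> transfinite_seq C r X \<phi> \<Longrightarrow> steps_in r \<phi> D \<Longrightarrow>
        is_colimit (order_cat r) C X \<phi> L \<kappa> \<Longrightarrow>
        bij_betw (\<lambda>c. the_elem ((\<lambda>(a, g). \<kappa> a \<cdot> g) ` c)) (hom_colim C A r X \<phi>) (hom C A L)"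
    using assms unfolding small_relative_def by blast
  have "\<exists>a \<in> Field r. \<exists>g \<in> hom C A (X a). \<kappa> a \<cdot> g = v"
    if fo: "filtered_ordinal S r" and seq: "transfinite_seq C r X \<phi>" and st: "steps_in r \<phi> D"
      and L: "is_colimit (order_cat r) C X \<phi> L \<kappa>" and v: "v \<in> hom C A L"
    for r :: "'u rel" and X \<phi> L \<kappa> v
  proof -
    note Xd = order_functorD[OF transfinite_seqD(3)[OF seq]] and Ld = order_colimitD[OF L]
      and wo = transfinite_seqD(1)[OF seq]
    let ?E = "{((a, g), (b, h)). (a, g) \<in> hom_seq C A r X \<and> (b, h) \<in> hom_seq C A r X \<and>
        (\<exists>c. (a, c) \<in> r \<and> (b, c) \<in> r \<and> \<phi> (a, c) \<cdot> g = \<phi> (b, c) \<cdot> h)}"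
    obtain c where c: "c \<in> hom_colim C A r X \<phi>" and vc: "v = the_elem ((\<lambda>(a, g). \<kappa> a \<cdot> g) ` c)"
      using bij[OF fo seq st L] v unfolding bij_betw_def by blast
    then obtain a g where ag: "(a, g) \<in> hom_seq C A r X" and ceq: "c = ?E `` {(a, g)}"
      unfolding hom_colim_def quotient_def by auto
    have a: "a \<in> Field r" and g: "g \<in> hom C A (X a)" using ag by (auto simp: hom_seq_def)
    have val: "\<kappa> b \<cdot> h = \<kappa> a \<cdot> g" if bh: "(b, h) \<in> c" for b h
    proof -
      obtain d where d: "(a, d) \<in> r" "(b, d) \<in> r" "\<phi> (a, d) \<cdot> g = \<phi> (b, d) \<cdot> h" and h: "h \<in> hom C A (X b)"
        using bh unfolding ceq hom_seq_def by auto
      have "d \<in> Field r" using d(1) by (rule FieldI2)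
      then show ?thesis
        using assoc[OF g Xd(3)[OF d(1)] Ld(2)] assoc[OF h Xd(3)[OF d(2)] Ld(2)] d(3)
          Ld(3)[OF d(1)] Ld(3)[OF d(2)] by metis
    qed
    have "(a, g) \<in> c" using wo_refl[OF wo a] ag unfolding ceq by auto
    then have "\<kappa> a \<cdot> g \<in> (\<lambda>(a, g). \<kappa> a \<cdot> g) ` c" by (rule rev_image_eqI) simp
    moreover have "(\<lambda>(a, g). \<kappa> a \<cdot> g) ` c \<subseteq> {\<kappa> a \<cdot> g}" using val by clarsimp
    ultimately have "(\<lambda>(a, g). \<kappa> a \<cdot> g) ` c = {\<kappa> a \<cdot> g}" by blast
    then have "v = \<kappa> a \<cdot> g" using vc by simp
    then show ?thesis using a g by blast
  qed
  then show ?thesis using S unfolding factors_through_stages_def by blast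
qed

text \<open>The small object argument runs along a single ordinal, so one bound S has to serve the domains
  of all maps in K.\<close>

lemma uniform_factors:
  assumes u: "universe TYPE('u)" and K: "small TYPE('u) K"
    and fac: "\<And>k. k \<in> K \<Longrightarrow> \<exists>S. small TYPE('u) S \<and> factors_through_stages TYPE('u) C D S (A k)"
  shows "\<exists>S. small TYPE('u) S \<and> (\<forall>k \<in> K. factors_through_stages TYPE('u) C D S (A k))"
proof -
  obtain S where S: "\<And>k. k \<in> K \<Longrightarrow> small TYPE('u) (S k)"
    "\<And>k. k \<in> K \<Longrightarrow> factors_through_stages TYPE('u) C D (S k) (A k)"
    using fac by metis
  then have "small TYPE('u) (\<Union>k\<in>K. S k)" by (intro small_UN[OF u K])
  moreover have "factors_through_stages TYPE('u) C D (\<Union>k\<in>K. S k) (A k)" if "k \<in> K" for k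
    using factors_through_stages_mono[OF S(2)[OF that] order_refl] that by blast
  ultimately show ?thesis by blast
qed

lemma is_succ_exists:
  assumes wo: "Well_order r" and ab: "(a, b) \<in> r" "a \<noteq> b"
  shows "\<exists>c. is_succ r a c"
proof -
  interpret wo_rel r using wo by (simp add: wo_rel_def)
  define B where "B = {c. (a, c) \<in> r \<and> c \<noteq> a}"
  have B: "B \<subseteq> Field r" "B \<noteq> {}" using ab by (auto simp: B_def FieldI2)
  have m: "minim B \<in> B" using minim_in[OF B] .
  have "c = minim B" if "c \<in> B" "(c, minim B) \<in> r" for c
    using wo_antisym[OF wo that(2) minim_least[OF B(1) that(1)]] .
  then have "is_succ r a (minim B)" using m unfolding is_succ_def B_def by auto
  then show ?thesis by blast
qed

lemma is_zero_exists:
  assumes "Well_order r" "Field r \<noteq> {}" shows "\<exists>z. is_zero r z"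
proof -
  interpret wo_rel r using assms(1) by (simp add: wo_rel_def)
  have "is_zero r (minim (Field r))"
    using minim_in[OF order_refl assms(2)] minim_least[OF order_refl] by (simp add: is_zero_def)
  then show ?thesis by blast
qed

lemma segment_stages:
  assumes wo: "Well_order r" and b: "b \<in> underS r l"
  shows "underS (Restr r (underS r l)) b = underS r b"
    "is_succ (Restr r (underS r l)) a b \<longleftrightarrow> is_succ r a b"
    "is_limit_elem (Restr r (underS r l)) b \<longleftrightarrow> is_limit_elem r b"
    "is_zero (Restr r (underS r l)) b \<longleftrightarrow> is_zero r b"
proof -
  have down: "a \<in> underS r l" if "(a, b) \<in> r" for a
    using that b wo_trans[OF wo that] wo_antisym[OF wo, of b l] by (auto simp: underS_iff)
  show "underS (Restr r (underS r l)) b = underS r b" using down b by (auto simp: underS_def)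
  show s: "is_succ (Restr r (underS r l)) a b \<longleftrightarrow> is_succ r a b" for a
  proof -
    have e1: "(c, b) \<in> Restr r (underS r l) \<longleftrightarrow> (c, b) \<in> r" for c using down b by blast
    have e2: "(a, c) \<in> Restr r (underS r l) \<longleftrightarrow> (a, c) \<in> r" if "(a, b) \<in> r" "(c, b) \<in> r" for c
      using down that by blast
    show ?thesis unfolding is_succ_def e1 using e2 by (metis (no_types, lifting))
  qed
  have bF: "b \<in> Field r" using b by (auto simp: underS_iff FieldI1)
  have bR: "b \<in> underS r l" by (rule b)
  show z: "is_zero (Restr r (underS r l)) b \<longleftrightarrow> is_zero r b"
  proof
    assume L: "is_zero (Restr r (underS r l)) b"
    have "(b, c) \<in> r" if "c \<in> Field r" for c
    proof (cases "c \<in> underS r l")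
      case True
      then show ?thesis using L by (simp add: is_zero_def Field_Restr_underS[OF wo])
    next
      case False
      then have "(c, b) \<notin> r" using down by blast
      then show ?thesis using wo_total[OF wo bF that] by blast
    qed
    then show "is_zero r b" using bF by (simp add: is_zero_def)
  next
    assume "is_zero r b"
    then show "is_zero (Restr r (underS r l)) b"
      using b by (auto simp: is_zero_def Field_Restr_underS[OF wo] underS_iff FieldI1)
  qed
  show "is_limit_elem (Restr r (underS r l)) b \<longleftrightarrow> is_limit_elem r b"
    using bF b by (simp add: is_limit_elem_def s z Field_Restr_underS[OF wo])
qed

text \<open>A sequence indexed by the whole universe is not itself admissible as a transfinite sequence,
  but its proper initial segments are.\<close>

lemma segment_transfinite_seq:
  fixes r :: "'u rel"
  assumes wo: "Well_order r" and sm: "small TYPE('u) (underS r l)"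
    and X: "is_functor (order_cat r) C X \<phi>" and cont: "continuous_at_limits C r X \<phi>"
  shows "transfinite_seq C (Restr r (underS r l)) X \<phi>"
  unfolding transfinite_seq_def
proof (intro conjI allI impI)
  let ?r = "Restr r (underS r l)"
  show "small_ordinal ?r" by (rule small_ordinal_Restr_underS[OF wo sm])
  show "is_functor (order_cat ?r) C X \<phi>"
    using X unfolding order_functor_iff Field_Restr_underS[OF wo] by (auto simp: underS_iff FieldI1)
  fix b assume b: "is_limit_elem ?r b"
  then have bl: "b \<in> underS r l" by (simp add: is_limit_elem_def Field_Restr_underS[OF wo])
  have "underS r b \<subseteq> underS r l"
    using bl underS_trans[OF wo, of _ b l] by (auto simp: underS_iff)
  then have "Restr ?r (underS ?r b) = Restr r (underS r b)"
    unfolding segment_stages(1)[OF wo bl] by auto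
  then show "is_colimit (order_cat (Restr ?r (underS ?r b))) C X \<phi> (X b) (\<lambda>a. \<phi> (a, b))"
    using cont b segment_stages(3)[OF wo bl] by (simp add: continuous_at_limits_def)
qed

text \<open>Every pair \<open>(a, n)\<close>, read as the problem number n of stage a, comes up at a time c when stage a
  has been reached: an encoding of triples lists it as often as there are elements in the
  universe, and only a small set of times lies before a.\<close>

lemma bookkeeping:
  assumes u: "universe TYPE('u)"
  obtains bk :: "'u \<Rightarrow> 'u \<times> 'u" where "\<And>a n. \<exists>c. bk c = (a, n) \<and> (a, c) \<in> univ_order"
proof -
  have inf: "infinite (UNIV :: 'u set)" by (rule universe_infinite[OF u])
  have "|(UNIV :: 'u set) \<times> (UNIV :: 'u set)| \<le>o |UNIV :: 'u set|"
    using card_of_Times_same_infinite[OF inf] by (rule ordIso_imp_ordLeq)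
  then obtain e0 :: "'u \<times> 'u \<Rightarrow> 'u" where e0: "inj e0"
    unfolding card_of_ordLeq[symmetric] by auto
  define e where "e = (\<lambda>(a, n, i). e0 (a, e0 (n, i)))"
  have e: "inj e"
    by (rule injI) (auto simp: e_def split: prod.splits dest!: injD[OF e0])
  define bk where "bk c = (let x = inv e c in (fst x, fst (snd x)))" for c
  have "\<exists>c. bk c = (a, n) \<and> (a, c) \<in> univ_order" for a n
  proof -
    let ?A = "range (\<lambda>i. e (a, n, i))"
    have "inj (\<lambda>i. e (a, n, i))" by (rule injI) (auto dest: injD[OF e])
    then have "|UNIV :: 'u set| \<le>o |?A|" by (metis card_of_ordLeq order_refl)
    then have "\<not> small TYPE('u) ?A" unfolding small_def using not_ordLess_ordLeq by blast
    then have "\<not> ?A \<subseteq> underS univ_order a"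
      using small_subset[OF small_underS_univ_order] by metis
    then obtain i where "e (a, n, i) \<notin> underS univ_order a" by blast
    then have "(a, e (a, n, i)) \<in> univ_order"
      using not_in_underS[OF univ_order_Well_order] by simp
    moreover have "bk (e (a, n, i)) = (a, n)" using e by (simp add: bk_def)
    ultimately show ?thesis by blast
  qed
  then show thesis using that by blast
qed

definition lifting_problems :: "('o, 'm) cat \<Rightarrow> 'm set \<Rightarrow> 'o \<Rightarrow> 'o \<Rightarrow> 'm \<Rightarrow> ('m \<times> 'm \<times> 'm) set" where
  "lifting_problems C K Z Y p = {(k, g, v). k \<in> K \<and> g \<in> hom C (Dom C k) Y \<and> v \<in> hom C (Cod C k) Z \<and>
     p \<cdot>\<^bsub>C\<^esub> g = v \<cdot>\<^bsub>C\<^esub> k}"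

lemma lifting_problems_small:
  assumes u: "universe TYPE('u)" and ls: "locally_small TYPE('u) C" and C: "category C"
    and K: "K \<subseteq> Arr C" "small TYPE('u) K" and Y: "Y \<in> Obj C" and Z: "Z \<in> Obj C"
  shows "small TYPE('u) (lifting_problems C K Z Y p)"
proof -
  have "small TYPE('u) (SIGMA k : K. hom C (Dom C k) Y \<times> hom C (Cod C k) Z)"
    using ls Y Z K category.Dom_Obj[OF C] category.Cod_Obj[OF C]
    by (intro small_Sigma[OF u]) (auto simp: locally_small_def)
  then show ?thesis by (rule small_subset) (auto simp: lifting_problems_def)
qed

lemma ex_enumeration:
  assumes "small TYPE('u) A" "A \<noteq> {}"
  shows "\<exists>h :: 'u \<Rightarrow> 'a. range h = A"
  using assms card_of_ordLeq2[OF assms(2), of "UNIV :: 'u set"] ordLess_imp_ordLeq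
  unfolding small_def by blast

text \<open>Cells are attached one at a time along the whole universe, the order in which problems are
  handled being fixed in advance by \<open>bookkeeping\<close>. Every problem of a stage is thus solved at some
  later stage. As each stage has only a small set of problems, there is a bound F for the time by which
  those of stage a are solved, and the construction is cut off at a limit stage l that is closed
  under F and sufficiently filtered. A problem at l then comes from an earlier stage, and its
  solution is already present before l. If there are no problems at the beginning, f itself has the lifting
  property and no cell is attached; otherwise there is a problem at every stage, so that no
  step is idle.\<close>

theorem (in category) small_object_argument:
  assumes u: "universe TYPE('u)" and ls: "locally_small TYPE('u) C" and co: "cocomplete TYPE('u) C"
    and K: "K \<subseteq> Arr C" "small TYPE('u) K"
    and fac: "\<And>k. k \<in> K \<Longrightarrow>
      \<exists>S. small TYPE('u) S \<and> factors_through_stages TYPE('u) C (pushouts C K) S (Dom C k)"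
    and f: "f \<in> hom C X Z"
  obtains Y t q where "t \<in> hom C X Y" "q \<in> hom C Y Z" "q \<cdot> t = f"
    "t \<in> cell_class TYPE('u) C K" "q \<in> inj_class C K"
proof (cases "lifting_problems C K Z X f = {}")
  case True
  then have "f \<in> inj_class C K"
    using f K by (auto simp: inj_class_def rlp_def lifting_problems_def homD)
  moreover have "Id C X \<in> hom C X X" using f hom_Obj Id_hom by blast
  ultimately show thesis
    using that[of "Id C X" X f] f Comp_Id[OF f] mem_transfinite_compositions[OF u]
    unfolding cell_class_def by blast
next
  case ne: False
  obtain S :: "'u set" where S: "small TYPE('u) S"
    and fac: "\<And>k. k \<in> K \<Longrightarrow> factors_through_stages TYPE('u) C (pushouts C K) S (Dom C k)"
    using uniform_factors[OF u K(2), of C "pushouts C K" "Dom C"] fac by metis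
  let ?R = "univ_order :: 'u rel"
  note wo = univ_order_Well_order[where 'u='u]
  obtain z where z: "is_zero ?R z" using is_zero_exists[OF wo] by auto
  obtain bk :: "'u \<Rightarrow> 'u \<times> 'u" where bk: "\<And>a n. \<exists>c. bk c = (a, n) \<and> (a, c) \<in> ?R"
    using bookkeeping[OF u] by blast
  have ZO: "Z \<in> Obj C" using f hom_Obj by blast
  have "\<exists>h :: 'u \<Rightarrow> _. Y \<in> Obj C \<longrightarrow> lifting_problems C K Z Y p \<noteq> {} \<longrightarrow> range h = lifting_problems C K Z Y p" for Y p
    using ex_enumeration lifting_problems_small[OF u ls category_axioms K _ ZO] by metis
  then obtain h :: "'o \<Rightarrow> 'm \<Rightarrow> 'u \<Rightarrow> 'm \<times> 'm \<times> 'm" where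
    h: "\<And>Y p. Y \<in> Obj C \<Longrightarrow> lifting_problems C K Z Y p \<noteq> {} \<Longrightarrow> range (h Y p) = lifting_problems C K Z Y p"
    by metis
  \<comment> \<open>a request concerning a stage that has not been reached is answered at the current one\<close>
  define st where "st a = (if (fst (bk a), a) \<in> ?R then fst (bk a) else a)" for a
  define Q where "Q a b Y \<psi> p y e q \<longleftrightarrow> e \<in> pushouts C K \<and>
      (case h (Y (st a)) (p (st a)) (snd (bk a)) of (k, g, v) \<Rightarrow>
        \<exists>w \<in> hom C (Cod C k) y. w \<cdot> k = e \<cdot> (\<psi> (st a, a) \<cdot> g) \<and> q \<cdot> w = v)"
    for a b :: 'u and Y :: "'u \<Rightarrow> 'o" and \<psi> :: "'u \<times> 'u \<Rightarrow> 'm" and p :: "'u \<Rightarrow> 'm" and y e q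
  have stR: "(st a, a) \<in> ?R" for a using wo_refl[OF wo] by (simp add: st_def)
  \<comment> \<open>a problem at the beginning persists, which keeps the enumerations h meaningful\<close>
  have sq: "lifting_problems C K Z (Y a) (p a) \<noteq> {}"
    if tow: "tower_over C r (\<lambda>_. Z) (\<lambda>_. Id C Z) Y \<psi> p" and 0: "Y z = X" "p z = f" "(z, a) \<in> r"
    for r Y \<psi> p a
  proof -
    obtain k g v where kg: "k \<in> K" "g \<in> hom C (Dom C k) X" "v \<in> hom C (Cod C k) Z" "f \<cdot> g = v \<cdot> k"
      using ne by (auto simp: lifting_problems_def)
    have \<psi>: "\<psi> (z, a) \<in> hom C X (Y a)" and p: "p a \<in> hom C (Y a) Z" "p a \<cdot> \<psi> (z, a) = f"
      using tow 0 f Id_Comp[OF f] unfolding tower_over_def order_functor_iff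
      by (metis FieldI2)+
    have "p a \<cdot> (\<psi> (z, a) \<cdot> g) = v \<cdot> k" using assoc[OF kg(2) \<psi> p(1)] p(2) kg(4) by simp
    then have "(k, \<psi> (z, a) \<cdot> g, v) \<in> lifting_problems C K Z (Y a) (p a)"
      using kg Comp_hom[OF kg(2) \<psi>] by (simp add: lifting_problems_def)
    then show ?thesis by blast
  qed
  obtain Y \<psi> p where tow: "tower_over C ?R (\<lambda>_. Z) (\<lambda>_. Id C Z) Y \<psi> p"
    and cont: "continuous_at_limits C ?R Y \<psi>" and Yz: "Y z = X" "p z = f"
    and Q: "\<And>a b. is_succ ?R a b \<Longrightarrow> Q a b Y \<psi> p (Y b) (\<psi> (a, b)) (p b)"
  proof (rule transfinite_tower[OF u co wo small_underS_univ_order constant_functor[OF ZO] z f,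
        of Q])
    fix a b Y \<psi> p Y' \<psi>' p' y e q
    assume ab: "is_succ ?R a b" and "\<And>c. c \<in> underS ?R b \<Longrightarrow> Y c = Y' c \<and> p c = p' c"
      "\<And>c d. (c, d) \<in> ?R \<Longrightarrow> d \<in> underS ?R b \<Longrightarrow> \<psi> (c, d) = \<psi>' (c, d)" "Q a b Y \<psi> p y e q"
    moreover have "a \<in> underS ?R b" using ab by (simp add: is_succ_def underS_iff)
    moreover from this have "st a \<in> underS ?R b"
      using stR[of a] wo_trans[OF wo] wo_antisym[OF wo] unfolding underS_iff by metis
    ultimately show "Q a b Y' \<psi>' p' y e q" using stR[of a] by (simp add: Q_def)
  next
    fix a b Y \<psi> p
    assume ab: "is_succ ?R a b"
      and tow: "tower_over C (Restr ?R (underS ?R b)) (\<lambda>_. Z) (\<lambda>_. Id C Z) Y \<psi> p"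
      and 0: "Y z = X" "p z = f"
    have aS: "a \<in> underS ?R b" using ab by (simp add: is_succ_def underS_iff)
    then have sS: "st a \<in> underS ?R b"
      using stR[of a] wo_trans[OF wo] wo_antisym[OF wo] unfolding underS_iff by metis
    have zs: "(z, st a) \<in> ?R" using z by (simp add: is_zero_def)
    then have zS: "z \<in> underS ?R b"
      using sS wo_trans[OF wo] wo_antisym[OF wo] unfolding underS_iff by metis
    note tw = tow[unfolded tower_over_def order_functor_iff Field_Restr_underS[OF wo]]
    have YO: "Y (st a) \<in> Obj C" "Y a \<in> Obj C" using tw sS aS by auto
    have \<psi>: "\<psi> (st a, a) \<in> hom C (Y (st a)) (Y a)" and pa: "p a \<in> hom C (Y a) Z"
      and ps: "p (st a) \<in> hom C (Y (st a)) Z" and pn: "p a \<cdot> \<psi> (st a, a) = Id C Z \<cdot> p (st a)"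
      using tw sS aS stR[of a] by auto
    have "lifting_problems C K Z (Y (st a)) (p (st a)) \<noteq> {}"
      by (rule sq[OF tow 0]) (use zs zS sS in auto)
    then have "h (Y (st a)) (p (st a)) (snd (bk a)) \<in> lifting_problems C K Z (Y (st a)) (p (st a))"
      using h[OF YO(1)] by blast
    then obtain k g v where hk: "h (Y (st a)) (p (st a)) (snd (bk a)) = (k, g, v)" and k: "k \<in> K"
      and g: "g \<in> hom C (Dom C k) (Y (st a))" and v: "v \<in> hom C (Cod C k) Z"
      and eq: "p (st a) \<cdot> g = v \<cdot> k"
      unfolding lifting_problems_def by auto
    have kh: "k \<in> hom C (Dom C k) (Cod C k)" using Arr_hom[OF subsetD[OF K(1) k]] .
    have gh: "\<psi> (st a, a) \<cdot> g \<in> hom C (Dom C k) (Y a)" by (rule Comp_hom[OF g \<psi>])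
    obtain y w e where P: "is_pushout C k (\<psi> (st a, a) \<cdot> g) y w e"
      using pushout_exists[OF u co kh gh] by blast
    note Pd = pushoutD[OF P kh gh]
    have "v \<cdot> k = p a \<cdot> (\<psi> (st a, a) \<cdot> g)"
      using eq pn Id_Comp[OF ps] assoc[OF g \<psi> pa] by simp
    then obtain q where q: "q \<in> hom C y Z" "q \<cdot> w = v" "q \<cdot> e = p a"
      using Pd(5)[OF v pa ZO] by blast
    have "e \<in> pushouts C K" using P k by (auto simp: pushouts_def)
    then have "Q a b Y \<psi> p y e q"
      using hk Pd(2,4) q(2) by (auto simp: Q_def intro!: bexI[of _ w])
    then show "\<exists>y e q. e \<in> hom C (Y a) y \<and> q \<in> hom C y Z \<and> q \<cdot> e = Id C Z \<cdot> p a \<and> Q a b Y \<psi> p y e q"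
      using Pd(3) q Id_Comp[OF pa] by auto
  qed (rule that)
  have func: "is_functor (order_cat ?R) C Y \<psi>" and ph: "p a \<in> hom C (Y a) Z" for a
    using tow by (simp_all add: tower_over_def)
  have pn: "p b \<cdot> \<psi> (a, b) = p a" if "(a, b) \<in> ?R" for a b
    using tow that Id_Comp[OF ph] by (simp add: tower_over_def)
  note Yd = order_functorD[OF func]
  have z0: "(z, a) \<in> ?R" for a using z by (simp add: is_zero_def)
  define solved where "solved a b x \<longleftrightarrow> (case x of (k, g, v) \<Rightarrow>
      \<exists>w \<in> hom C (Cod C k) (Y b). w \<cdot> k = \<psi> (a, b) \<cdot> g \<and> p b \<cdot> w = v)" for a b x
  have ev: "\<exists>b. (a, b) \<in> ?R \<and> solved a b x" if x: "x \<in> lifting_problems C K Z (Y a) (p a)" for a x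
  proof -
    have YO: "Y a \<in> Obj C" using Yd(1) by simp
    obtain n where n: "x = h (Y a) (p a) n" using h[OF YO] x by blast
    obtain c where c: "bk c = (a, n)" "(a, c) \<in> ?R" using bk by blast
    obtain d where "(c, d) \<in> ?R" "c \<noteq> d"
      using infinite_Card_order_limit[OF card_of_Card_order, of "UNIV :: 'u set" c]
        universe_infinite[OF u] by auto
    then obtain b where b: "is_succ ?R c b" using is_succ_exists[OF wo] by blast
    then have cb: "(c, b) \<in> ?R" by (simp add: is_succ_def)
    have "st c = a" using c by (simp add: st_def)
    obtain k g v where xk: "x = (k, g, v)" by (cases x)
    have g: "g \<in> hom C (Dom C k) (Y a)" using x xk by (simp add: lifting_problems_def)
    obtain w where "w \<in> hom C (Cod C k) (Y b)" "w \<cdot> k = \<psi> (c, b) \<cdot> (\<psi> (a, c) \<cdot> g)" "p b \<cdot> w = v"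
      using Q[OF b] n c xk \<open>st c = a\<close> by (auto simp: Q_def)
    then have "solved a b x"
      using assoc[OF g Yd(3)[OF c(2)] Yd(3)[OF cb]] Yd(4)[OF c(2) cb] xk by (auto simp: solved_def)
    then show ?thesis using wo_trans[OF wo c(2) cb] by blast
  qed
  have "\<exists>F. \<forall>x\<in>lifting_problems C K Z (Y a) (p a). \<exists>b\<in>underS ?R F. (a, b) \<in> ?R \<and> solved a b x" for a
  proof -
    obtain B where B: "\<And>x. x \<in> lifting_problems C K Z (Y a) (p a) \<Longrightarrow> (a, B x) \<in> ?R \<and> solved a (B x) x"
      using bchoice[of "lifting_problems C K Z (Y a) (p a)" "\<lambda>x b. (a, b) \<in> ?R \<and> solved a b x"] ev by blast
    have "small TYPE('u) (B ` lifting_problems C K Z (Y a) (p a))"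
      by (rule small_image[OF lifting_problems_small[OF u ls category_axioms K _ ZO]]) (simp add: Yd(1))
    then obtain F where "B ` lifting_problems C K Z (Y a) (p a) \<subseteq> underS ?R F"
      using small_bounded[OF u] by blast
    then show ?thesis using B by (intro exI[of _ F]) blast
  qed
  then obtain F where F: "\<And>a x. x \<in> lifting_problems C K Z (Y a) (p a) \<Longrightarrow>
      \<exists>b\<in>underS ?R (F a). (a, b) \<in> ?R \<and> solved a b x"
    by metis
  obtain l where l: "filtered_ordinal S (Restr ?R (underS ?R l))" "is_limit_elem ?R l"
    "\<And>a. a \<in> underS ?R l \<Longrightarrow> F a \<in> underS ?R l"
    using closed_filtered_segment[OF u S, of F] by blast
  let ?r = "Restr ?R (underS ?R l)"
  have seq: "transfinite_seq C ?r Y \<psi>"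
    by (rule segment_transfinite_seq[OF wo small_underS_univ_order func cont])
  have colim: "is_colimit (order_cat ?r) C Y \<psi> (Y l) (\<lambda>a. \<psi> (a, l))"
    using cont l(2) by (simp add: continuous_at_limits_def)
  have steps: "steps_in ?r \<psi> (pushouts C K)"
    unfolding steps_in_def
  proof (intro allI impI)
    fix a b assume ab: "is_succ ?r a b"
    then have "b \<in> underS ?R l" by (simp add: is_succ_def)
    with ab have "is_succ ?R a b" using segment_stages(2)[OF wo] by blast
    then show "\<psi> (a, b) \<in> pushouts C K" using Q by (simp add: Q_def)
  qed
  have zl: "z \<in> underS ?R l"
    using z l(2) z0 by (auto simp: underS_iff is_limit_elem_def)
  then have "is_zero ?r z" using segment_stages(4)[OF wo] z by blast
  then have "\<psi> (z, l) \<in> cell_class TYPE('u) C K"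
    unfolding cell_class_def transfinite_compositions_def using seq steps colim by blast
  moreover have "p l \<in> inj_class C K"
    unfolding inj_class_def
  proof (intro CollectI conjI ballI)
    show "p l \<in> Arr C" using ph by (rule homD)
    fix k assume k: "k \<in> K"
    have kh: "k \<in> hom C (Dom C k) (Cod C k)" using Arr_hom[OF subsetD[OF K(1) k]] .
    show "rlp C k (p l)"
    proof (rule rlpI[OF kh ph])
      fix g' v assume g': "g' \<in> hom C (Dom C k) (Y l)" and v: "v \<in> hom C (Cod C k) Z"
        and eq: "p l \<cdot> g' = v \<cdot> k"
      obtain a g where a: "a \<in> Field ?r" and g: "g \<in> hom C (Dom C k) (Y a)" and gg: "\<psi> (a, l) \<cdot> g = g'"
        using fac[OF k] l(1) seq steps colim g' unfolding factors_through_stages_def by blast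
      have al: "a \<in> underS ?R l" "(a, l) \<in> ?R"
        using a unfolding Field_Restr_underS[OF wo] by (auto simp: underS_iff)
      have "p a \<cdot> g = v \<cdot> k" using assoc[OF g Yd(3)[OF al(2)] ph] pn[OF al(2)] gg eq by simp
      then have "(k, g, v) \<in> lifting_problems C K Z (Y a) (p a)" using k g v by (simp add: lifting_problems_def)
      then obtain b where b: "b \<in> underS ?R (F a)" "(a, b) \<in> ?R" "solved a b (k, g, v)"
        using F by blast
      then have bl: "(b, l) \<in> ?R" using l(3)[OF al(1)] underS_trans[OF wo b(1)] by (simp add: underS_iff)
      obtain w where w: "w \<in> hom C (Cod C k) (Y b)" "w \<cdot> k = \<psi> (a, b) \<cdot> g" "p b \<cdot> w = v"
        using b(3) by (auto simp: solved_def)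
      have "(\<psi> (b, l) \<cdot> w) \<cdot> k = g'"
        using assoc[OF kh w(1) Yd(3)[OF bl]] w(2) assoc[OF g Yd(3)[OF b(2)] Yd(3)[OF bl]]
          Yd(4)[OF b(2) bl] gg by simp
      moreover have "p l \<cdot> (\<psi> (b, l) \<cdot> w) = v"
        using assoc[OF w(1) Yd(3)[OF bl] ph] pn[OF bl] w(3) by simp
      ultimately show "\<exists>k'\<in>hom C (Cod C k) (Y l). k' \<cdot> k = g' \<and> p l \<cdot> k' = v"
        using Comp_hom[OF w(1) Yd(3)[OF bl]] by blast
    qed
  qed
  moreover have "\<psi> (z, l) \<in> hom C X (Y l)" using Yd(3)[OF z0] Yz by simp
  moreover have "p l \<cdot> \<psi> (z, l) = f" using pn[OF z0] Yz by simp
  ultimately show thesis using that ph by blast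
qed


section \<open>Smallness relative to cofibrations\<close>

lemma (in category) pushouts_subset_cell:
  assumes u: "universe TYPE('u)"
  shows "pushouts C K \<subseteq> cell_class TYPE('u) C K"
proof
  fix f assume f: "f \<in> pushouts C K"
  then have "f \<in> Arr C" unfolding pushouts_def is_pushout_def hom_def by blast
  from mem_transfinite_compositions[OF u Arr_hom[OF this]] f
  show "f \<in> cell_class TYPE('u) C K" unfolding cell_class_def by blast
qed

lemma (in category) small_relative_factorization:
  assumes u: "universe TYPE('u)" and ls: "locally_small TYPE('u) C" and co: "cocomplete TYPE('u) C"
    and K: "K \<subseteq> Arr C" "small TYPE('u) K"
    and sm: "\<And>k. k \<in> K \<Longrightarrow> small_relative TYPE('u) C (cell_class TYPE('u) C K) (Dom C k)"
    and f: "f \<in> hom C X Z"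
  obtains Y t q where "t \<in> hom C X Y" "q \<in> hom C Y Z" "q \<cdot> t = f"
    "t \<in> cell_class TYPE('u) C K" "q \<in> inj_class C K"
proof (rule small_object_argument[OF u ls co K _ f])
  show "\<exists>S. small TYPE('u) S \<and> factors_through_stages TYPE('u) C (pushouts C K) S (Dom C k)"
    if k: "k \<in> K" for k
  proof -
    obtain S where "small TYPE('u) S" "factors_through_stages TYPE('u) C (cell_class TYPE('u) C K) S (Dom C k)"
      using small_relative_factors[OF sm[OF k]] by blast
    then show ?thesis
      using factors_through_stages_mono[OF _ pushouts_subset_cell[OF u] order_refl] by metis
  qed
qed (rule that)

text \<open>A sequence X of K-cofibrations is a retract of a sequence Y of K-cell maps: Y is a tower over X
  in which each step factors \<open>Y a \<rightarrow> X a \<rightarrow> X b\<close> as a cell map followed by a map in K-inj, and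
  the cofibrations lift against the latter to give a section. A map from A to the colimit of X then
  factors through a stage of Y, hence through the stage of X below it.\<close>

lemma (in category) factors_through_cofibrant_stages:
  assumes u: "universe TYPE('u)" and ls: "locally_small TYPE('u) C" and co: "cocomplete TYPE('u) C"
    and K: "K \<subseteq> Arr C" "small TYPE('u) K"
    and sm: "\<And>k. k \<in> K \<Longrightarrow> small_relative TYPE('u) C (cell_class TYPE('u) C K) (Dom C k)"
    and A: "factors_through_stages TYPE('u) C (cell_class TYPE('u) C K) S A"
  shows "factors_through_stages TYPE('u) C (cof_class C K) S A"
  unfolding factors_through_stages_def
proof (intro allI impI ballI, elim conjE)
  fix r :: "'u rel" and X \<phi> L \<kappa> v
  assume fo: "filtered_ordinal S r" and seq: "transfinite_seq C r X \<phi>"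
    and st: "steps_in r \<phi> (cof_class C K)" and L: "is_colimit (order_cat r) C X \<phi> L \<kappa>"
    and v: "v \<in> hom C A L"
  note Xs = transfinite_seqD[OF seq] and Ld = order_colimitD[OF L]
  note wo = Xs(1) and Xd = order_functorD[OF Xs(3)]
  have smS: "small TYPE('u) (underS r b)" for b
    by (rule small_subset[OF Xs(2)]) (auto simp: underS_iff FieldI1)
  obtain z where z: "is_zero r z" using is_zero_exists[OF wo] fo by (auto simp: filtered_ordinal_def)
  have zF: "z \<in> Field r" using z by (simp add: is_zero_def)
  obtain Y \<psi> p where tow: "tower_over C r X \<phi> Y \<psi> p" and cont: "continuous_at_limits C r Y \<psi>"
    and Yz: "Y z = X z" "p z = Id C (X z)"
    and Q: "\<And>a b. is_succ r a b \<Longrightarrow> \<psi> (a, b) \<in> cell_class TYPE('u) C K \<and> p b \<in> inj_class C K"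
  proof (rule transfinite_tower[OF u co wo smS Xs(3) z Id_hom[OF Xd(1)[OF zF]],
        of "\<lambda>a b Y \<psi> p y e q. e \<in> cell_class TYPE('u) C K \<and> q \<in> inj_class C K"])
    fix a b Y \<psi> p
    assume ab: "is_succ r a b" and tow: "tower_over C (Restr r (underS r b)) X \<phi> Y \<psi> p"
    have abr: "(a, b) \<in> r" "a \<in> underS r b" using ab by (auto simp: is_succ_def underS_iff)
    have pa: "p a \<in> hom C (Y a) (X a)"
      using tow abr(2) by (simp add: tower_over_def Field_Restr_underS[OF wo])
    from small_relative_factorization[OF u ls co K sm Comp_hom[OF pa Xd(3)[OF abr(1)]]]
    show "\<exists>y e q. e \<in> hom C (Y a) y \<and> q \<in> hom C y (X b) \<and> q \<cdot> e = \<phi> (a, b) \<cdot> p a \<and>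
        e \<in> cell_class TYPE('u) C K \<and> q \<in> inj_class C K" by metis
  qed (auto intro: that)
  have func: "is_functor (order_cat r) C Y \<psi>" and ph: "a \<in> Field r \<Longrightarrow> p a \<in> hom C (Y a) (X a)"
    and pn: "(a, b) \<in> r \<Longrightarrow> p b \<cdot> \<psi> (a, b) = \<phi> (a, b) \<cdot> p a" for a b
    using tow by (simp_all add: tower_over_def)
  note Yd = order_functorD[OF func]
  obtain i where i: "\<And>a. a \<in> Field r \<Longrightarrow> i a \<in> hom C (X a) (Y a)"
      "\<And>a. a \<in> Field r \<Longrightarrow> p a \<cdot> i a = Id C (X a)"
      "\<And>a b. (a, b) \<in> r \<Longrightarrow> i b \<cdot> \<phi> (a, b) = \<psi> (a, b) \<cdot> i a"
  proof (rule transfinite_lift[OF wo Xs(3,4) func Xs(3) ph pn, of "\<lambda>a. Id C (X a)" z "Id C (X z)"])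
    fix a b k assume ab: "is_succ r a b" and k: "k \<in> hom C (X a) (Y a)" "p a \<cdot> k = Id C (X a)"
    have abr: "(a, b) \<in> r" using ab by (simp add: is_succ_def)
    note F = FieldI1[OF abr] FieldI2[OF abr]
    have "p b \<cdot> (\<psi> (a, b) \<cdot> k) = Id C (X b) \<cdot> \<phi> (a, b)"
      using assoc[OF k(1) Yd(3)[OF abr] ph[OF F(2)]] assoc[OF k(1) ph[OF F(1)] Xd(3)[OF abr]]
        pn[OF abr] k(2) Comp_Id[OF Xd(3)[OF abr]] Id_Comp[OF Xd(3)[OF abr]] by simp
    moreover have "rlp C (\<phi> (a, b)) (p b)"
      using st ab Q[OF ab] by (auto simp: steps_in_def cof_class_def)
    ultimately show "\<exists>l\<in>hom C (X b) (Y b). l \<cdot> \<phi> (a, b) = \<psi> (a, b) \<cdot> k \<and> p b \<cdot> l = Id C (X b)"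
      using rlpE[OF _ Xd(3)[OF abr] ph[OF F(2)] Comp_hom[OF k(1) Yd(3)[OF abr]] Id_hom[OF Xd(1)[OF F(2)]]]
      by metis
  next
    show "Id C (X b) \<cdot> \<phi> (a, b) = \<phi> (a, b) \<cdot> Id C (X a)" if "(a, b) \<in> r" for a b
      using Id_Comp[OF Xd(3)[OF that]] Comp_Id[OF Xd(3)[OF that]] by simp
    show "p z \<cdot> Id C (X z) = Id C (X z)"
      using Comp_Id[OF Id_hom[OF Xd(1)[OF zF]]] Yz by simp
  qed (use z zF Yz Id_hom Xd in \<open>auto simp: FieldI1 FieldI2\<close>)
  have "small_category TYPE('u) (order_cat r)" by (rule order_cat_small[OF u wo Xs(2)])
  then obtain M \<mu> where M: "is_colimit (order_cat r) C Y \<psi> M \<mu>"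
    using small_colimit_exists[OF co _ func] by blast
  note Md = order_colimitD[OF M]
  have "(\<kappa> b \<cdot> p b) \<cdot> \<psi> (a, b) = \<kappa> a \<cdot> p a" if "(a, b) \<in> r" for a b
    using assoc[OF Yd(3)[OF that] ph Ld(2)] assoc[OF ph Xd(3)[OF that] Ld(2)] pn[OF that]
      Ld(3)[OF that] that by (simp add: FieldI1 FieldI2)
  then obtain P where P: "P \<in> hom C M L" "\<And>a. a \<in> Field r \<Longrightarrow> P \<cdot> \<mu> a = \<kappa> a \<cdot> p a"
    using order_colimit_induce[OF M Ld(1), of "\<lambda>a. \<kappa> a \<cdot> p a"] Comp_hom[OF ph Ld(2)] by metis
  have "(\<mu> b \<cdot> i b) \<cdot> \<phi> (a, b) = \<mu> a \<cdot> i a" if "(a, b) \<in> r" for a b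
    using assoc[OF Xd(3)[OF that] i(1) Md(2)] assoc[OF i(1) Yd(3)[OF that] Md(2)] i(3)[OF that]
      Md(3)[OF that] that by (simp add: FieldI1 FieldI2)
  then obtain J where J: "J \<in> hom C L M" "\<And>a. a \<in> Field r \<Longrightarrow> J \<cdot> \<kappa> a = \<mu> a \<cdot> i a"
    using order_colimit_induce[OF L Md(1), of "\<lambda>a. \<mu> a \<cdot> i a"] Comp_hom[OF i(1) Md(2)] by metis
  have "P \<cdot> J = Id C L"
  proof (rule order_colimit_unique[OF L Xd(3) Comp_hom[OF J(1) P(1)] Id_hom[OF Ld(1)]])
    fix a assume a: "a \<in> Field r"
    have "(P \<cdot> J) \<cdot> \<kappa> a = (P \<cdot> \<mu> a) \<cdot> i a"
      using assoc[OF Ld(2)[OF a] J(1) P(1)] J(2)[OF a] assoc[OF i(1)[OF a] Md(2)[OF a] P(1)] by simp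
    also have "\<dots> = \<kappa> a"
      using P(2)[OF a] assoc[OF i(1)[OF a] ph[OF a] Ld(2)[OF a]] i(2)[OF a] Comp_Id[OF Ld(2)[OF a]] by simp
    finally show "(P \<cdot> J) \<cdot> \<kappa> a = Id C L \<cdot> \<kappa> a" using Id_Comp[OF Ld(2)[OF a]] by simp
  qed
  moreover have "transfinite_seq C r Y \<psi>"
    using func cont wo Xs(2) by (simp add: transfinite_seq_def small_ordinal_def continuous_at_limits_def)
  moreover have "steps_in r \<psi> (cell_class TYPE('u) C K)" using Q by (simp add: steps_in_def)
  ultimately obtain a g where a: "a \<in> Field r" and g: "g \<in> hom C A (Y a)" and gJ: "\<mu> a \<cdot> g = J \<cdot> v"
    using A fo M Comp_hom[OF v J(1)] unfolding factors_through_stages_def by blast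
  have "\<kappa> a \<cdot> (p a \<cdot> g) = P \<cdot> (\<mu> a \<cdot> g)"
    using assoc[OF g ph[OF a] Ld(2)[OF a]] assoc[OF g Md(2)[OF a] P(1)] P(2)[OF a] by simp
  also have "\<dots> = v"
    unfolding gJ using assoc[OF v J(1) P(1)] \<open>P \<cdot> J = Id C L\<close> Id_Comp[OF v] by simp
  finally show "\<exists>a\<in>Field r. \<exists>g\<in>hom C A (X a). \<kappa> a \<cdot> g = v"
    using a Comp_hom[OF g ph[OF a]] by blast
qed


section \<open>Cylinders and path objects\<close>

text \<open>A homotopy lifts relative to prescribed lifts of both ends, provided that these agree on U: they
  glue to a map on the pushout, whose map to the cylinder lies in D.\<close>

lemma (in category) copairing_lift:
  assumes u: "universe TYPE('u)" and co: "cocomplete TYPE('u) C"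
    and cyl: "rel_cylinder C i K \<iota>\<^sub>0 \<iota>\<^sub>1" and D: "copairing_in C D i K \<iota>\<^sub>0 \<iota>\<^sub>1"
    and p: "p \<in> hom C E F" "\<And>d. d \<in> D \<Longrightarrow> rlp C d p"
    and x: "x \<in> hom C (Cod C i) E" and y: "y \<in> hom C (Cod C i) E" and xy: "x \<cdot> i = y \<cdot> i"
    and H: "H \<in> hom C K F" "p \<cdot> x = H \<cdot> \<iota>\<^sub>0" "p \<cdot> y = H \<cdot> \<iota>\<^sub>1"
  shows "\<exists>G \<in> hom C K E. G \<cdot> \<iota>\<^sub>0 = x \<and> G \<cdot> \<iota>\<^sub>1 = y \<and> p \<cdot> G = H"
proof -
  have ih: "i \<in> hom C (Dom C i) (Cod C i)" and KO: "K \<in> Obj C"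
    and c0: "\<iota>\<^sub>0 \<in> hom C (Cod C i) K" and c1: "\<iota>\<^sub>1 \<in> hom C (Cod C i) K" and c: "\<iota>\<^sub>0 \<cdot> i = \<iota>\<^sub>1 \<cdot> i"
    using cyl Arr_hom by (auto simp: rel_cylinder_def)
  obtain Q j\<^sub>0 j\<^sub>1 where Q: "is_pushout C i i Q j\<^sub>0 j\<^sub>1" using pushout_exists[OF u co ih ih] by blast
  note Qd = pushoutD[OF Q ih ih]
  obtain h where h: "h \<in> hom C Q K" "h \<cdot> j\<^sub>0 = \<iota>\<^sub>0" "h \<cdot> j\<^sub>1 = \<iota>\<^sub>1" using Qd(5)[OF c0 c1 KO c] by blast
  then have hp: "rlp C h p" using D Q p(2) by (auto simp: copairing_in_def)
  obtain w where w: "w \<in> hom C Q E" "w \<cdot> j\<^sub>0 = x" "w \<cdot> j\<^sub>1 = y"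
    using Qd(5)[OF x y hom_Obj(2)[OF x] xy] by blast
  have "p \<cdot> w = H \<cdot> h"
    by (rule pushout_unique[OF Q ih ih Comp_hom[OF w(1) p(1)] Comp_hom[OF h(1) H(1)]])
      (use assoc[OF Qd(2) w(1) p(1)] assoc[OF Qd(3) w(1) p(1)] assoc[OF Qd(2) h(1) H(1)]
        assoc[OF Qd(3) h(1) H(1)] w h H in simp_all)
  then obtain G where G: "G \<in> hom C K E" "G \<cdot> h = w" "p \<cdot> G = H"
    using rlpE[OF hp h(1) p(1) w(1) H(1)] by blast
  have "G \<cdot> \<iota>\<^sub>0 = x" "G \<cdot> \<iota>\<^sub>1 = y"
    using assoc[OF Qd(2) h(1) G(1)] assoc[OF Qd(3) h(1) G(1)] G w h by auto
  then show ?thesis using G by blast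
qed

lemma productD:
  assumes "is_product C X Y Q q\<^sub>0 q\<^sub>1"
  shows "Q \<in> Obj C" "q\<^sub>0 \<in> hom C Q X" "q\<^sub>1 \<in> hom C Q Y"
    and "\<And>T a b. T \<in> Obj C \<Longrightarrow> a \<in> hom C T X \<Longrightarrow> b \<in> hom C T Y \<Longrightarrow>
      \<exists>!h. h \<in> hom C T Q \<and> q\<^sub>0 \<cdot>\<^bsub>C\<^esub> h = a \<and> q\<^sub>1 \<cdot>\<^bsub>C\<^esub> h = b"
  using assms unfolding is_product_def by auto

text \<open>Lifting against a map into a product amounts to lifting both coordinates at once, so it does not
  depend on the choice of the product.\<close>

lemma (in category) pairing_lift_iff:
  assumes Q: "is_product C X Y Q q\<^sub>0 q\<^sub>1" and h: "h \<in> hom C P Q" and j: "j \<in> hom C A B"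
  shows "rlp C j h \<longleftrightarrow> (\<forall>u \<in> hom C A P. \<forall>a \<in> hom C B X. \<forall>b \<in> hom C B Y.
    (q\<^sub>0 \<cdot> h) \<cdot> u = a \<cdot> j \<and> (q\<^sub>1 \<cdot> h) \<cdot> u = b \<cdot> j \<longrightarrow>
    (\<exists>k \<in> hom C B P. k \<cdot> j = u \<and> (q\<^sub>0 \<cdot> h) \<cdot> k = a \<and> (q\<^sub>1 \<cdot> h) \<cdot> k = b))"
    (is "?L \<longleftrightarrow> ?R")
proof -
  note Qd = productD[OF Q]
  have uniq: "f = g" if "f \<in> hom C T Q" "g \<in> hom C T Q" "q\<^sub>0 \<cdot> f = q\<^sub>0 \<cdot> g" "q\<^sub>1 \<cdot> f = q\<^sub>1 \<cdot> g" for f g T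
    using Qd(4)[OF hom_Obj(1)[OF that(1)] Comp_hom[OF that(1) Qd(2)] Comp_hom[OF that(1) Qd(3)]] that
    by metis
  show ?thesis
  proof
    assume L: ?L
    show ?R
    proof (intro ballI impI, elim conjE)
      fix u a b assume u: "u \<in> hom C A P" and a: "a \<in> hom C B X" and b: "b \<in> hom C B Y"
        and eq: "(q\<^sub>0 \<cdot> h) \<cdot> u = a \<cdot> j" "(q\<^sub>1 \<cdot> h) \<cdot> u = b \<cdot> j"
      obtain v where v: "v \<in> hom C B Q" "q\<^sub>0 \<cdot> v = a" "q\<^sub>1 \<cdot> v = b"
        using Qd(4)[OF hom_Obj(1)[OF a] a b] by blast
      have "h \<cdot> u = v \<cdot> j"
        by (rule uniq[OF Comp_hom[OF u h] Comp_hom[OF j v(1)]])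
          (use eq v assoc[OF u h Qd(2)] assoc[OF u h Qd(3)] assoc[OF j v(1) Qd(2)] assoc[OF j v(1) Qd(3)]
           in simp_all)
      then obtain k where "k \<in> hom C B P" "k \<cdot> j = u" "h \<cdot> k = v"
        using rlpE[OF L j h u v(1)] by blast
      then show "\<exists>k\<in>hom C B P. k \<cdot> j = u \<and> q\<^sub>0 \<cdot> h \<cdot> k = a \<and> q\<^sub>1 \<cdot> h \<cdot> k = b"
        using v assoc[OF _ h Qd(2)] assoc[OF _ h Qd(3)] by (intro bexI[of _ k]) auto
    qed
  next
    assume R: ?R
    show ?L
    proof (rule rlpI[OF j h])
      fix u v assume u: "u \<in> hom C A P" and v: "v \<in> hom C B Q" and eq: "h \<cdot> u = v \<cdot> j"
      have "(q\<^sub>0 \<cdot> h) \<cdot> u = (q\<^sub>0 \<cdot> v) \<cdot> j" "(q\<^sub>1 \<cdot> h) \<cdot> u = (q\<^sub>1 \<cdot> v) \<cdot> j"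
        using eq assoc[OF u h Qd(2)] assoc[OF u h Qd(3)] assoc[OF j v Qd(2)] assoc[OF j v Qd(3)] by simp_all
      then obtain k where k: "k \<in> hom C B P" "k \<cdot> j = u" "(q\<^sub>0 \<cdot> h) \<cdot> k = q\<^sub>0 \<cdot> v" "(q\<^sub>1 \<cdot> h) \<cdot> k = q\<^sub>1 \<cdot> v"
        using R u Comp_hom[OF v Qd(2)] Comp_hom[OF v Qd(3)] by blast
      have "h \<cdot> k = v"
        by (rule uniq[OF Comp_hom[OF k(1) h] v])
          (use k assoc[OF k(1) h Qd(2)] assoc[OF k(1) h Qd(3)] in simp_all)
      then show "\<exists>k\<in>hom C B P. k \<cdot> j = u \<and> h \<cdot> k = v" using k by blast
    qed
  qed
qed

text \<open>The hypothesis that the pairing \<open>[\<iota>\<^sub>0, \<iota>\<^sub>1]\<close> is a cofibration enters as the lifting property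
  that it yields, a form that involves neither pushouts nor the size of the universe.\<close>

locale cylinder_category = category +
  fixes I :: "'m set" and Cyl :: "'m \<Rightarrow> 'o" and \<iota>\<^sub>0 \<iota>\<^sub>1 :: "'m \<Rightarrow> 'm"
  assumes I_Arr: "I \<subseteq> Arr C"
    and cylinder: "i \<in> I \<Longrightarrow> reflexive_cylinder C i (Cyl i) (\<iota>\<^sub>0 i) (\<iota>\<^sub>1 i)"
    and cylinder_lift: "i \<in> I \<Longrightarrow> p \<in> inj_class C I \<Longrightarrow> p \<in> hom C E F \<Longrightarrow>
      x \<in> hom C (Cod C i) E \<Longrightarrow> y \<in> hom C (Cod C i) E \<Longrightarrow> x \<cdot> i = y \<cdot> i \<Longrightarrow>
      H \<in> hom C (Cyl i) F \<Longrightarrow> p \<cdot> x = H \<cdot> \<iota>\<^sub>0 i \<Longrightarrow> p \<cdot> y = H \<cdot> \<iota>\<^sub>1 i \<Longrightarrow>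
      \<exists>G \<in> hom C (Cyl i) E. G \<cdot> \<iota>\<^sub>0 i = x \<and> G \<cdot> \<iota>\<^sub>1 i = y \<and> p \<cdot> G = H"
begin

abbreviation W :: "'m set" where "W \<equiv> W_class C I Cyl \<iota>\<^sub>0 \<iota>\<^sub>1"

lemma cylD:
  assumes "i \<in> I"
  shows "i \<in> hom C (Dom C i) (Cod C i)" "\<iota>\<^sub>0 i \<in> hom C (Cod C i) (Cyl i)"
    "\<iota>\<^sub>1 i \<in> hom C (Cod C i) (Cyl i)" "\<iota>\<^sub>0 i \<cdot> i = \<iota>\<^sub>1 i \<cdot> i"
    "\<exists>s \<in> hom C (Cyl i) (Cod C i). s \<cdot> \<iota>\<^sub>0 i = Id C (Cod C i) \<and> s \<cdot> \<iota>\<^sub>1 i = Id C (Cod C i)"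
  using cylinder[OF assms] Arr_hom unfolding reflexive_cylinder_def rel_cylinder_def by auto

lemma W_E:
  assumes f: "f \<in> W" "f \<in> hom C X Y" and i: "i \<in> I" and u: "u \<in> hom C (Dom C i) X"
    and v: "v \<in> hom C (Cod C i) Y" and eq: "f \<cdot> u = v \<cdot> i"
  obtains k H where "k \<in> hom C (Cod C i) X" "H \<in> hom C (Cyl i) Y" "k \<cdot> i = u"
    "H \<cdot> \<iota>\<^sub>0 i = f \<cdot> k" "H \<cdot> \<iota>\<^sub>1 i = v"
proof -
  have "rlp_upto C (cyl_sim C (Cyl i) (\<iota>\<^sub>0 i) (\<iota>\<^sub>1 i)) i f" using f i by (simp add: W_class_def)
  then obtain k where k: "k \<in> hom C (Cod C i) X" "k \<cdot> i = u"
    and sim: "cyl_sim C (Cyl i) (\<iota>\<^sub>0 i) (\<iota>\<^sub>1 i) (f \<cdot> k) v"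
    using f(2) u v eq unfolding rlp_upto_def by (auto simp: homD)
  have "Cod C (f \<cdot> k) = Y" using Comp_hom[OF k(1) f(2)] by (rule homD)
  then show thesis using that k sim unfolding cyl_sim_def by auto
qed

lemma W_I:
  assumes f: "f \<in> hom C X Y"
    and lift: "\<And>i u v. i \<in> I \<Longrightarrow> u \<in> hom C (Dom C i) X \<Longrightarrow> v \<in> hom C (Cod C i) Y \<Longrightarrow> f \<cdot> u = v \<cdot> i \<Longrightarrow>
      \<exists>k \<in> hom C (Cod C i) X. \<exists>H \<in> hom C (Cyl i) Y. k \<cdot> i = u \<and> H \<cdot> \<iota>\<^sub>0 i = f \<cdot> k \<and> H \<cdot> \<iota>\<^sub>1 i = v"
  shows "f \<in> W"
  unfolding W_class_def rlp_upto_def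
proof (intro CollectI conjI ballI impI)
  show "f \<in> Arr C" using f by (rule homD)
  fix i u v assume i: "i \<in> I" and u: "u \<in> hom C (Dom C i) (Dom C f)"
    and v: "v \<in> hom C (Cod C i) (Cod C f)" and eq: "f \<cdot> u = v \<cdot> i"
  obtain k H where k: "k \<in> hom C (Cod C i) X" and H: "H \<in> hom C (Cyl i) Y" "k \<cdot> i = u"
      "H \<cdot> \<iota>\<^sub>0 i = f \<cdot> k" "H \<cdot> \<iota>\<^sub>1 i = v"
    using lift[OF i _ _ eq] u v f by (auto simp: homD)
  have "Cod C (f \<cdot> k) = Y" using Comp_hom[OF k f] by (rule homD)
  then show "\<exists>k\<in>hom C (Cod C i) (Dom C f). k \<cdot> i = u \<and> cyl_sim C (Cyl i) (\<iota>\<^sub>0 i) (\<iota>\<^sub>1 i) (f \<cdot> k) v"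
    using k H f unfolding cyl_sim_def by (auto simp: homD)
qed

lemma Id_in_W:
  assumes X: "X \<in> Obj C"
  shows "Id C X \<in> W"
proof (rule W_I[OF Id_hom[OF X]])
  fix i u v assume i: "i \<in> I" and u: "u \<in> hom C (Dom C i) X" and v: "v \<in> hom C (Cod C i) X"
    and eq: "Id C X \<cdot> u = v \<cdot> i"
  note c = cylD[OF i]
  obtain s where s: "s \<in> hom C (Cyl i) (Cod C i)" "s \<cdot> \<iota>\<^sub>0 i = Id C (Cod C i)" "s \<cdot> \<iota>\<^sub>1 i = Id C (Cod C i)"
    using c(5) by blast
  have "(v \<cdot> s) \<cdot> \<iota>\<^sub>0 i = v" "(v \<cdot> s) \<cdot> \<iota>\<^sub>1 i = v"
    using assoc[OF c(2) s(1) v] assoc[OF c(3) s(1) v] s Comp_Id[OF v] by simp_all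
  then show "\<exists>k\<in>hom C (Cod C i) X. \<exists>H\<in>hom C (Cyl i) X. k \<cdot> i = u \<and> H \<cdot> \<iota>\<^sub>0 i = Id C X \<cdot> k \<and> H \<cdot> \<iota>\<^sub>1 i = v"
    using v Comp_hom[OF s(1) v] eq Id_Comp[OF u] Id_Comp[OF v] by (intro bexI[of _ v] bexI[of _ "v \<cdot> s"]) auto
qed

text \<open>Every object is fibrant: compose with the retraction of the cylinder.\<close>

lemma extend_along_\<iota>\<^sub>0:
  assumes i: "i \<in> I" and u: "u \<in> hom C (Cod C i) X"
  obtains w where "w \<in> hom C (Cyl i) X" "w \<cdot> \<iota>\<^sub>0 i = u"
proof -
  obtain s where s: "s \<in> hom C (Cyl i) (Cod C i)" "s \<cdot> \<iota>\<^sub>0 i = Id C (Cod C i)"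
    using cylD(5)[OF i] by blast
  have "(u \<cdot> s) \<cdot> \<iota>\<^sub>0 i = u" using assoc[OF cylD(2)[OF i] s(1) u] s(2) Comp_Id[OF u] by simp
  then show thesis using that Comp_hom[OF s(1) u] by blast
qed

text \<open>A lift up to homotopy is moved along a lift of the homotopy. The cylinder being relative to U,
  this does not change its restriction to U.\<close>

lemma W_fibration_in_inj:
  assumes f: "f \<in> W" "f \<in> inj_class C (\<iota>\<^sub>0 ` I)"
  shows "f \<in> inj_class C I"
  unfolding inj_class_def
proof (intro CollectI conjI ballI)
  show fA: "f \<in> Arr C" using f by (simp add: inj_class_def)
  note fh = Arr_hom[OF fA]
  fix i assume i: "i \<in> I"
  note c = cylD[OF i]
  show "rlp C i f"
  proof (rule rlpI[OF c(1) fh])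
    fix u v assume u: "u \<in> hom C (Dom C i) (Dom C f)" and v: "v \<in> hom C (Cod C i) (Cod C f)"
      and eq: "f \<cdot> u = v \<cdot> i"
    obtain k H where k: "k \<in> hom C (Cod C i) (Dom C f)" and H: "H \<in> hom C (Cyl i) (Cod C f)"
      and ki: "k \<cdot> i = u" and H0: "H \<cdot> \<iota>\<^sub>0 i = f \<cdot> k" and H1: "H \<cdot> \<iota>\<^sub>1 i = v"
      using W_E[OF f(1) fh i u v eq] .
    have "rlp C (\<iota>\<^sub>0 i) f" using f(2) i by (simp add: inj_class_def)
    then obtain G where G: "G \<in> hom C (Cyl i) (Dom C f)" "G \<cdot> \<iota>\<^sub>0 i = k" "f \<cdot> G = H"
      using rlpE[OF _ c(2) fh k H H0[symmetric]] by blast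
    have "(G \<cdot> \<iota>\<^sub>1 i) \<cdot> i = u"
      using assoc[OF c(1,3) G(1)] assoc[OF c(1,2) G(1)] c(4) G(2) ki by simp
    moreover have "f \<cdot> (G \<cdot> \<iota>\<^sub>1 i) = v" using assoc[OF c(3) G(1) fh] G(3) H1 by simp
    ultimately show "\<exists>k\<in>hom C (Cod C i) (Dom C f). k \<cdot> i = u \<and> f \<cdot> k = v"
      using Comp_hom[OF c(3) G(1)] by blast
  qed
qed

text \<open>The map \<open>\<iota>\<^sub>0\<close> is the inclusion of one end, a pushout of i, followed by the pairing of both ends:
  first the other end is lifted along i, then the homotopy.\<close>

lemma \<iota>\<^sub>0_in_cof:
  assumes i: "i \<in> I"
  shows "\<iota>\<^sub>0 i \<in> cof_class C I"
  unfolding cof_class_def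
proof (intro CollectI conjI ballI)
  note c = cylD[OF i]
  show "\<iota>\<^sub>0 i \<in> Arr C" using c(2) by (rule homD)
  fix p assume p: "p \<in> inj_class C I"
  then have ph: "p \<in> hom C (Dom C p) (Cod C p)" by (simp add: inj_class_def Arr_hom)
  show "rlp C (\<iota>\<^sub>0 i) p"
  proof (rule rlpI[OF c(2) ph])
    fix x H assume x: "x \<in> hom C (Cod C i) (Dom C p)" and H: "H \<in> hom C (Cyl i) (Cod C p)"
      and eq: "p \<cdot> x = H \<cdot> \<iota>\<^sub>0 i"
    have "p \<cdot> (x \<cdot> i) = (H \<cdot> \<iota>\<^sub>1 i) \<cdot> i"
      using assoc[OF c(1) x ph] eq assoc[OF c(1,2) H] assoc[OF c(1,3) H] c(4) by simp
    moreover have "rlp C i p" using p i by (simp add: inj_class_def)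
    ultimately obtain y where y: "y \<in> hom C (Cod C i) (Dom C p)" "y \<cdot> i = x \<cdot> i" "p \<cdot> y = H \<cdot> \<iota>\<^sub>1 i"
      using rlpE[OF _ c(1) ph Comp_hom[OF c(1) x] Comp_hom[OF c(3) H]] by blast
    then show "\<exists>G\<in>hom C (Cyl i) (Dom C p). G \<cdot> \<iota>\<^sub>0 i = x \<and> p \<cdot> G = H"
      using cylinder_lift[OF i p ph x y(1) y(2)[symmetric] H eq y(3)] by blast
  qed
qed

end


context cylinder_category
begin

text \<open>The path object of X is a factorization of the diagonal. The hypothesis on cancellation applies
  because the inclusion of constant paths is a section of both projections and identities are in W;
  the projections lie in J-inj because, X being fibrant, the other coordinate of a square
  can always be filled in.\<close>

lemma path_objects_exist:
  assumes prod: "\<And>X. X \<in> Obj C \<Longrightarrow> \<exists>Q q\<^sub>0 q\<^sub>1. is_product C X X Q q\<^sub>0 q\<^sub>1"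
    and T: "\<And>f p. f \<in> T \<Longrightarrow> p \<in> inj_class C (\<iota>\<^sub>0 ` I) \<Longrightarrow> rlp C f p"
    and fac: "\<And>f X Y. f \<in> hom C X Y \<Longrightarrow>
      \<exists>E t q. t \<in> hom C X E \<and> q \<in> hom C E Y \<and> q \<cdot> t = f \<and> t \<in> T \<and> q \<in> inj_class C (\<iota>\<^sub>0 ` I)"
    and cancel: "\<forall>f \<in> T. \<forall>g \<in> Arr C. Dom C g = Cod C f \<longrightarrow> g \<cdot> f \<in> W \<longrightarrow> g \<in> W"
  obtains P p\<^sub>0 p\<^sub>1 where
    "\<forall>X \<in> Obj C. path_object C X (P X) (p\<^sub>0 X) (p\<^sub>1 X)"
    "\<forall>X \<in> Obj C. \<forall>Y \<in> Obj C. \<forall>f \<in> hom C X Y. \<exists>Pf.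
       path_morphism C (P X) (p\<^sub>0 X) (p\<^sub>1 X) (P Y) (p\<^sub>0 Y) (p\<^sub>1 Y) f Pf"
    "\<forall>X \<in> Obj C. \<forall>i \<in> I. rlp C i (p\<^sub>1 X)"
    "\<forall>X \<in> Obj C. \<forall>i \<in> I. rlp C i (p\<^sub>0 X)"
    "\<forall>X \<in> Obj C. reflexive_path_object C X (P X) (p\<^sub>0 X) (p\<^sub>1 X) \<and>
       pairing_rlp C (\<iota>\<^sub>0 ` I) X (P X) (p\<^sub>0 X) (p\<^sub>1 X)"
proof -
  let ?J = "\<iota>\<^sub>0 ` I"
  \<comment> \<open>the lifting property of the pairing, independent of the chosen product\<close>
  define lifts where "lifts X P p\<^sub>0 p\<^sub>1 j \<longleftrightarrow>
      (\<forall>u \<in> hom C (Dom C j) P. \<forall>a \<in> hom C (Cod C j) X. \<forall>b \<in> hom C (Cod C j) X.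
        p\<^sub>0 \<cdot> u = a \<cdot> j \<and> p\<^sub>1 \<cdot> u = b \<cdot> j \<longrightarrow>
        (\<exists>k \<in> hom C (Cod C j) P. k \<cdot> j = u \<and> p\<^sub>0 \<cdot> k = a \<and> p\<^sub>1 \<cdot> k = b))" for X P p\<^sub>0 p\<^sub>1 j
  define good where "good X P p\<^sub>0 p\<^sub>1 t \<longleftrightarrow>
      p\<^sub>0 \<in> hom C P X \<and> p\<^sub>1 \<in> hom C P X \<and> t \<in> hom C X P \<and> t \<in> T \<and>
      p\<^sub>0 \<cdot> t = Id C X \<and> p\<^sub>1 \<cdot> t = Id C X \<and>
      (\<forall>j \<in> T \<union> ?J. j \<in> Arr C \<longrightarrow> lifts X P p\<^sub>0 p\<^sub>1 j)" for X P p\<^sub>0 p\<^sub>1 t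
  have "\<exists>P p\<^sub>0 p\<^sub>1 t. good X P p\<^sub>0 p\<^sub>1 t"
    if X: "X \<in> Obj C" for X
  proof -
    obtain Q q\<^sub>0 q\<^sub>1 where Q: "is_product C X X Q q\<^sub>0 q\<^sub>1" using prod[OF X] by blast
    note Qd = productD[OF Q]
    obtain d where d: "d \<in> hom C X Q" "q\<^sub>0 \<cdot> d = Id C X" "q\<^sub>1 \<cdot> d = Id C X"
      using Qd(4)[OF X Id_hom[OF X] Id_hom[OF X]] by blast
    obtain P t h where t: "t \<in> hom C X P" and h: "h \<in> hom C P Q" "h \<cdot> t = d" and tT: "t \<in> T"
      and hJ: "h \<in> inj_class C ?J" using fac[OF d(1)] by blast
    have "lifts X P (q\<^sub>0 \<cdot> h) (q\<^sub>1 \<cdot> h) j" if "j \<in> T \<union> ?J" "j \<in> Arr C" for j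
    proof -
      have "rlp C j h" using that(1) T hJ by (auto simp: inj_class_def)
      then show ?thesis unfolding lifts_def pairing_lift_iff[OF Q h(1) Arr_hom[OF that(2)]] .
    qed
    then show ?thesis
      unfolding good_def
      using Comp_hom[OF h(1) Qd(2)] Comp_hom[OF h(1) Qd(3)] t tT d h(2)
        assoc[OF t h(1) Qd(2)] assoc[OF t h(1) Qd(3)]
      by (intro exI[of _ P] exI[of _ "q\<^sub>0 \<cdot> h"] exI[of _ "q\<^sub>1 \<cdot> h"] exI[of _ t]) auto
  qed
  then obtain P p\<^sub>0 p\<^sub>1 t where good: "\<And>X. X \<in> Obj C \<Longrightarrow> good X (P X) (p\<^sub>0 X) (p\<^sub>1 X) (t X)"
    by metis
  then have p0: "\<And>X. X \<in> Obj C \<Longrightarrow> p\<^sub>0 X \<in> hom C (P X) X" and p1: "\<And>X. X \<in> Obj C \<Longrightarrow> p\<^sub>1 X \<in> hom C (P X) X"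
    and t: "\<And>X. X \<in> Obj C \<Longrightarrow> t X \<in> hom C X (P X)" "\<And>X. X \<in> Obj C \<Longrightarrow> t X \<in> T"
      "\<And>X. X \<in> Obj C \<Longrightarrow> p\<^sub>0 X \<cdot> t X = Id C X" "\<And>X. X \<in> Obj C \<Longrightarrow> p\<^sub>1 X \<cdot> t X = Id C X"
    and lift: "\<And>X j. X \<in> Obj C \<Longrightarrow> j \<in> T \<union> ?J \<Longrightarrow> j \<in> Arr C \<Longrightarrow> lifts X (P X) (p\<^sub>0 X) (p\<^sub>1 X) j"
    unfolding good_def by blast+
  have lift_E: "\<exists>k \<in> hom C B (P X). k \<cdot> j = u \<and> p\<^sub>0 X \<cdot> k = a \<and> p\<^sub>1 X \<cdot> k = b"
    if "X \<in> Obj C" "j \<in> T \<union> ?J" "j \<in> hom C A B" "u \<in> hom C A (P X)" "a \<in> hom C B X" "b \<in> hom C B X"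
      "p\<^sub>0 X \<cdot> u = a \<cdot> j" "p\<^sub>1 X \<cdot> u = b \<cdot> j" for X j A B u a b
    using lift[OF that(1,2)] that(3-) unfolding lifts_def by (auto simp: homD)
  have morph: "\<exists>Pf. path_morphism C (P X) (p\<^sub>0 X) (p\<^sub>1 X) (P Y) (p\<^sub>0 Y) (p\<^sub>1 Y) f Pf"
    if X: "X \<in> Obj C" and Y: "Y \<in> Obj C" and f: "f \<in> hom C X Y" for X Y f
  proof -
    have "p\<^sub>0 Y \<cdot> (t Y \<cdot> f) = (f \<cdot> p\<^sub>0 X) \<cdot> t X"
      using assoc[OF f t(1)[OF Y] p0[OF Y]] assoc[OF t(1)[OF X] p0[OF X] f] t(3)[OF X] t(3)[OF Y]
        Id_Comp[OF f] Comp_Id[OF f] by simp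
    moreover have "p\<^sub>1 Y \<cdot> (t Y \<cdot> f) = (f \<cdot> p\<^sub>1 X) \<cdot> t X"
      using assoc[OF f t(1)[OF Y] p1[OF Y]] assoc[OF t(1)[OF X] p1[OF X] f] t(4)[OF X] t(4)[OF Y]
        Id_Comp[OF f] Comp_Id[OF f] by simp
    ultimately obtain k where "k \<in> hom C (P X) (P Y)" "p\<^sub>0 Y \<cdot> k = f \<cdot> p\<^sub>0 X" "p\<^sub>1 Y \<cdot> k = f \<cdot> p\<^sub>1 X"
      using lift_E[OF Y _ t(1)[OF X] Comp_hom[OF f t(1)[OF Y]] Comp_hom[OF p0[OF X] f]
          Comp_hom[OF p1[OF X] f]] t(2)[OF X] by blast
    then show ?thesis using f by (auto simp: path_morphism_def homD)
  qed
  have inj: "p\<^sub>0 X \<in> inj_class C I \<and> p\<^sub>1 X \<in> inj_class C I" if X: "X \<in> Obj C" for X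
  proof -
    have "p\<^sub>0 X \<in> W" "p\<^sub>1 X \<in> W"
      using cancel t(2)[OF X] t(3,4)[OF X] t(1)[OF X] p0[OF X] p1[OF X] Id_in_W[OF X]
      by (auto simp: homD)
    moreover have "p\<^sub>0 X \<in> inj_class C ?J \<and> p\<^sub>1 X \<in> inj_class C ?J"
    proof -
      have "rlp C (\<iota>\<^sub>0 i) (p\<^sub>0 X) \<and> rlp C (\<iota>\<^sub>0 i) (p\<^sub>1 X)" if i: "i \<in> I" for i
      proof
        note c = cylD[OF i]
        have j: "\<iota>\<^sub>0 i \<in> T \<union> ?J" using i by blast
        show "rlp C (\<iota>\<^sub>0 i) (p\<^sub>0 X)"
        proof (rule rlpI[OF c(2) p0[OF X]])
          fix u v assume u: "u \<in> hom C (Cod C i) (P X)" and v: "v \<in> hom C (Cyl i) X"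
            and eq: "p\<^sub>0 X \<cdot> u = v \<cdot> \<iota>\<^sub>0 i"
          obtain w where "w \<in> hom C (Cyl i) X" "w \<cdot> \<iota>\<^sub>0 i = p\<^sub>1 X \<cdot> u"
            using extend_along_\<iota>\<^sub>0[OF i Comp_hom[OF u p1[OF X]]] .
          then show "\<exists>k\<in>hom C (Cyl i) (P X). k \<cdot> \<iota>\<^sub>0 i = u \<and> p\<^sub>0 X \<cdot> k = v"
            using lift_E[OF X j c(2) u v _ eq] by metis
        qed
        show "rlp C (\<iota>\<^sub>0 i) (p\<^sub>1 X)"
        proof (rule rlpI[OF c(2) p1[OF X]])
          fix u v assume u: "u \<in> hom C (Cod C i) (P X)" and v: "v \<in> hom C (Cyl i) X"
            and eq: "p\<^sub>1 X \<cdot> u = v \<cdot> \<iota>\<^sub>0 i"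
          obtain w where "w \<in> hom C (Cyl i) X" "w \<cdot> \<iota>\<^sub>0 i = p\<^sub>0 X \<cdot> u"
            using extend_along_\<iota>\<^sub>0[OF i Comp_hom[OF u p0[OF X]]] .
          then show "\<exists>k\<in>hom C (Cyl i) (P X). k \<cdot> \<iota>\<^sub>0 i = u \<and> p\<^sub>1 X \<cdot> k = v"
            using lift_E[OF X j c(2) u _ v _ eq] by metis
        qed
      qed
      then show ?thesis using p0[OF X] p1[OF X] by (auto simp: inj_class_def homD)
    qed
    ultimately show ?thesis using W_fibration_in_inj by blast
  qed
  have refl: "reflexive_path_object C X (P X) (p\<^sub>0 X) (p\<^sub>1 X)" if X: "X \<in> Obj C" for X
    using X p0[OF X] p1[OF X] t[OF X] hom_Obj(1)[OF p0[OF X]]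
    unfolding reflexive_path_object_def path_object_def by blast
  have pair: "pairing_rlp C ?J X (P X) (p\<^sub>0 X) (p\<^sub>1 X)" if X: "X \<in> Obj C" for X
    unfolding pairing_rlp_def
  proof (intro allI impI ballI, elim conjE)
    fix Q q\<^sub>0 q\<^sub>1 h j
    assume Q: "is_product C X X Q q\<^sub>0 q\<^sub>1" and h: "h \<in> hom C (P X) Q" and j: "j \<in> ?J"
      and eq: "q\<^sub>0 \<cdot> h = p\<^sub>0 X" "q\<^sub>1 \<cdot> h = p\<^sub>1 X"
    have "j \<in> Arr C" using j cylD(2) by (auto simp: hom_def)
    then show "rlp C j h"
      using pairing_lift_iff[OF Q h Arr_hom] lift[OF X] j unfolding eq lifts_def by blast
  qed
  show thesis
    by (rule that[of P p\<^sub>0 p\<^sub>1])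
      (use refl pair morph inj in \<open>auto simp: inj_class_def reflexive_path_object_def\<close>)
qed

text \<open>The domain is fibrant, so its identity extends along f.\<close>

lemma trivial_cofibration_retraction:
  assumes terminal: "Z \<in> Obj C" "\<forall>X \<in> Obj C. \<exists>!h. h \<in> hom C X Z"
    and f: "f \<in> hom C A B" "\<And>p. p \<in> inj_class C (\<iota>\<^sub>0 ` I) \<Longrightarrow> rlp C f p"
  obtains \<rho> where "\<rho> \<in> hom C B A" "\<rho> \<cdot> f = Id C A"
proof -
  note O = hom_Obj[OF f(1)]
  obtain a where a: "a \<in> hom C A Z" using terminal(2) O by blast
  obtain b where b: "b \<in> hom C B Z" using terminal(2) O by blast
  have uniq: "g = h" if "g \<in> hom C X Z" "h \<in> hom C X Z" for g h X
    using terminal(2) that hom_Obj(1)[OF that(1)] by metis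
  have "rlp C (\<iota>\<^sub>0 i) a" if i: "i \<in> I" for i
  proof (rule rlpI[OF cylD(2)[OF i] a])
    fix u v assume u: "u \<in> hom C (Cod C i) A" and v: "v \<in> hom C (Cyl i) Z"
    obtain w where w: "w \<in> hom C (Cyl i) A" "w \<cdot> \<iota>\<^sub>0 i = u" using extend_along_\<iota>\<^sub>0[OF i u] .
    then show "\<exists>k\<in>hom C (Cyl i) A. k \<cdot> \<iota>\<^sub>0 i = u \<and> a \<cdot> k = v"
      using uniq[OF Comp_hom[OF w(1) a] v] by blast
  qed
  then have "a \<in> inj_class C (\<iota>\<^sub>0 ` I)" using a by (auto simp: inj_class_def homD)
  moreover have "a \<cdot> Id C A = b \<cdot> f"
    using uniq[OF Comp_hom[OF Id_hom[OF O(1)] a] Comp_hom[OF f(1) b]] .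
  ultimately show thesis using rlpE[OF f(2) f(1) a Id_hom[OF O(1)] b] that by metis
qed

text \<open>The homotopy hypothesis says that maps from U into B are ends of paths starting in the image of f.
  Paths can be extended from U to V with prescribed start (lifting along \<open>p\<^sub>0\<close>) and, up to a fixed
  endomorphism e of the path object, with prescribed end. The two extensions used here, the image
  of a path in B and a path y ending at v, agree on U, and a homotopy between their starts comes
  from \<open>g f \<in> W\<close>. Lifting that homotopy to paths and taking ends yields a homotopy from g applied to the lift to v.\<close>

lemma left_cancellation_from_path_objects:
  assumes P: "\<And>X. X \<in> Obj C \<Longrightarrow> path_object C X (P X) (p\<^sub>0 X) (p\<^sub>1 X)"
    and morph: "\<And>X Y f. f \<in> hom C X Y \<Longrightarrow>
       \<exists>Pf. path_morphism C (P X) (p\<^sub>0 X) (p\<^sub>1 X) (P Y) (p\<^sub>0 Y) (p\<^sub>1 Y) f Pf"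
    and sym: "\<And>X. X \<in> Obj C \<Longrightarrow> (\<forall>i \<in> I. rlp C i (p\<^sub>1 X)) \<or>
       (\<exists>s \<in> hom C (P X) (P X). p\<^sub>0 X \<cdot> s = p\<^sub>1 X \<and> p\<^sub>1 X \<cdot> s = p\<^sub>0 X)"
    and p0_rlp: "\<And>X i. X \<in> Obj C \<Longrightarrow> i \<in> I \<Longrightarrow> rlp C i (p\<^sub>0 X)"
    and f: "f \<in> hom C A B" and g: "g \<in> hom C B Z" and gf: "g \<cdot> f \<in> W"
    and homotopy: "\<And>i u. i \<in> I \<Longrightarrow> u \<in> hom C (Dom C i) B \<Longrightarrow>
       \<exists>u' \<in> hom C (Dom C i) A. \<exists>h \<in> hom C (Dom C i) (P B). p\<^sub>0 B \<cdot> h = f \<cdot> u' \<and> p\<^sub>1 B \<cdot> h = u"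
  shows "g \<in> W"
proof -
  have BO: "B \<in> Obj C" and ZO: "Z \<in> Obj C" using hom_Obj[OF g] by auto
  have p0: "p\<^sub>0 X \<in> hom C (P X) X" and p1: "p\<^sub>1 X \<in> hom C (P X) X" and PO: "P X \<in> Obj C"
    if "X \<in> Obj C" for X
    using P[OF that] by (auto simp: path_object_def)
  \<comment> \<open>in the symmetric case e is path inversion applied twice: it fixes both ends of a path but need
    not be the identity\<close>
  obtain e where e: "e \<in> hom C (P Z) (P Z)" "p\<^sub>0 Z \<cdot> e = p\<^sub>0 Z" "p\<^sub>1 Z \<cdot> e = p\<^sub>1 Z"
    and p1_lift: "\<And>i x v. i \<in> I \<Longrightarrow> x \<in> hom C (Dom C i) (P Z) \<Longrightarrow> v \<in> hom C (Cod C i) Z \<Longrightarrow>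
      p\<^sub>1 Z \<cdot> x = v \<cdot> i \<Longrightarrow> \<exists>k \<in> hom C (Cod C i) (P Z). k \<cdot> i = e \<cdot> x \<and> p\<^sub>1 Z \<cdot> k = v"
    using sym[OF ZO]
  proof (elim disjE bexE conjE)
    assume r: "\<forall>i \<in> I. rlp C i (p\<^sub>1 Z)"
    show thesis
    proof (rule that[of "Id C (P Z)"])
      show "Id C (P Z) \<in> hom C (P Z) (P Z)" by (rule Id_hom[OF PO[OF ZO]])
      show "p\<^sub>0 Z \<cdot> Id C (P Z) = p\<^sub>0 Z" "p\<^sub>1 Z \<cdot> Id C (P Z) = p\<^sub>1 Z"
        using Comp_Id p0[OF ZO] p1[OF ZO] by auto
      fix i x v assume i: "i \<in> I" and x: "x \<in> hom C (Dom C i) (P Z)" "v \<in> hom C (Cod C i) Z"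
        "p\<^sub>1 Z \<cdot> x = v \<cdot> i"
      have "rlp C i (p\<^sub>1 Z)" using r i by blast
      then show "\<exists>k\<in>hom C (Cod C i) (P Z). k \<cdot> i = Id C (P Z) \<cdot> x \<and> p\<^sub>1 Z \<cdot> k = v"
        using rlpE[OF _ cylD(1)[OF i] p1[OF ZO] x] Id_Comp[OF x(1)] by metis
    qed
  next
    fix s assume s: "s \<in> hom C (P Z) (P Z)" "p\<^sub>0 Z \<cdot> s = p\<^sub>1 Z" "p\<^sub>1 Z \<cdot> s = p\<^sub>0 Z"
    show thesis
    proof (rule that[of "s \<cdot> s"])
      show "s \<cdot> s \<in> hom C (P Z) (P Z)" by (rule Comp_hom[OF s(1) s(1)])
      show "p\<^sub>0 Z \<cdot> (s \<cdot> s) = p\<^sub>0 Z" "p\<^sub>1 Z \<cdot> (s \<cdot> s) = p\<^sub>1 Z"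
        using assoc[OF s(1) s(1) p0[OF ZO]] assoc[OF s(1) s(1) p1[OF ZO]] s by simp_all
      fix i x v assume i: "i \<in> I" and x: "x \<in> hom C (Dom C i) (P Z)" and v: "v \<in> hom C (Cod C i) Z"
        and eq: "p\<^sub>1 Z \<cdot> x = v \<cdot> i"
      have "p\<^sub>0 Z \<cdot> (s \<cdot> x) = v \<cdot> i" using assoc[OF x s(1) p0[OF ZO]] s eq by simp
      then obtain k where k: "k \<in> hom C (Cod C i) (P Z)" "k \<cdot> i = s \<cdot> x" "p\<^sub>0 Z \<cdot> k = v"
        using rlpE[OF p0_rlp[OF ZO i] cylD(1)[OF i] p0[OF ZO] Comp_hom[OF x s(1)] v] by blast
      have "(s \<cdot> k) \<cdot> i = (s \<cdot> s) \<cdot> x"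
        using assoc[OF cylD(1)[OF i] k(1) s(1)] k(2) assoc[OF x s(1) s(1)] by simp
      moreover have "p\<^sub>1 Z \<cdot> (s \<cdot> k) = v" using assoc[OF k(1) s(1) p1[OF ZO]] s k by simp
      ultimately show "\<exists>k\<in>hom C (Cod C i) (P Z). k \<cdot> i = s \<cdot> s \<cdot> x \<and> p\<^sub>1 Z \<cdot> k = v"
        using Comp_hom[OF k(1) s(1)] by blast
    qed
  qed
  obtain G where G: "G \<in> hom C (P B) (P Z)" "p\<^sub>0 Z \<cdot> G = g \<cdot> p\<^sub>0 B" "p\<^sub>1 Z \<cdot> G = g \<cdot> p\<^sub>1 B"
    using morph[OF g] by (auto simp: path_morphism_def)
  \<comment> \<open>using E in place of G makes the restrictions to U of the two extended paths equal\<close>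
  define E where "E = e \<cdot> G"
  have E: "E \<in> hom C (P B) (P Z)" "p\<^sub>0 Z \<cdot> E = g \<cdot> p\<^sub>0 B" "p\<^sub>1 Z \<cdot> E = g \<cdot> p\<^sub>1 B"
    using Comp_hom[OF G(1) e(1)] assoc[OF G(1) e(1) p0[OF ZO]] assoc[OF G(1) e(1) p1[OF ZO]] e G
    by (simp_all add: E_def)
  have E_path: "p\<^sub>0 Z \<cdot> (E \<cdot> x) = g \<cdot> (p\<^sub>0 B \<cdot> x)" "p\<^sub>1 Z \<cdot> (E \<cdot> x) = g \<cdot> (p\<^sub>1 B \<cdot> x)"
    if x: "x \<in> hom C D (P B)" for x D
    using assoc[OF x E(1) p0[OF ZO]] assoc[OF x p0[OF BO] g] assoc[OF x E(1) p1[OF ZO]]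
      assoc[OF x p1[OF BO] g] E by simp_all
  have gfh: "g \<cdot> f \<in> hom C A Z" by (rule Comp_hom[OF f g])
  have p0_inj: "p\<^sub>0 Z \<in> inj_class C I" using p0[OF ZO] p0_rlp[OF ZO] by (auto simp: inj_class_def homD)
  show ?thesis
  proof (rule W_I[OF g])
    fix i u v assume i: "i \<in> I" and u: "u \<in> hom C (Dom C i) B" and v: "v \<in> hom C (Cod C i) Z"
      and eq: "g \<cdot> u = v \<cdot> i"
    note c = cylD[OF i]
    obtain u' h where u': "u' \<in> hom C (Dom C i) A" and h: "h \<in> hom C (Dom C i) (P B)"
      and h0: "p\<^sub>0 B \<cdot> h = f \<cdot> u'" and h1: "p\<^sub>1 B \<cdot> h = u" using homotopy[OF i u] by blast
    have Gh: "G \<cdot> h \<in> hom C (Dom C i) (P Z)" by (rule Comp_hom[OF h G(1)])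
    have Eh: "e \<cdot> (G \<cdot> h) = E \<cdot> h" unfolding E_def using assoc[OF h G(1) e(1)] by simp
    have "p\<^sub>1 Z \<cdot> (G \<cdot> h) = v \<cdot> i"
      using assoc[OF h G(1) p1[OF ZO]] G(3) assoc[OF h p1[OF BO] g] h1 eq by simp
    then obtain y where y: "y \<in> hom C (Cod C i) (P Z)" "y \<cdot> i = E \<cdot> h" "p\<^sub>1 Z \<cdot> y = v"
      using p1_lift[OF i Gh v] Eh by auto
    \<comment> \<open>the other end of the path y extends the image of u'\<close>
    have "(g \<cdot> f) \<cdot> u' = (p\<^sub>0 Z \<cdot> y) \<cdot> i"
      using assoc[OF u' f g] assoc[OF c(1) y(1) p0[OF ZO]] y(2) E_path(1)[OF h] h0 by simp
    then obtain m H where m: "m \<in> hom C (Cod C i) A" "m \<cdot> i = u'" and H: "H \<in> hom C (Cyl i) Z"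
      and H0: "H \<cdot> \<iota>\<^sub>0 i = (g \<cdot> f) \<cdot> m" and H1: "H \<cdot> \<iota>\<^sub>1 i = p\<^sub>0 Z \<cdot> y"
      using W_E[OF gf gfh i u' Comp_hom[OF y(1) p0[OF ZO]]] by blast
    have fm: "f \<cdot> m \<in> hom C (Cod C i) B" by (rule Comp_hom[OF m(1) f])
    have "p\<^sub>0 B \<cdot> h = (f \<cdot> m) \<cdot> i" using h0 assoc[OF c(1) m(1) f] m(2) by simp
    then obtain n where n: "n \<in> hom C (Cod C i) (P B)" "n \<cdot> i = h" "p\<^sub>0 B \<cdot> n = f \<cdot> m"
      using rlpE[OF p0_rlp[OF BO i] c(1) p0[OF BO] h fm] by blast
    have "\<exists>K \<in> hom C (Cyl i) (P Z). K \<cdot> \<iota>\<^sub>0 i = E \<cdot> n \<and> K \<cdot> \<iota>\<^sub>1 i = y \<and> p\<^sub>0 Z \<cdot> K = H"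
    proof (rule cylinder_lift[OF i p0_inj p0[OF ZO] Comp_hom[OF n(1) E(1)] y(1) _ H])
      show "(E \<cdot> n) \<cdot> i = y \<cdot> i" using assoc[OF c(1) n(1) E(1)] n(2) y(2) by simp
      show "p\<^sub>0 Z \<cdot> (E \<cdot> n) = H \<cdot> \<iota>\<^sub>0 i" using E_path(1)[OF n(1)] n(3) H0 assoc[OF m(1) f g] by simp
      show "p\<^sub>0 Z \<cdot> y = H \<cdot> \<iota>\<^sub>1 i" using H1 by simp
    qed
    then obtain K where K: "K \<in> hom C (Cyl i) (P Z)" "K \<cdot> \<iota>\<^sub>0 i = E \<cdot> n" "K \<cdot> \<iota>\<^sub>1 i = y" by blast
    have k: "p\<^sub>1 B \<cdot> n \<in> hom C (Cod C i) B" by (rule Comp_hom[OF n(1) p1[OF BO]])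
    have "(p\<^sub>1 B \<cdot> n) \<cdot> i = u" using assoc[OF c(1) n(1) p1[OF BO]] n(2) h1 by simp
    moreover have "(p\<^sub>1 Z \<cdot> K) \<cdot> \<iota>\<^sub>0 i = g \<cdot> (p\<^sub>1 B \<cdot> n)"
      using assoc[OF c(2) K(1) p1[OF ZO]] K(2) E_path(2)[OF n(1)] by simp
    moreover have "(p\<^sub>1 Z \<cdot> K) \<cdot> \<iota>\<^sub>1 i = v"
      using assoc[OF c(3) K(1) p1[OF ZO]] K(3) y(3) by simp
    ultimately show "\<exists>k\<in>hom C (Cod C i) B. \<exists>H\<in>hom C (Cyl i) Z.
        k \<cdot> i = u \<and> H \<cdot> \<iota>\<^sub>0 i = g \<cdot> k \<and> H \<cdot> \<iota>\<^sub>1 i = v"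
      using k Comp_hom[OF K(1) p1[OF ZO]] by blast
  qed
qed

text \<open>A trivial cofibration f is the inclusion of a deformation retract: it has a retraction \<open>\<rho>\<close>, and \<open>f \<rho>\<close> is homotopic
  to the identity because the constant homotopy at f extends along f.\<close>

lemma homotopy_from_reflexive_path_object:
  assumes terminal: "Z \<in> Obj C" "\<forall>X \<in> Obj C. \<exists>!h. h \<in> hom C X Z"
    and prod: "is_product C B B Q q\<^sub>0 q\<^sub>1"
    and f: "f \<in> hom C A B" "\<And>p. p \<in> inj_class C (\<iota>\<^sub>0 ` I) \<Longrightarrow> rlp C f p"
    and refl: "reflexive_path_object C B P p\<^sub>0 p\<^sub>1" and pair: "pairing_rlp C (\<iota>\<^sub>0 ` I) B P p\<^sub>0 p\<^sub>1"
    and u: "u \<in> hom C D B"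
  shows "\<exists>u' \<in> hom C D A. \<exists>h \<in> hom C D P. p\<^sub>0 \<cdot> h = f \<cdot> u' \<and> p\<^sub>1 \<cdot> h = u"
proof -
  obtain \<rho> where \<rho>: "\<rho> \<in> hom C B A" "\<rho> \<cdot> f = Id C A"
    using trivial_cofibration_retraction[OF terminal f] .
  have p: "p\<^sub>0 \<in> hom C P B" "p\<^sub>1 \<in> hom C P B" and PO: "P \<in> Obj C" and BO: "B \<in> Obj C"
    using refl by (auto simp: reflexive_path_object_def path_object_def)
  obtain t where t: "t \<in> hom C B P" "p\<^sub>0 \<cdot> t = Id C B" "p\<^sub>1 \<cdot> t = Id C B"
    using refl by (auto simp: reflexive_path_object_def)
  obtain h where h: "h \<in> hom C P Q" "q\<^sub>0 \<cdot> h = p\<^sub>0" "q\<^sub>1 \<cdot> h = p\<^sub>1"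
    using productD(4)[OF prod PO p] by blast
  have "h \<in> inj_class C (\<iota>\<^sub>0 ` I)"
    using pair prod h by (auto simp: pairing_rlp_def inj_class_def homD)
  then have fh: "rlp C f h" by (rule f(2))
  have tf: "t \<cdot> f \<in> hom C A P" and f\<rho>: "f \<cdot> \<rho> \<in> hom C B B"
    using Comp_hom f t \<rho> by blast+
  have "p\<^sub>0 \<cdot> (t \<cdot> f) = (f \<cdot> \<rho>) \<cdot> f"
    using assoc[OF f(1) t(1) p(1)] t(2) Id_Comp[OF f(1)] assoc[OF f(1) \<rho>(1) f(1)] \<rho>(2) Comp_Id[OF f(1)]
    by simp
  moreover have "p\<^sub>1 \<cdot> (t \<cdot> f) = Id C B \<cdot> f" using assoc[OF f(1) t(1) p(2)] t(3) by simp
  ultimately obtain H where H: "H \<in> hom C B P" "p\<^sub>0 \<cdot> H = f \<cdot> \<rho>" "p\<^sub>1 \<cdot> H = Id C B"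
    using fh[unfolded pairing_lift_iff[OF prod h(1) f(1)] h(2,3)] tf f\<rho> Id_hom[OF BO] by blast
  have "p\<^sub>0 \<cdot> (H \<cdot> u) = f \<cdot> (\<rho> \<cdot> u)"
    using assoc[OF u H(1) p(1)] H(2) assoc[OF u \<rho>(1) f(1)] by simp
  moreover have "p\<^sub>1 \<cdot> (H \<cdot> u) = u" using assoc[OF u H(1) p(2)] H(3) Id_Comp[OF u] by simp
  ultimately show ?thesis using Comp_hom[OF u \<rho>(1)] Comp_hom[OF u H(1)] by blast
qed

end

section \<open>The equivalence\<close>

lemma (in category) rlp_upto_objE:
  assumes Z: "is_initial C Z" and r: "rlp_upto_obj C (path_sim C P p\<^sub>0 p\<^sub>1) D f"
    and f: "f \<in> hom C A B" and u: "u \<in> hom C D B"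
  shows "\<exists>u' \<in> hom C D A. \<exists>h \<in> hom C D P. p\<^sub>0 \<cdot> h = f \<cdot> u' \<and> p\<^sub>1 \<cdot> h = u"
proof -
  have init: "\<exists>!h. h \<in> hom C Z X" if "X \<in> Obj C" for X using Z that by (simp add: is_initial_def)
  obtain z where z: "z \<in> hom C Z D" using init[OF hom_Obj(1)[OF u]] by blast
  obtain w where w: "w \<in> hom C Z A" using init[OF hom_Obj(1)[OF f]] by blast
  have "f \<cdot> w = u \<cdot> z"
    using init[OF hom_Obj(2)[OF f]] Comp_hom[OF w f] Comp_hom[OF z u] by blast
  moreover have "rlp_upto C (path_sim C P p\<^sub>0 p\<^sub>1) z f" using r Z z by (auto simp: rlp_upto_obj_def)
  ultimately obtain k where k: "k \<in> hom C D A" "path_sim C P p\<^sub>0 p\<^sub>1 (f \<cdot> k) u"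
    using f u z w unfolding rlp_upto_def by (auto simp: homD)
  have "Dom C (f \<cdot> k) = D" using Comp_hom[OF k(1) f] by (rule homD)
  then show ?thesis using k unfolding path_sim_def by auto
qed

theorem proposition4p4:
  fixes C :: "('o, 'm) cat" and I :: "'m set"
    and Cyl :: "'m \<Rightarrow> 'o" and \<iota>\<^sub>0 \<iota>\<^sub>1 :: "'m \<Rightarrow> 'm"
  assumes "universe TYPE('u)"
    and "category C" and "locally_small TYPE('u) C"
    and "complete TYPE('u) C" and "cocomplete TYPE('u) C"
    and "I \<subseteq> Arr C" and "small TYPE('u) I"
    and "\<And>i. i \<in> I \<Longrightarrow> small_relative TYPE('u) C (cell_class TYPE('u) C I) (Dom C i)"
    and "\<And>i. i \<in> I \<Longrightarrow> small_relative TYPE('u) C (cell_class TYPE('u) C I) (Cod C i)"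
    and "\<And>i. i \<in> I \<Longrightarrow> reflexive_cylinder C i (Cyl i) (\<iota>\<^sub>0 i) (\<iota>\<^sub>1 i)"
    and "\<And>i. i \<in> I \<Longrightarrow> copairing_in C (cof_class C I) i (Cyl i) (\<iota>\<^sub>0 i) (\<iota>\<^sub>1 i)"
  shows
    "(\<forall>f \<in> cell_class TYPE('u) C (\<iota>\<^sub>0 ` I). \<forall>g \<in> Arr C. Dom C g = Cod C f \<longrightarrow>
        g \<cdot>\<^bsub>C\<^esub> f \<in> W_class C I Cyl \<iota>\<^sub>0 \<iota>\<^sub>1 \<longrightarrow> g \<in> W_class C I Cyl \<iota>\<^sub>0 \<iota>\<^sub>1)
     \<longleftrightarrow>
     (\<exists>(P :: 'o \<Rightarrow> 'o) (p\<^sub>0 :: 'o \<Rightarrow> 'm) (p\<^sub>1 :: 'o \<Rightarrow> 'm).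
        (\<forall>X \<in> Obj C. path_object C X (P X) (p\<^sub>0 X) (p\<^sub>1 X)) \<and>
        (\<forall>X \<in> Obj C. \<forall>Y \<in> Obj C. \<forall>f \<in> hom C X Y. \<exists>Pf.
           path_morphism C (P X) (p\<^sub>0 X) (p\<^sub>1 X) (P Y) (p\<^sub>0 Y) (p\<^sub>1 Y) f Pf) \<and>
        (\<forall>X \<in> Obj C. (\<forall>i \<in> I. rlp C i (p\<^sub>1 X)) \<or>
           (\<exists>s \<in> hom C (P X) (P X). p\<^sub>0 X \<cdot>\<^bsub>C\<^esub> s = p\<^sub>1 X \<and> p\<^sub>1 X \<cdot>\<^bsub>C\<^esub> s = p\<^sub>0 X)) \<and>
        (\<forall>X \<in> Obj C. \<forall>i \<in> I. rlp C i (p\<^sub>0 X)) \<and>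
        ((\<forall>X \<in> Obj C. reflexive_path_object C X (P X) (p\<^sub>0 X) (p\<^sub>1 X) \<and>
            pairing_rlp C (\<iota>\<^sub>0 ` I) X (P X) (p\<^sub>0 X) (p\<^sub>1 X)) \<or>
         (\<forall>f \<in> cell_class TYPE('u) C (\<iota>\<^sub>0 ` I). \<forall>i \<in> I.
            rlp_upto_obj C (path_sim C (P (Cod C f)) (p\<^sub>0 (Cod C f)) (p\<^sub>1 (Cod C f))) (Dom C i) f)))"
    (is "?cancel \<longleftrightarrow> (\<exists>P p\<^sub>0 p\<^sub>1. ?paths P p\<^sub>0 p\<^sub>1)")
proof -
  note u = assms(1) and ls = assms(3) and complete = assms(4) and co = assms(5)
  interpret category C by (rule assms(2))
  let ?J = "\<iota>\<^sub>0 ` I" and ?T = "cell_class TYPE('u) C (\<iota>\<^sub>0 ` I)"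
  interpret cylinder_category C I Cyl \<iota>\<^sub>0 \<iota>\<^sub>1
  proof
    fix i p E F x y H
    assume i: "i \<in> I" and p: "p \<in> inj_class C I" "p \<in> hom C E F"
      and rest: "x \<in> hom C (Cod C i) E" "y \<in> hom C (Cod C i) E" "x \<cdot>\<^bsub>C\<^esub> i = y \<cdot>\<^bsub>C\<^esub> i"
      "H \<in> hom C (Cyl i) F" "p \<cdot>\<^bsub>C\<^esub> x = H \<cdot>\<^bsub>C\<^esub> \<iota>\<^sub>0 i" "p \<cdot>\<^bsub>C\<^esub> y = H \<cdot>\<^bsub>C\<^esub> \<iota>\<^sub>1 i"
    have "rel_cylinder C i (Cyl i) (\<iota>\<^sub>0 i) (\<iota>\<^sub>1 i)" using assms(10)[OF i] by (simp add: reflexive_cylinder_def)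
    moreover have "rlp C d p" if "d \<in> cof_class C I" for d using that p by (simp add: cof_class_def)
    ultimately show "\<exists>G\<in>hom C (Cyl i) E. G \<cdot>\<^bsub>C\<^esub> \<iota>\<^sub>0 i = x \<and> G \<cdot>\<^bsub>C\<^esub> \<iota>\<^sub>1 i = y \<and> p \<cdot>\<^bsub>C\<^esub> G = H"
      using copairing_lift[OF u co _ assms(11)[OF i] p(2) _ rest] by blast
  qed (use assms in auto)
  have T: "rlp C f p" if "f \<in> ?T" "p \<in> inj_class C ?J" for f p using rlp_cell that by blast
  show ?thesis
  proof
    assume cancel: ?cancel
    have JA: "?J \<subseteq> Arr C" using cylD(2) by (auto simp: hom_def)
    \<comment> \<open>J consists of cofibrations, whose domains V are small relative to cofibrations\<close>
    have cof: "pushouts C ?J \<subseteq> cof_class C I"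
    proof
      fix f assume f: "f \<in> pushouts C ?J"
      then obtain i a P b where i: "i \<in> I" and po: "is_pushout C (\<iota>\<^sub>0 i) a P b f"
        by (auto simp: pushouts_def)
      have "rlp C f p" if "p \<in> inj_class C I" for p
        using rlp_pushout[OF _ po] \<iota>\<^sub>0_in_cof[OF i] that by (simp add: cof_class_def inj_class_def)
      moreover have "f \<in> Arr C" using po by (auto simp: is_pushout_def hom_def)
      ultimately show "f \<in> cof_class C I" by (simp add: cof_class_def)
    qed
    have fac: "\<exists>S. small TYPE('u) S \<and> factors_through_stages TYPE('u) C (pushouts C ?J) S (Dom C j)"
      if j: "j \<in> ?J" for j
    proof -
      obtain i where i: "i \<in> I" "j = \<iota>\<^sub>0 i" using j by blast
      have D: "Dom C j = Cod C i" using cylD(2)[OF i(1)] i(2) by (simp add: homD)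
      obtain S where S: "small TYPE('u) S"
        "factors_through_stages TYPE('u) C (cell_class TYPE('u) C I) S (Cod C i)"
        using small_relative_factors[OF assms(9)[OF i(1)]] by blast
      then have "factors_through_stages TYPE('u) C (cof_class C I) S (Cod C i)"
        using factors_through_cofibrant_stages[OF u ls co assms(6,7,8)] by blast
      then show ?thesis
        using S(1) factors_through_stages_mono[OF _ cof order_refl] unfolding D by metis
    qed
    have fac: "\<exists>E t q. t \<in> hom C X E \<and> q \<in> hom C E Y \<and> q \<cdot>\<^bsub>C\<^esub> t = f \<and> t \<in> ?T \<and> q \<in> inj_class C ?J"
      if f: "f \<in> hom C X Y" for f X Y
    proof -
      obtain E t q where "t \<in> hom C X E" "q \<in> hom C E Y" "q \<cdot>\<^bsub>C\<^esub> t = f" "t \<in> ?T" "q \<in> inj_class C ?J"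
        by (rule small_object_argument[OF u ls co JA small_image[OF assms(7)] fac f])
      then show ?thesis by blast
    qed
    obtain P p\<^sub>0 p\<^sub>1 where
      "\<forall>X \<in> Obj C. path_object C X (P X) (p\<^sub>0 X) (p\<^sub>1 X)"
      "\<forall>X \<in> Obj C. \<forall>Y \<in> Obj C. \<forall>f \<in> hom C X Y. \<exists>Pf.
         path_morphism C (P X) (p\<^sub>0 X) (p\<^sub>1 X) (P Y) (p\<^sub>0 Y) (p\<^sub>1 Y) f Pf"
      "\<forall>X \<in> Obj C. \<forall>i \<in> I. rlp C i (p\<^sub>1 X)" "\<forall>X \<in> Obj C. \<forall>i \<in> I. rlp C i (p\<^sub>0 X)"
      "\<forall>X \<in> Obj C. reflexive_path_object C X (P X) (p\<^sub>0 X) (p\<^sub>1 X) \<and>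
         pairing_rlp C ?J X (P X) (p\<^sub>0 X) (p\<^sub>1 X)"
      by (rule path_objects_exist[OF product_exists[OF u complete] T fac cancel])
    then show "\<exists>P p\<^sub>0 p\<^sub>1. ?paths P p\<^sub>0 p\<^sub>1"
      by (intro exI[of _ P] exI[of _ p\<^sub>0] exI[of _ p\<^sub>1]) simp
  next
    assume "\<exists>P p\<^sub>0 p\<^sub>1. ?paths P p\<^sub>0 p\<^sub>1"
    then obtain P p\<^sub>0 p\<^sub>1 where paths: "?paths P p\<^sub>0 p\<^sub>1" by blast
    obtain Z0 where init: "is_initial C Z0" using initial_exists[OF u co] by blast
    obtain Z1 where terminal: "Z1 \<in> Obj C" "\<forall>X \<in> Obj C. \<exists>!h. h \<in> hom C X Z1"
      using terminal_exists[OF u complete] by blast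
    show ?cancel
    proof (intro ballI impI)
      fix f g assume f: "f \<in> ?T" and g: "g \<in> Arr C" and dom: "Dom C g = Cod C f" and gf: "g \<cdot>\<^bsub>C\<^esub> f \<in> W"
      have fh: "f \<in> hom C (Dom C f) (Cod C f)" using Arr_hom[OF cell_Arr[OF f]] .
      have gh: "g \<in> hom C (Cod C f) (Cod C g)" using g dom by (simp add: hom_def)
      have BO: "Cod C f \<in> Obj C" using hom_Obj(2)[OF fh] .
      obtain Q q\<^sub>0 q\<^sub>1 where Q: "is_product C (Cod C f) (Cod C f) Q q\<^sub>0 q\<^sub>1"
        using product_exists[OF u complete BO BO] by blast
      have homotopy: "\<exists>u' \<in> hom C (Dom C i) (Dom C f). \<exists>h \<in> hom C (Dom C i) (P (Cod C f)).
          p\<^sub>0 (Cod C f) \<cdot>\<^bsub>C\<^esub> h = f \<cdot>\<^bsub>C\<^esub> u' \<and> p\<^sub>1 (Cod C f) \<cdot>\<^bsub>C\<^esub> h = u"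
        if i: "i \<in> I" and u: "u \<in> hom C (Dom C i) (Cod C f)" for i u
        using paths
      proof (elim conjE disjE)
        assume "\<forall>X \<in> Obj C. reflexive_path_object C X (P X) (p\<^sub>0 X) (p\<^sub>1 X) \<and>
            pairing_rlp C ?J X (P X) (p\<^sub>0 X) (p\<^sub>1 X)"
        with BO show ?thesis
          by (intro homotopy_from_reflexive_path_object[OF terminal Q fh T[OF f] _ _ u]) simp_all
      next
        assume "\<forall>f\<in>?T. \<forall>i\<in>I. rlp_upto_obj C (path_sim C (P (Cod C f)) (p\<^sub>0 (Cod C f)) (p\<^sub>1 (Cod C f))) (Dom C i) f"
        with f i show ?thesis by (intro rlp_upto_objE[OF init _ fh u]) simp
      qed
      show "g \<in> W"
      proof (rule left_cancellation_from_path_objects[where P=P and p\<^sub>0=p\<^sub>0 and p\<^sub>1=p\<^sub>1, OF _ _ _ _ fh gh gf homotopy])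
        show "\<exists>Pf. path_morphism C (P X) (p\<^sub>0 X) (p\<^sub>1 X) (P Y) (p\<^sub>0 Y) (p\<^sub>1 Y) f Pf"
          if "f \<in> hom C X Y" for X Y f
          using paths that hom_Obj[OF that] by blast
      qed (use paths in blast)+
    qed
  qed
qed

end
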